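(* Let $y_{\rm qc}\in\mathcal{Y}^h$ (with $y_{\rm qc}'>0$) be a local minimizer of $E_{\rm qc}$ over $\mathcal{Y}^h$ such that $\min_\ell(y_{\rm qc})'_\ell\ge r_*/2$ and $A_*(y_{\rm qc})>0$. Then there exists $\tau_0>0$, not depending on $y_{\rm a}$, such that the following holds for every $\tau\in(0,\tau_0]$: if $y_{\rm a}\in\mathcal{Y}^\varepsilon$ (with $y_{\rm a}'>0$) is a local minimizer of $E_{\rm a}$ over $\mathcal{Y}^\varepsilon$ satisfying $\|y_{\rm a}'-y_{\rm qc}'\|_{L^\infty(\Omega)}\le\tau$, and $\mu>0$ is a constant with $\min_\ell(y_{\rm a})_\ell'\ge\mu$ and $\min_\ell(y_{\rm qc})_\ell'\ge\mu$, then, with $C_{\rm H}=C_{\rm H}(\mu)$, $$\big|E_{\rm a}(y_{\rm a})-E_{\rm qc}(y_{\rm qc})\big|\le\frac{4C_{\rm H}}{A_*(y_{\rm qc})^2}\big\{\eta(y_{\rm qc})^2+(\eta^f)^2+(\eta^q)^2\big\}+\mu(y_{\rm qc})+\mu^f(y_{\rm qc})+\mu^q(y_{\rm qc}).$$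
   Context: Atomistic model. Fix $N\in\mathbb{N}$, $F>0$, $\varepsilon=1/(2N)$. $\phi\in C^3(0,\infty)$ is a potential for which there is $r_*>0$ such that $\phi$ is convex on $(0,r_* )$ and concave on $(r_*,\infty)$. A lattice function $v\in\mathbb{R}^{\mathbb{Z}}$ is identified with its continuous piecewise affine interpolant with $v(\varepsilon\ell)=v_\ell$; conversely a continuous $g$ is identified with its nodal values $g_\ell=g(\varepsilon\ell)$ where a lattice function is needed, and $I_\varepsilon g$ denotes the piecewise affine interpolant of $(g(\varepsilon\ell))_\ell$. $v'_\ell:=(v_\ell-v_{\ell-1})/\varepsilon$. $\mathcal{Y}^\varepsilon:=\{y\in\mathbb{R}^{\mathbb{Z}}:y_{\ell+2N}=F+y_\ell,\ y_0=0\}$. $f\in C^0(\mathbb{R})$ is 1-periodic. $E_{\rm a}(y)=\mathcal{E}_{\rm a}(y)-\langle f,y-Fx\rangle_\varepsilon$, where $\mathcal{E}_{\rm a}(y)=\varepsilon\sum_{\ell=-N+1}^N[\phi(y_\ell')+\phi(y_{\ell-1}'+y_\ell')]=\varepsilon\sum_{b\in\mathcal{B}}\phi(r_bD_by)$ and $\langle f,u\rangle_\varepsilon=\varepsilon\sum_{\ell=-N+1}^Nf_\ell u_\ell$. Energies are considered on deformations with positive gradient. $A_*(y):=\min_{\ell=-N+1,\dots,N}A_\ell(y)$ with $A_\ell(y):=\phi''(y_\ell')+2\phi''(y_{\ell-1}'+y_\ell')+2\phi''(y_\ell'+y_{\ell+1}')$. $C_{\rm H}(\mu):=M_2(\mu)+4M_2(2\mu)$,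 where $M_2(t):=\sup_{s\ge t}|\phi''(s)|$ (if this is infinite the estimate is void). Bonds. $\mathcal{B}:=\{(\ell\varepsilon,(\ell+j)\varepsilon):j=1,2;\ \ell=-N+1,\dots,N\}$ (open intervals); $r_b:=j$. For an open interval $\omega=(L,R)$ with $|\omega|=R-L>0$, $D_\omega v:=(v(R)-v(L))/|\omega|$. Mesh. $\Omega=[-1/2,1/2]$; $\Omega_{\rm a}=(L_{\rm a},R_{\rm a})$ with $-1/2<L_{\rm a}<R_{\rm a}<1/2$ and $R_{\rm a}-L_{\rm a}\ge2\varepsilon$; $\Omega_{\rm c}=\Omega\setminus\Omega_{\rm a}$; $\Omega_{\rm a}^\#=\Omega_{\rm a}+\mathbb{Z}$, $\Omega_{\rm c}^\#=\Omega_{\rm c}+\mathbb{Z}$. $\mathcal{T}^h$ is a partition of $\mathbb{R}$ into closed intervals $T_k^h=[x_{k-1}^h,x_k^h]$ ($k\in\mathbb{Z}$, $x^h_{k-1}<x^h_k$), of length $h_k$, such that: (T1) for some $K\in\mathbb{N}$, $x^h_{k+K}=x_k^h+1$ for all $k$; (T2) $\Omega_{\rm a}\cap\varepsilon\mathbb{Z}=\Omega_{\rm a}\cap\{x_k^h\}_{k\in\mathbb{Z}}$; (T3) $L_{\rm a},R_{\rm a}\in\{x_k^h\}$; (T4) $h_k\ge2\varepsilon$ whenever $T_k^h\subset\Omega_{\rm c}^\#$. Moreover $0$ is a mesh node. Nodes are numbered so that $x_1^h,\dots,x_K^h$ are exactly the nodes in $(-1/2,1/2]$. $\mathcal{P}_1(\mathcal{T}^h)$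 is the space of continuous functions affine on each $T_k^h$; $\mathcal{U}^h:=\{u\in\mathcal{P}_1(\mathcal{T}^h):u\text{ 1-periodic},\ u(0)=0\}$, $\mathcal{Y}^h:=\{y\in\mathcal{P}_1(\mathcal{T}^h):y-Fx\in\mathcal{U}^h\}$. $I_h:C^0(\mathbb{R})\to\mathcal{P}_1(\mathcal{T}^h)$ is nodal interpolation. $\mathcal{K}_{\rm c}:=\{k\in\{1,\dots,K\}:x_k^h\in\Omega_{\rm c}\}$. "$x_k^h\in b$ (mod 1)" means $x_k^h+m\in b$ for some $m\in\mathbb{Z}$. QC model. $E_{\rm qc}(y)=\mathcal{E}_{\rm qc}(y)-\langle f,y-Fx\rangle_h$, $\langle f,u\rangle_h=\int_\Omega I_h(fu)\,dx$, $\mathcal{E}_{\rm qc}(y)=\varepsilon\sum_{b\in\mathcal{B}}[a_b(y)+c_b(y)]$, $a_b(y)=\frac{|b\cap\Omega_{\rm a}^\#|}{|b|}\phi(r_bD_{b\cap\Omega_{\rm a}^\#}y)$ (with $a_b\equiv0$ if $|b\cap\Omega_{\rm a}^\#|=0$; $b\cap\Omega_{\rm a}^\#$ is empty or an open interval), $c_b(y)=\frac1{|b|}\int_{b\cap\Omega_{\rm c}^\#}\phi(r_by'(x))\,dx$. Residual estimators. $\eta(y_h):=(3\sum_{k\in\mathcal{K}_{\rm c}}\eta_k^2)^{1/2}$ with $\eta_k^2:=\sum_{b\in\mathcal{B},\,x_k^h\in b\,(\mathrm{mod}\,1)}\big(\|\phi'(r_bD_by_h)-\phi'(r_bD_{b\cap\Omega_{\rm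 a}^\#}y_h)\|_{L^2(b\cap\Omega_{\rm a}^\#)}^2+\|\phi'(r_bD_by_h)-\phi'(r_by_h')\|_{L^2(b\cap\Omega_{\rm c}^\#)}^2\big)$. Let $T_\ell^\varepsilon=((\ell-1)\varepsilon,\ell\varepsilon)$ and let $\tilde\Omega_{\rm c}$ be the union of the closures of all $T_\ell^\varepsilon$, $\ell\in\mathbb{Z}$, with $|T_\ell^\varepsilon\cap\Omega_{\rm c}^\#|>0$. It is assumed that $f\in C^2(\tilde\Omega_{\rm c})$, meaning: $f$ is $C^2$ on $\tilde\Omega_{\rm c}\cap[-1/2,1/2]$ (one-sided at boundary points) and, in case $1/2$ is not a mesh node, also $C^2$ near $1/2$. For $*\in\{f,q\}$, $(\eta^* )^2:=\sum_{k\in\{1,\dots,K\},\,T_k^h\subset\tilde\Omega_{\rm c}}(\eta^*_k)^2$, $(\eta_k^f)^2:=\frac{h_k^2}{\pi^2}\|f\|_{L^2(T_k^h)}^2$, $(\eta_k^q)^2:=(\varepsilon^4+h_k^4)\|f'\|^2_{L^2(T_k^h)}+\frac{\varepsilon^4+h_k^4}{4\pi^2}\|f''\|_{L^2(T_k^h)}^2$. Energy estimators. For $y_h\in\mathcal{Y}^h$ and $u_h:=y_h-Fx$: $\mu(y_h):=\sum_{k\in\mathcal{K}_{\rm c}}\mu_k$ with $\mu_k:=\Big|\sum_{b\in\mathcal{B},\,x_k^h\in b\,(\mathrm{mod}\,1)}\Big\{\frac{|b\cap\Omega_{\rm a}^\#|}{r_b}\big[\phi(r_bD_by_h)-\phi(r_bD_{b\cap\Omega_{\rm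 a}^\#}y_h)\big]+\frac1{r_b}\int_{b\cap\Omega_{\rm c}^\#}\big[\phi(r_bD_by_h)-\phi(r_by_h')\big]dx\Big\}\Big|$; $\mu^f(y_h):=\sum_{k\in\mathcal{K}_{\rm c}}\frac\varepsilon2\|f\|_{L^1(\omega_k)}\big|[u_h']_{x_k^h}\big|$, where $\omega_k=T_\ell^\varepsilon$ if $(\ell-1)\varepsilon<x_k^h<\ell\varepsilon$ for some $\ell\in\mathbb{Z}$ and $\omega_k=\emptyset$ otherwise, and $[u_h']_{x_k^h}:=u_h'(x_k^h+)-u_h'(x_k^h-)$; $\mu^q(y_h):=\sum_{k\in\{1,\dots,K\},\,T_k^h\subset\tilde\Omega_{\rm c}}\Big(\frac{\varepsilon^2}4\|(fI_\varepsilon u_h)''\|_{L^1(T_k^h)}+\frac{h_k^2}4\|(fu_h)''\|_{L^1(T_k^h)}\Big)$, second derivatives being understood piecewise. *)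

theory Defs
  imports "HOL-Analysis.Analysis"
begin

section \<open>Calculus\<close>

text \<open>\<open>C\<^sup>n\<close> regularity with derivatives relative to the set: the usual notion on open sets,
  and one-sided derivatives at the end points of a closed nondegenerate interval.\<close>

definition Ck_on :: "nat \<Rightarrow> real set \<Rightarrow> (real \<Rightarrow> real) \<Rightarrow> bool" where
  "Ck_on n S f \<longleftrightarrow> (\<exists>g :: nat \<Rightarrow> real \<Rightarrow> real.
     (\<forall>t\<in>S. g 0 t = f t) \<and>
     (\<forall>j<n. \<forall>t\<in>S. (g j has_real_derivative g (Suc j) t) (at t within S)) \<and>
     continuous_on S (g n))"

text \<open>In all the integrals below the integrands are defined and continuous off a finite set,
  at whose points \<^const>\<open>deriv\<close> returns an unspecified, irrelevant value.\<close>

definition L1norm :: "real set \<Rightarrow> (real \<Rightarrow> real) \<Rightarrow> real" where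
  "L1norm S g = integral S (\<lambda>t. \<bar>g t\<bar>)"

definition L2norm :: "real set \<Rightarrow> (real \<Rightarrow> real) \<Rightarrow> real" where
  "L2norm S g = sqrt (integral S (\<lambda>t. (g t)\<^sup>2))"

definition periodic_ext :: "real set \<Rightarrow> real set" where
  "periodic_ext S = (\<Union>m::int. (\<lambda>t. t + of_int m) ` S)"

text \<open>The difference quotient \<open>(v(R) - v(L)) / (R - L)\<close> for \<open>\<omega> = (L,R)\<close>.\<close>

definition diffq :: "real set \<Rightarrow> (real \<Rightarrow> real) \<Rightarrow> real" where
  "diffq \<omega> v = (v (Sup \<omega>) - v (Inf \<omega>)) / (Sup \<omega> - Inf \<omega>)"

text \<open>Continuous piecewise affine interpolation of the values \<open>v k\<close> at the increasing nodes \<open>X k\<close>.\<close>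

definition pw_interp :: "(int \<Rightarrow> real) \<Rightarrow> (int \<Rightarrow> real) \<Rightarrow> real \<Rightarrow> real" where
  "pw_interp X v t = (let k = (THE k. X (k - 1) \<le> t \<and> t < X k) in
     v (k - 1) + (t - X (k - 1)) / (X k - X (k - 1)) * (v k - v (k - 1)))"

text \<open>Local minimality within a set of functions, with respect to the sup distance. It is used on
  affine spaces whose (periodic) differences form a finite-dimensional space, so that the choice
  of the norm does not matter.\<close>

definition local_minimizer :: "(('i \<Rightarrow> real) \<Rightarrow> real) \<Rightarrow> ('i \<Rightarrow> real) set \<Rightarrow> ('i \<Rightarrow> real) \<Rightarrow> bool" where
  "local_minimizer E A y \<longleftrightarrow>
     y \<in> A \<and> (\<exists>\<delta>>0. \<forall>z\<in>A. (\<forall>i. \<bar>z i - y i\<bar> < \<delta>) \<longrightarrow> E y \<le> E z)"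


section \<open>Atomistic model\<close>

definition eps :: "nat \<Rightarrow> real" where
  "eps N = 1 / (2 * real N)"

definition lat :: "nat \<Rightarrow> int \<Rightarrow> real" where
  "lat N l = eps N * of_int l"

definition nodal :: "nat \<Rightarrow> (real \<Rightarrow> real) \<Rightarrow> int \<Rightarrow> real" where
  "nodal N g l = g (lat N l)"

definition I_eps :: "nat \<Rightarrow> (real \<Rightarrow> real) \<Rightarrow> real \<Rightarrow> real" where
  "I_eps N g = pw_interp (lat N) (nodal N g)"

definition ldiff :: "nat \<Rightarrow> (int \<Rightarrow> real) \<Rightarrow> int \<Rightarrow> real" where
  "ldiff N v l = (v l - v (l - 1)) / eps N"

definition cell :: "nat \<Rightarrow> int set" where
  "cell N = {- int N + 1..int N}"

definition Y_eps :: "nat \<Rightarrow> real \<Rightarrow> (int \<Rightarrow> real) set" where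
  "Y_eps N F = {y. (\<forall>l. y (l + 2 * int N) = F + y l) \<and> y 0 = 0}"

definition Y_eps_pos :: "nat \<Rightarrow> real \<Rightarrow> (int \<Rightarrow> real) set" where
  "Y_eps_pos N F = {y \<in> Y_eps N F. \<forall>l. ldiff N y l > 0}"

definition ip_eps :: "nat \<Rightarrow> (real \<Rightarrow> real) \<Rightarrow> (int \<Rightarrow> real) \<Rightarrow> real" where
  "ip_eps N f u = eps N * (\<Sum>l\<in>cell N. nodal N f l * u l)"

definition E_a_int :: "nat \<Rightarrow> (real \<Rightarrow> real) \<Rightarrow> (int \<Rightarrow> real) \<Rightarrow> real" where
  "E_a_int N \<phi> y =
     eps N * (\<Sum>l\<in>cell N. \<phi> (ldiff N y l) + \<phi> (ldiff N y (l - 1) + ldiff N y l))"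

definition E_a ::
  "nat \<Rightarrow> real \<Rightarrow> (real \<Rightarrow> real) \<Rightarrow> (real \<Rightarrow> real) \<Rightarrow> (int \<Rightarrow> real) \<Rightarrow> real" where
  "E_a N F \<phi> f y = E_a_int N \<phi> y - ip_eps N f (\<lambda>l. y l - F * lat N l)"

definition A_coef :: "nat \<Rightarrow> (real \<Rightarrow> real) \<Rightarrow> (int \<Rightarrow> real) \<Rightarrow> int \<Rightarrow> real" where
  "A_coef N \<phi> y l = deriv (deriv \<phi>) (ldiff N y l)
     + 2 * deriv (deriv \<phi>) (ldiff N y (l - 1) + ldiff N y l)
     + 2 * deriv (deriv \<phi>) (ldiff N y l + ldiff N y (l + 1))"

definition A_star :: "nat \<Rightarrow> (real \<Rightarrow> real) \<Rightarrow> (int \<Rightarrow> real) \<Rightarrow> real" where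
  "A_star N \<phi> y = Min (A_coef N \<phi> y ` cell N)"

text \<open>\<open>M2\<close> is only meaningful when the supremum is finite.\<close>

definition M2 :: "(real \<Rightarrow> real) \<Rightarrow> real \<Rightarrow> real" where
  "M2 \<phi> t = (SUP s\<in>{t..}. \<bar>deriv (deriv \<phi>) s\<bar>)"

definition C_H :: "(real \<Rightarrow> real) \<Rightarrow> real \<Rightarrow> real" where
  "C_H \<phi> \<mu> = M2 \<phi> \<mu> + 4 * M2 \<phi> (2 * \<mu>)"


section \<open>Bonds and mesh\<close>

text \<open>A bond is encoded by the pair \<open>(l, j)\<close>, which stands for the interval
  \<open>(l \<epsilon>, (l + j) \<epsilon>)\<close>; its range \<open>r\<^sub>b\<close> is \<open>j\<close>.\<close>

definition bonds :: "nat \<Rightarrow> (int \<times> nat) set" where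
  "bonds N = cell N \<times> {1, 2}"

definition bond :: "nat \<Rightarrow> int \<times> nat \<Rightarrow> real set" where
  "bond N b = {lat N (fst b)<..<lat N (fst b + int (snd b))}"

definition rb :: "int \<times> nat \<Rightarrow> real" where
  "rb b = real (snd b)"

definition Om :: "real set" where
  "Om = {-1/2..1/2}"

definition Om_c :: "real \<Rightarrow> real \<Rightarrow> real set" where
  "Om_c La Ra = Om - {La<..<Ra}"

definition bond_a :: "nat \<Rightarrow> real \<Rightarrow> real \<Rightarrow> int \<times> nat \<Rightarrow> real set" where
  "bond_a N La Ra b = bond N b \<inter> periodic_ext {La<..<Ra}"

definition bond_c :: "nat \<Rightarrow> real \<Rightarrow> real \<Rightarrow> int \<times> nat \<Rightarrow> real set" where
  "bond_c N La Ra b = bond N b \<inter> periodic_ext (Om_c La Ra)"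

definition elem :: "(int \<Rightarrow> real) \<Rightarrow> int \<Rightarrow> real set" where
  "elem X k = {X (k - 1)..X k}"

definition hk :: "(int \<Rightarrow> real) \<Rightarrow> int \<Rightarrow> real" where
  "hk X k = X k - X (k - 1)"

definition qc_mesh :: "nat \<Rightarrow> real \<Rightarrow> real \<Rightarrow> nat \<Rightarrow> (int \<Rightarrow> real) \<Rightarrow> bool" where
  "qc_mesh N La Ra K X \<longleftrightarrow>
     (\<forall>k. X (k - 1) < X k) \<and>
     (\<forall>k. X (k + int K) = X k + 1) \<and>
     {La<..<Ra} \<inter> range (lat N) = {La<..<Ra} \<inter> range X \<and>
     La \<in> range X \<and> Ra \<in> range X \<and>
     (\<forall>k. elem X k \<subseteq> periodic_ext (Om_c La Ra) \<longrightarrow> hk X k \<ge> 2 * eps N) \<and>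
     0 \<in> range X \<and>
     X ` {1..int K} = range X \<inter> {-1/2<..1/2}"

definition P1 :: "(int \<Rightarrow> real) \<Rightarrow> (real \<Rightarrow> real) set" where
  "P1 X = {g. continuous_on UNIV g \<and> (\<forall>k. \<exists>a b. \<forall>t\<in>elem X k. g t = a + b * t)}"

definition U_h :: "(int \<Rightarrow> real) \<Rightarrow> (real \<Rightarrow> real) set" where
  "U_h X = {u \<in> P1 X. (\<forall>t. u (t + 1) = u t) \<and> u 0 = 0}"

definition Y_h :: "real \<Rightarrow> (int \<Rightarrow> real) \<Rightarrow> (real \<Rightarrow> real) set" where
  "Y_h F X = {y \<in> P1 X. (\<lambda>t. y t - F * t) \<in> U_h X}"

definition Y_h_pos :: "real \<Rightarrow> (int \<Rightarrow> real) \<Rightarrow> (real \<Rightarrow> real) set" where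
  "Y_h_pos F X = {y \<in> Y_h F X. \<forall>k. \<forall>t\<in>{X (k - 1)<..<X k}. deriv y t > 0}"

definition I_h :: "(int \<Rightarrow> real) \<Rightarrow> (real \<Rightarrow> real) \<Rightarrow> real \<Rightarrow> real" where
  "I_h X g = pw_interp X (\<lambda>k. g (X k))"

definition K_c :: "real \<Rightarrow> real \<Rightarrow> nat \<Rightarrow> (int \<Rightarrow> real) \<Rightarrow> int set" where
  "K_c La Ra K X = {k \<in> {1..int K}. X k \<in> Om_c La Ra}"

definition bonds_at :: "nat \<Rightarrow> real \<Rightarrow> (int \<times> nat) set" where
  "bonds_at N t = {b \<in> bonds N. \<exists>m::int. t + of_int m \<in> bond N b}"


section \<open>Quasicontinuum model\<close>

definition ip_h :: "(int \<Rightarrow> real) \<Rightarrow> (real \<Rightarrow> real) \<Rightarrow> (real \<Rightarrow> real) \<Rightarrow> real" where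
  "ip_h X f u = integral Om (I_h X (\<lambda>t. f t * u t))"

definition a_bond ::
  "nat \<Rightarrow> real \<Rightarrow> real \<Rightarrow> (real \<Rightarrow> real) \<Rightarrow> (real \<Rightarrow> real) \<Rightarrow> int \<times> nat \<Rightarrow> real" where
  "a_bond N La Ra \<phi> y b =
     (if measure lborel (bond_a N La Ra b) = 0 then 0
      else measure lborel (bond_a N La Ra b) / measure lborel (bond N b)
             * \<phi> (rb b * diffq (bond_a N La Ra b) y))"

definition c_bond ::
  "nat \<Rightarrow> real \<Rightarrow> real \<Rightarrow> (real \<Rightarrow> real) \<Rightarrow> (real \<Rightarrow> real) \<Rightarrow> int \<times> nat \<Rightarrow> real" where
  "c_bond N La Ra \<phi> y b =
     1 / measure lborel (bond N b) * integral (bond_c N La Ra b) (\<lambda>t. \<phi> (rb b * deriv y t))"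

definition E_qc_int ::
  "nat \<Rightarrow> real \<Rightarrow> real \<Rightarrow> (real \<Rightarrow> real) \<Rightarrow> (real \<Rightarrow> real) \<Rightarrow> real" where
  "E_qc_int N La Ra \<phi> y =
     eps N * (\<Sum>b\<in>bonds N. a_bond N La Ra \<phi> y b + c_bond N La Ra \<phi> y b)"

definition E_qc ::
  "nat \<Rightarrow> real \<Rightarrow> real \<Rightarrow> real \<Rightarrow> (int \<Rightarrow> real) \<Rightarrow> (real \<Rightarrow> real) \<Rightarrow> (real \<Rightarrow> real)
     \<Rightarrow> (real \<Rightarrow> real) \<Rightarrow> real" where
  "E_qc N F La Ra X \<phi> f y = E_qc_int N La Ra \<phi> y - ip_h X f (\<lambda>t. y t - F * t)"


section \<open>Residual estimators\<close>

definition eta_sq ::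
  "nat \<Rightarrow> real \<Rightarrow> real \<Rightarrow> (int \<Rightarrow> real) \<Rightarrow> (real \<Rightarrow> real) \<Rightarrow> (real \<Rightarrow> real) \<Rightarrow> int \<Rightarrow> real" where
  "eta_sq N La Ra X \<phi> y k = (\<Sum>b\<in>bonds_at N (X k).
     (L2norm (bond_a N La Ra b)
        (\<lambda>t. deriv \<phi> (rb b * diffq (bond N b) y)
              - deriv \<phi> (rb b * diffq (bond_a N La Ra b) y)))\<^sup>2
   + (L2norm (bond_c N La Ra b)
        (\<lambda>t. deriv \<phi> (rb b * diffq (bond N b) y) - deriv \<phi> (rb b * deriv y t)))\<^sup>2)"

definition eta ::
  "nat \<Rightarrow> real \<Rightarrow> real \<Rightarrow> nat \<Rightarrow> (int \<Rightarrow> real) \<Rightarrow> (real \<Rightarrow> real) \<Rightarrow> (real \<Rightarrow> real) \<Rightarrow> real" where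
  "eta N La Ra K X \<phi> y = sqrt (3 * (\<Sum>k\<in>K_c La Ra K X. eta_sq N La Ra X \<phi> y k))"

definition T_eps :: "nat \<Rightarrow> int \<Rightarrow> real set" where
  "T_eps N l = {lat N (l - 1)<..<lat N l}"

definition Om_ct :: "nat \<Rightarrow> real \<Rightarrow> real \<Rightarrow> real set" where
  "Om_ct N La Ra =
     (\<Union>l\<in>{l. measure lborel (T_eps N l \<inter> periodic_ext (Om_c La Ra)) > 0}. closure (T_eps N l))"

definition elems_c :: "nat \<Rightarrow> real \<Rightarrow> real \<Rightarrow> nat \<Rightarrow> (int \<Rightarrow> real) \<Rightarrow> int set" where
  "elems_c N La Ra K X = {k \<in> {1..int K}. elem X k \<subseteq> Om_ct N La Ra}"

text \<open>A kink of the periodic function \<open>f\<close> at \<open>1/2\<close> is allowed if \<open>1/2\<close> is a mesh node.\<close>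

definition f_regular ::
  "nat \<Rightarrow> real \<Rightarrow> real \<Rightarrow> (int \<Rightarrow> real) \<Rightarrow> (real \<Rightarrow> real) \<Rightarrow> bool" where
  "f_regular N La Ra X f \<longleftrightarrow>
     Ck_on 2 (Om_ct N La Ra \<inter> {-1/2..1/2}) f \<and>
     (1/2 \<notin> range X \<longrightarrow> (\<exists>\<delta>>0. Ck_on 2 {1/2 - \<delta><..<1/2 + \<delta>} f))"

definition eta_f ::
  "nat \<Rightarrow> real \<Rightarrow> real \<Rightarrow> nat \<Rightarrow> (int \<Rightarrow> real) \<Rightarrow> (real \<Rightarrow> real) \<Rightarrow> real" where
  "eta_f N La Ra K X f = sqrt (\<Sum>k\<in>elems_c N La Ra K X.
     (hk X k)\<^sup>2 / pi\<^sup>2 * (L2norm (elem X k) f)\<^sup>2)"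

definition eta_q ::
  "nat \<Rightarrow> real \<Rightarrow> real \<Rightarrow> nat \<Rightarrow> (int \<Rightarrow> real) \<Rightarrow> (real \<Rightarrow> real) \<Rightarrow> real" where
  "eta_q N La Ra K X f = sqrt (\<Sum>k\<in>elems_c N La Ra K X.
     (eps N ^ 4 + hk X k ^ 4) * (L2norm (elem X k) (deriv f))\<^sup>2
     + (eps N ^ 4 + hk X k ^ 4) / (4 * pi\<^sup>2) * (L2norm (elem X k) (deriv (deriv f)))\<^sup>2)"


section \<open>Energy estimators\<close>

definition mu_k ::
  "nat \<Rightarrow> real \<Rightarrow> real \<Rightarrow> (int \<Rightarrow> real) \<Rightarrow> (real \<Rightarrow> real) \<Rightarrow> (real \<Rightarrow> real) \<Rightarrow> int \<Rightarrow> real" where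
  "mu_k N La Ra X \<phi> y k = \<bar>\<Sum>b\<in>bonds_at N (X k).
     measure lborel (bond_a N La Ra b) / rb b
       * (\<phi> (rb b * diffq (bond N b) y) - \<phi> (rb b * diffq (bond_a N La Ra b) y))
     + 1 / rb b * integral (bond_c N La Ra b)
         (\<lambda>t. \<phi> (rb b * diffq (bond N b) y) - \<phi> (rb b * deriv y t))\<bar>"

definition mu_est ::
  "nat \<Rightarrow> real \<Rightarrow> real \<Rightarrow> nat \<Rightarrow> (int \<Rightarrow> real) \<Rightarrow> (real \<Rightarrow> real) \<Rightarrow> (real \<Rightarrow> real) \<Rightarrow> real" where
  "mu_est N La Ra K X \<phi> y = (\<Sum>k\<in>K_c La Ra K X. mu_k N La Ra X \<phi> y k)"

text \<open>The open lattice cell containing \<open>t\<close>; empty if \<open>t\<close> is a lattice point.\<close>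

definition omega :: "nat \<Rightarrow> real \<Rightarrow> real set" where
  "omega N t = (\<Union>l\<in>{l. t \<in> T_eps N l}. T_eps N l)"

definition jump :: "(real \<Rightarrow> real) \<Rightarrow> real \<Rightarrow> real" where
  "jump g t = Lim (at_right t) g - Lim (at_left t) g"

definition mu_f ::
  "nat \<Rightarrow> real \<Rightarrow> real \<Rightarrow> real \<Rightarrow> nat \<Rightarrow> (int \<Rightarrow> real) \<Rightarrow> (real \<Rightarrow> real) \<Rightarrow> (real \<Rightarrow> real)
     \<Rightarrow> real" where
  "mu_f N F La Ra K X f y = (\<Sum>k\<in>K_c La Ra K X.
     eps N / 2 * L1norm (omega N (X k)) f * \<bar>jump (deriv (\<lambda>t. y t - F * t)) (X k)\<bar>)"

definition mu_q ::
  "nat \<Rightarrow> real \<Rightarrow> real \<Rightarrow> real \<Rightarrow> nat \<Rightarrow> (int \<Rightarrow> real) \<Rightarrow> (real \<Rightarrow> real) \<Rightarrow> (real \<Rightarrow> real)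
     \<Rightarrow> real" where
  "mu_q N F La Ra K X f y = (let u = (\<lambda>t. y t - F * t) in
     \<Sum>k\<in>elems_c N La Ra K X.
       (eps N)\<^sup>2 / 4 * L1norm (elem X k) (deriv (deriv (\<lambda>t. f t * I_eps N u t)))
       + (hk X k)\<^sup>2 / 4 * L1norm (elem X k) (deriv (deriv (\<lambda>t. f t * u t))))"

end

theory Submission
  imports Defs
begin

text \<open>Write \<open>Y\<close> for the lattice values of \<open>yqc\<close> and \<open>e = Y - ya\<close>. Since \<open>ya\<close> is critical, a Taylor expansion
  along \<open>ya + s e\<close> bounds the difference of the atomistic energies at \<open>ya\<close> and \<open>Y\<close> by \<open>C_H / 2\<close> times
  \<open>V = \<parallel>e'\<parallel>\<^sup>2\<close>. The second neighbour coefficients at \<open>Y\<close> are nonpositive, so near \<open>Y\<close> the Hessian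
  is at least \<open>7/8\<close> of the stability constant \<open>A_star\<close>, and \<open>V\<close> is controlled by the residual of \<open>Y\<close> in direction \<open>e\<close>.
  The residual is compared with the vanishing derivative of \<open>E_qc\<close> at \<open>yqc\<close> in the direction of the mesh
  interpolant of \<open>e\<close>. The interaction part becomes a sum over bonds of stress differences, which
  vanish on every bond containing no mesh node of the continuum region. The force part is a
  difference of two trapezoidal rules that agree off \<open>Om_ct\<close> and is expressed through Peano kernels
  on \<open>Om_ct\<close>. All terms are estimated by Young's inequality under the integral, with one weight
  \<open>\<alpha>\<close> fixed at the end. The remaining difference of \<open>E_a\<close> at \<open>Y\<close> and \<open>E_qc\<close> at \<open>yqc\<close> consists of the same
  bond defects and quadrature errors, now for the energies themselves.\<close>

text \<open>Why the constants fit: suppose a fraction c of the stability constant A survives near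
  the lattice values, and the residual is at most \<alpha>/2 times S plus 3/\<alpha> times V, where
  S is the sum of the three squared estimators. The choice \<alpha> = 6/(cA) absorbs half of the
  left side and gives V at most 6 S/(cA)^2, hence an energy difference of at most 3/c^2 times C_H
  S/A^2. The factor 4 of the claim therefore allows any c with c^2 at least 3/4; c = 7/8 is taken,
  and this fixes how small \<open>\<tau>0\<close> has to be. The obstacle is that two unrelated
  grids meet. Gradients of lattice functions jump at lattice points, those of mesh functions at
  nodes, and f has second derivatives on part of the line only. Identities are therefore stated off
  a locally finite set, and no common refinement is ever formed. The direction e lives on the
  lattice and is not admissible in the quasicontinuum problem; its mesh interpolant can replace it
  because both have the same increments over every piece on which the quasicontinuum stress is
  constant.\<close>

section \<open>Piecewise continuous functions\<close>

text \<open>The exceptional set is only required to be sparse, so sums and products of functions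
  that jump on different grids stay in the class. Boundedness near each point, with the point itself
  left out, gives integrability on compact intervals although the values at jumps are
  arbitrary.\<close>

definition pwc :: "(real \<Rightarrow> real) \<Rightarrow> bool" where
  "pwc g \<longleftrightarrow> (\<forall>\<^sub>\<approx>t. isCont g t) \<and> (\<forall>t. \<exists>B. \<forall>\<^sub>F s in at t. \<bar>g s\<bar> \<le> B)"

lemma cosparse_real_iff: "(\<forall>\<^sub>\<approx>t. P t) \<longleftrightarrow> (\<forall>t::real. \<forall>\<^sub>F s in at t. P s)"
  by (simp add: eventually_cosparse_open_eq)

lemma cosparse_finite:
  assumes "\<forall>\<^sub>\<approx>t::real. P t"
  shows "finite {t\<in>{a..b}. \<not> P t}"
proof -
  have "{t. \<not> P t} sparse_in {a..b}"
    using assms by (auto simp: eventually_cosparse intro: sparse_in_subset)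
  from sparse_in_compact_finite[OF this compact_Icc] show ?thesis
    by (simp add: Int_def)
qed

lemma pwc_bounded:
  assumes "pwc g"
  shows "bounded (g ` {a..b})"
proof (cases "a \<le> b")
  case True
  then show ?thesis
  proof (induction rule: Bolzano)
    case (trans a b c)
    then show ?case
      by (metis bounded_Un image_Un ivl_disj_un_two_touch(4))
  next
    case (local x)
    obtain B where "\<forall>\<^sub>F s in at x. \<bar>g s\<bar> \<le> B"
      using assms by (auto simp: pwc_def)
    then obtain d where d: "d > 0" "\<And>s. s \<noteq> x \<Longrightarrow> dist s x < d \<Longrightarrow> \<bar>g s\<bar> \<le> B"
      by (auto simp: eventually_at)
    have "bounded (g ` {a..b})" if "a \<le> x" "x \<le> b" "b - a < d" for a b
      unfolding bounded_iff
    \<comment> \<open>The local bound says nothing about x itself, so the value there is added by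
      hand.\<close>
    proof (intro exI[of _ "max B \<bar>g x\<bar>"] ballI)
      fix y assume "y \<in> g ` {a..b}"
      then obtain s where "s \<in> {a..b}" "y = g s" by blast
      moreover from this that have "dist s x < d" by (auto simp: dist_real_def)
      ultimately show "norm y \<le> max B \<bar>g x\<bar>"
        using d(2)[of s] by (cases "s = x") auto
    qed
    with d(1) show ?case by blast
  qed
qed auto

text \<open>Off the finitely many discontinuities in the interval the function is Borel and bounded,
  and a finite set is negligible.\<close>

lemma pwc_integrable:
  assumes "pwc g"
  shows "g integrable_on {a..b}"
proof -
  define S where "S = {t\<in>{a..b}. \<not> isCont g t}"
  have fin: "finite S"
    unfolding S_def using assms by (intro cosparse_finite) (simp add: pwc_def)
  obtain B where B: "\<And>t. t \<in> {a..b} \<Longrightarrow> \<bar>g t\<bar> \<le> B"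
    using pwc_bounded[OF assms, of a b] unfolding bounded_iff by force
  have meas: "(\<lambda>t. indicator ({a..b} - S) t *\<^sub>R g t) \<in> borel_measurable borel"
    by (intro borel_measurable_continuous_on_indicator continuous_at_imp_continuous_on)
      (use fin in \<open>auto simp: S_def intro!: sets.Diff dest: finite_imp_closed intro: borel_closed\<close>)
  have "set_integrable lborel ({a..b} - S) g"
    unfolding set_integrable_def
  proof (rule Bochner_Integration.integrable_bound)
    show "integrable lborel (\<lambda>t. indicator {a..b} t *\<^sub>R B)"
      by (auto simp: emeasure_lborel_Icc_eq intro!: integrable_real_indicator)
    show "AE t in lborel. norm (indicator ({a..b} - S) t *\<^sub>R g t)
        \<le> norm (indicator {a..b} t *\<^sub>R B)"
      by (rule AE_I2) (use B in \<open>fastforce simp: indicator_def\<close>)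
  qed (use meas in simp)
  then have "g integrable_on {a..b} - S"
    by (rule set_borel_integral_eq_integral(1))
  then show ?thesis
    by (rule integrable_spike_set)
       (auto intro: negligible_subset[OF negligible_finite[OF fin]])
qed

lemma pwc_continuous: "continuous_on UNIV g \<Longrightarrow> pwc g"
proof -
  assume g: "continuous_on UNIV g"
  then have c: "isCont g t" for t
    by (simp add: continuous_on_eq_continuous_at)
  have "\<forall>\<^sub>F s in at t. \<bar>g s\<bar> \<le> \<bar>g t\<bar> + 1" for t
  proof -
    have "((\<lambda>s. \<bar>g s\<bar>) \<longlongrightarrow> \<bar>g t\<bar>) (at t)"
      using c[of t] unfolding isCont_def by (intro tendsto_intros)
    then have "\<forall>\<^sub>F s in at t. \<bar>g s\<bar> < \<bar>g t\<bar> + 1"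
      by (rule order_tendstoD) simp
    then show ?thesis by eventually_elim simp
  qed
  then show "pwc g" unfolding pwc_def using c by (auto simp: cosparse_real_iff)
qed

lemma pwc_const [simp]: "pwc (\<lambda>t. c)"
  by (rule pwc_continuous) simp

text \<open>One scheme for all closure properties: F has to respect continuity at a point and to
  send bounded pairs to bounded values, with D tracking the bound.\<close>

lemma pwc_binop:
  assumes "pwc g" "pwc h"
    and op: "\<And>t. isCont g t \<Longrightarrow> isCont h t \<Longrightarrow> isCont (\<lambda>t. F (g t) (h t)) t"
    and bd: "\<And>x y B C. \<bar>x\<bar> \<le> B \<Longrightarrow> \<bar>y\<bar> \<le> C \<Longrightarrow> \<bar>F x y\<bar> \<le> D B C"
  shows "pwc (\<lambda>t. F (g t) (h t))"
  unfolding pwc_def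
proof (intro conjI allI)
  from assms have "\<forall>\<^sub>\<approx>t. isCont g t" "\<forall>\<^sub>\<approx>t. isCont h t"
    by (auto simp: pwc_def)
  then show "\<forall>\<^sub>\<approx>t. isCont (\<lambda>t. F (g t) (h t)) t"
    by eventually_elim (rule op)
next
  fix t
  from assms obtain B C where "\<forall>\<^sub>F s in at t. \<bar>g s\<bar> \<le> B" "\<forall>\<^sub>F s in at t. \<bar>h s\<bar> \<le> C"
    unfolding pwc_def by metis
  then have "\<forall>\<^sub>F s in at t. \<bar>F (g s) (h s)\<bar> \<le> D B C"
    by eventually_elim (rule bd)
  then show "\<exists>B. \<forall>\<^sub>F s in at t. \<bar>F (g s) (h s)\<bar> \<le> B" ..
qed

lemma pwc_add: "pwc g \<Longrightarrow> pwc h \<Longrightarrow> pwc (\<lambda>t. g t + h t)"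
  by (rule pwc_binop[where D = "(+)"]) (auto intro!: continuous_intros)

lemma pwc_diff: "pwc g \<Longrightarrow> pwc h \<Longrightarrow> pwc (\<lambda>t. g t - h t)"
  by (rule pwc_binop[where D = "(+)"]) (auto intro!: continuous_intros)

lemma pwc_mult: "pwc g \<Longrightarrow> pwc h \<Longrightarrow> pwc (\<lambda>t. g t * h t)"
  by (rule pwc_binop[where D = "\<lambda>B C. B * C"])
    (auto intro!: continuous_intros mult_mono simp: abs_mult)

lemma pwc_abs: "pwc g \<Longrightarrow> pwc (\<lambda>t. \<bar>g t\<bar>)"
  by (rule pwc_binop[where F = "\<lambda>x y. \<bar>x\<bar>" and h = "\<lambda>t. 0" and D = "\<lambda>B C. B"])
    (auto intro!: continuous_intros)

lemma pwc_power2: "pwc g \<Longrightarrow> pwc (\<lambda>t. (g t)\<^sup>2)"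
  unfolding power2_eq_square by (rule pwc_mult)

lemmas pwc_intros = pwc_const pwc_add pwc_diff pwc_mult pwc_abs pwc_power2

lemma integral_cosparse_cong:
  fixes g h :: "real \<Rightarrow> real"
  assumes "\<forall>\<^sub>\<approx>t. t \<in> {a<..<b} \<longrightarrow> g t = h t"
  shows "integral {a..b} g = integral {a..b} h"
proof (rule integral_spike)
  have "finite ({t\<in>{a..b}. \<not> (t \<in> {a<..<b} \<longrightarrow> g t = h t)} \<union> {a, b})"
    using cosparse_finite[OF assms, of a b] by simp
  then show "negligible {t\<in>{a..b}. g t \<noteq> h t}"
    by (rule negligible_subset[OF negligible_finite]) auto
qed auto

lemma integral_cosparse_mono:
  assumes "pwc g" "pwc h" "\<forall>\<^sub>\<approx>t. t \<in> {a<..<b} \<longrightarrow> g t \<le> h t"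
  shows "integral {a..b} g \<le> integral {a..b} h"
proof -
  \<comment> \<open>Replacing g by the minimum with h changes the integral by nothing and makes the
    inequality hold at every point.\<close>
  have "integral {a..b} g = integral {a..b} (\<lambda>t. min (g t) (h t))"
    by (rule integral_cosparse_cong) (use assms(3) in \<open>auto elim!: eventually_mono\<close>)
  also have "pwc (\<lambda>t. min (g t) (h t))"
    by (rule pwc_binop[where D = max])
      (use assms in \<open>auto intro!: continuous_intros simp: abs_if split: if_splits\<close>)
  then have "integral {a..b} (\<lambda>t. min (g t) (h t)) \<le> integral {a..b} h"
    by (intro integral_le pwc_integrable assms) auto
  finally show ?thesis .
qed

lemma integral_pwc_add:
  assumes "pwc g" "pwc h"
  shows "integral {a..b} (\<lambda>t. g t + h t) = integral {a..b} g + integral {a..b} h"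
  by (intro Henstock_Kurzweil_Integration.integral_add pwc_integrable assms)

lemma integral_pwc_diff:
  assumes "pwc g" "pwc h"
  shows "integral {a..b} (\<lambda>t. g t - h t) = integral {a..b} g - integral {a..b} h"
  by (intro Henstock_Kurzweil_Integration.integral_diff pwc_integrable assms)

lemma integral_pwc_abs_le:
  assumes "pwc g"
  shows "\<bar>integral {a..b} g\<bar> \<le> integral {a..b} (\<lambda>t. \<bar>g t\<bar>)"
  using integral_norm_bound_integral[of g "{a..b}" "\<lambda>t. \<bar>g t\<bar>"] assms
  by (auto intro!: pwc_integrable pwc_intros)

lemma integral_cosparse_ftc:
  assumes "a \<le> b" "continuous_on UNIV w" "\<forall>\<^sub>\<approx>t. (w has_real_derivative w1 t) (at t)"
  shows "integral {a..b} w1 = w b - w a"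
proof (rule integral_unique,
    rule fundamental_theorem_of_calculus_interior_strong[OF cosparse_finite[OF assms(3)] assms(1)])
  fix x assume "x \<in> {a<..<b} - {t\<in>{a..b}. \<not> (w has_real_derivative w1 t) (at t)}"
  then show "(w has_vector_derivative w1 x) (at x)"
    by (auto simp: has_real_derivative_iff_has_vector_derivative)
qed (use assms in \<open>auto intro: continuous_on_subset\<close>)

text \<open>Cauchy-Schwarz against the constant 1: the variance of |g| around its mean m is
  nonnegative.\<close>

lemma integral_abs_sq_le:
  assumes "a \<le> b" "pwc g"
  shows "(integral {a..b} (\<lambda>t. \<bar>g t\<bar>))\<^sup>2 \<le> (b - a) * integral {a..b} (\<lambda>t. (g t)\<^sup>2)"
proof (cases "a = b")
  case False
  define m where "m = integral {a..b} (\<lambda>t. \<bar>g t\<bar>) / (b - a)"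
  have "0 \<le> integral {a..b} (\<lambda>t. (\<bar>g t\<bar> - m)\<^sup>2)"
    by (intro integral_nonneg pwc_integrable pwc_intros assms) auto
  also have "(\<lambda>t. (\<bar>g t\<bar> - m)\<^sup>2) = (\<lambda>t. (g t)\<^sup>2 - (2 * m * \<bar>g t\<bar> - m\<^sup>2))"
    by (auto simp: power2_eq_square algebra_simps abs_mult_self)
  also have "integral {a..b} \<dots> = integral {a..b} (\<lambda>t. (g t)\<^sup>2)
      - (2 * m * integral {a..b} (\<lambda>t. \<bar>g t\<bar>) - m\<^sup>2 * (b - a))"
    using assms by (simp add: integral_pwc_diff pwc_intros)
  also have "integral {a..b} (\<lambda>t. \<bar>g t\<bar>) = m * (b - a)"
    using False by (simp add: m_def)
  finally have "m\<^sup>2 * (b - a) \<le> integral {a..b} (\<lambda>t. (g t)\<^sup>2)"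
    by (simp add: power2_eq_square algebra_simps)
  then have "(b - a) * (m\<^sup>2 * (b - a)) \<le> (b - a) * integral {a..b} (\<lambda>t. (g t)\<^sup>2)"
    using assms by (intro mult_left_mono) auto
  then show ?thesis
    using False by (simp add: m_def power2_eq_square)
qed auto

text \<open>Half the difference of the two representations of \<open>w\<close> from the end points costs half the
  total variation only, hence the factor \<open>1/4\<close>.\<close>

lemma poincare_zero:
  assumes t: "t \<in> {a..b}" and "continuous_on UNIV w" "\<forall>\<^sub>\<approx>t. (w has_real_derivative w1 t) (at t)"
    and w1: "pwc w1" and zero: "w a = 0" "w b = 0"
  shows "(w t)\<^sup>2 \<le> (b - a) / 4 * integral {a..b} (\<lambda>t. (w1 t)\<^sup>2)"
proof -
  have "2 * w t = integral {a..t} w1 - integral {t..b} w1"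
    using integral_cosparse_ftc[OF _ assms(2,3), of a t] integral_cosparse_ftc[OF _ assms(2,3), of t b]
      t zero by auto
  then have "\<bar>2 * w t\<bar> \<le> \<bar>integral {a..t} w1\<bar> + \<bar>integral {t..b} w1\<bar>"
    by linarith
  also have "\<dots> \<le> integral {a..t} (\<lambda>t. \<bar>w1 t\<bar>) + integral {t..b} (\<lambda>t. \<bar>w1 t\<bar>)"
    by (intro add_mono integral_pwc_abs_le w1)
  also have "\<dots> = integral {a..b} (\<lambda>t. \<bar>w1 t\<bar>)"
    using t by (intro Henstock_Kurzweil_Integration.integral_combine pwc_integrable pwc_intros w1) auto
  finally have "(2 * w t)\<^sup>2 \<le> (integral {a..b} (\<lambda>t. \<bar>w1 t\<bar>))\<^sup>2"
    using power_mono[of "\<bar>2 * w t\<bar>" _ 2] by simp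
  also have "\<dots> \<le> (b - a) * integral {a..b} (\<lambda>t. (w1 t)\<^sup>2)"
    using t by (intro integral_abs_sq_le w1) auto
  finally show ?thesis by (simp add: power_mult_distrib)
qed

lemma integral_shift_real:
  fixes g :: "real \<Rightarrow> real"
  shows "integral {a + c..b + c} g = integral {a..b} (\<lambda>t. g (t + c))"
  using integral_shift_Icc_real[of a b g c] by (simp add: o_def add.commute)

lemma integral_period_shift:
  assumes "pwc g" "\<And>t. g (t + 1) = g t" "a \<le> b" "b \<le> a + 1"
  shows "integral {a..a + 1} g = integral {b..b + 1} g"
proof -
  have "integral {a..a + 1} g = integral {a..b} g + integral {b..a + 1} g"
    using assms by (intro Henstock_Kurzweil_Integration.integral_combine[symmetric] pwc_integrable) auto
  also have "integral {a..b} g = integral {a + 1..b + 1} g"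
    by (simp add: integral_shift_real assms)
  also have "integral {a + 1..b + 1} g + integral {b..a + 1} g = integral {b..b + 1} g"
    using assms by (subst add.commute)
      (intro Henstock_Kurzweil_Integration.integral_combine pwc_integrable; auto)
  finally show ?thesis .
qed

section \<open>Periodic grids and piecewise affine functions\<close>

text \<open>Instantiated twice, by the lattice with 2N points per period and by the mesh with K
  nodes per period.\<close>

locale grid =
  fixes X :: "int \<Rightarrow> real" and K :: nat
  assumes X_step: "X (k - 1) < X k" and X_per: "X (k + int K) = X k + 1"
begin

lemma X_mono: "i < j \<Longrightarrow> X i < X j"
proof (induction j rule: int_gr_induct[of i])
  case base
  then show ?case using X_step[of "i + 1"] by simp
next
  case (step j)
  then show ?case using X_step[of "j + 1"] by simp
qed

lemma X_less_iff [simp]: "X i < X j \<longleftrightarrow> i < j"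
  using X_mono[of i j] X_mono[of j i] by (cases i j rule: linorder_cases) auto

lemma X_le_iff [simp]: "X i \<le> X j \<longleftrightarrow> i \<le> j"
  by (simp flip: not_less)

lemma X_eq_iff [simp]: "X i = X j \<longleftrightarrow> i = j"
  by (simp add: order_eq_iff)

lemma K_pos: "K > 0"
  using X_per[of 0] by (cases K) auto

lemma X_per_mult: "X (k + int K * m) = X k + of_int m"
proof (induction m rule: int_induct[of _ 0])
  case (step1 m)
  then show ?case using X_per[of "k + int K * m"] by (simp add: algebra_simps)
next
  case (step2 m)
  then show ?case using X_per[of "k + int K * (m - 1)"] by (simp add: algebra_simps)
qed simp

lemma per_mult:
  assumes "\<And>k. P (k + int K) = (P k :: 'a)"
  shows "P (k + int K * m) = P k"
proof (induction m rule: int_induct[of _ 0])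
  case (step1 m)
  then show ?case using assms[of "k + int K * m"] by (simp add: algebra_simps)
next
  case (step2 m)
  then show ?case using assms[of "k + int K * (m - 1)"] by (simp add: algebra_simps)
qed simp

lemma range_X_shift: "t + of_int m \<in> range X \<longleftrightarrow> t \<in> range X"
proof
  assume "t \<in> range X"
  then show "t + of_int m \<in> range X" by (metis X_per_mult rangeE rangeI)
next
  assume "t + of_int m \<in> range X"
  then obtain k where "X k = t + of_int m" by (metis rangeE)
  then have "X (k + int K * (- m)) = t" using X_per_mult[of k "- m"] by simp
  then show "t \<in> range X" by blast
qed

lemma X_unbounded: "\<exists>k. X k > t" "\<exists>k. X k \<le> t"
proof -
  have "X (0 + int K * \<lceil>t - X 0 + 1\<rceil>) > t"
    unfolding X_per_mult by linarith
  then show "\<exists>k. X k > t" ..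
  have "X (0 + int K * \<lfloor>t - X 0\<rfloor>) \<le> t"
    unfolding X_per_mult by linarith
  then show "\<exists>k. X k \<le> t" ..
qed

lemma ex_elem: "\<exists>k. X (k - 1) \<le> t \<and> t < X k"
proof -
  obtain j where j: "X j \<le> t" using X_unbounded by blast
  obtain i where i: "X i > t" using X_unbounded by blast
  have ji: "j < i" using i j by (meson X_less_iff le_less_trans)
  then have "\<exists>k. j < k \<and> X (k - 1) \<le> t \<and> t < X k"
    using i j
  proof (induction i rule: int_gr_induct[of j])
    case base
    then show ?case by (intro exI[of _ "j + 1"]) auto
  next
    case (step i)
    then show ?case by (cases "X i \<le> t") (auto intro!: exI[of _ "i + 1"])
  qed
  then show ?thesis by blast
qed

lemma elem_unique:
  assumes "X (k - 1) \<le> t" "t < X k" "X (j - 1) \<le> t" "t < X j"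
  shows "k = j"
proof -
  have "X (k - 1) < X j" "X (j - 1) < X k" using assms by linarith+
  then show ?thesis by simp
qed

lemma the_elem: "X (k - 1) \<le> t \<Longrightarrow> t < X k \<Longrightarrow> (THE k. X (k - 1) \<le> t \<and> t < X k) = k"
  by (rule the_equality) (auto intro: elem_unique)

text \<open>At a node the elements on the two sides differ, so each one-sided neighbourhood gets its
  own element. This is how facts about open elements become facts off a sparse set.\<close>

lemma eventually_left: "\<exists>k. (\<forall>\<^sub>F s in at_left t. s \<in> {X (k - 1)<..<X k}) \<and> X (k - 1) < t \<and> t \<le> X k"
proof -
  obtain k where k: "X (k - 1) \<le> t" "t < X k" using ex_elem by blast
  then consider "X (k - 1) < t" | "X (k - 1) = t" by linarith
  then show ?thesis
  proof cases
    case 1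
    then have "\<forall>\<^sub>F s in at_left t. s \<in> {X (k - 1)<..<X k}"
      using k by (auto simp: eventually_at_left_field intro!: exI[of _ "X (k - 1)"])
    with 1 k show ?thesis by force
  next
    case 2
    have "\<forall>\<^sub>F s in at_left t. s \<in> {X (k - 1 - 1)<..<X (k - 1)}"
      using X_step[of "k - 1"] 2
      by (auto simp: eventually_at_left_field intro!: exI[of _ "X (k - 1 - 1)"])
    with 2 X_step[of "k - 1"] show ?thesis by (intro exI[of _ "k - 1"]) simp
  qed
qed

lemma eventually_right: "\<exists>k. (\<forall>\<^sub>F s in at_right t. s \<in> {X (k - 1)<..<X k}) \<and> X (k - 1) \<le> t \<and> t < X k"
proof -
  obtain k where k: "X (k - 1) \<le> t" "t < X k" using ex_elem by blast
  then have "\<forall>\<^sub>F s in at_right t. s \<in> {X (k - 1)<..<X k}"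
    by (auto simp: eventually_at_right_field intro!: exI[of _ "X k"])
  with k show ?thesis by blast
qed

lemma cosparse_gridI:
  assumes "\<And>k t. t \<in> {X (k - 1)<..<X k} \<Longrightarrow> P t"
  shows "\<forall>\<^sub>\<approx>t. P t"
  unfolding cosparse_real_iff
proof
  fix t
  obtain k j where "\<forall>\<^sub>F s in at_left t. s \<in> {X (k - 1)<..<X k}"
    "\<forall>\<^sub>F s in at_right t. s \<in> {X (j - 1)<..<X j}"
    using eventually_left eventually_right by meson
  then have "eventually P (at_left t)" "eventually P (at_right t)"
    by (auto elim!: eventually_mono intro: assms)
  then show "\<forall>\<^sub>F s in at t. P s" by (simp add: eventually_at_split)
qed

lemma pwc_gridI:
  assumes "\<And>k t. t \<in> {X (k - 1)<..<X k} \<Longrightarrow> isCont g t"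
    and "\<And>k t. t \<in> {X (k - 1)<..<X k} \<Longrightarrow> \<bar>g t\<bar> \<le> B k"
  shows "pwc g"
  unfolding pwc_def
proof (intro conjI allI)
  show "\<forall>\<^sub>\<approx>t. isCont g t" by (rule cosparse_gridI) (rule assms)
next
  fix t
  obtain k j where "\<forall>\<^sub>F s in at_left t. s \<in> {X (k - 1)<..<X k}"
    "\<forall>\<^sub>F s in at_right t. s \<in> {X (j - 1)<..<X j}"
    using eventually_left eventually_right by meson
  then have "\<forall>\<^sub>F s in at_left t. \<bar>g s\<bar> \<le> max (B k) (B j)"
    "\<forall>\<^sub>F s in at_right t. \<bar>g s\<bar> \<le> max (B k) (B j)"
    by (auto elim!: eventually_mono simp: le_max_iff_disj intro: assms(2))
  then show "\<exists>B. \<forall>\<^sub>F s in at t. \<bar>g s\<bar> \<le> B" by (auto simp: eventually_at_split)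
qed

lemma pwc_stepI:
  assumes "\<And>k t. t \<in> {X (k - 1)<..<X k} \<Longrightarrow> g t = c k"
  shows "pwc g"
proof (rule pwc_gridI[where B = "\<lambda>k. \<bar>c k\<bar>"])
  fix k t assume t: "t \<in> {X (k - 1)<..<X k}"
  then have "\<forall>\<^sub>F s in nhds t. s \<in> {X (k - 1)<..<X k}"
    by (intro eventually_nhds_in_open) auto
  then have "\<forall>\<^sub>F s in nhds t. g s = c k"
    by eventually_elim (rule assms)
  then show "isCont g t" by (subst isCont_cong) auto
qed (use assms in simp)

lemma pw_interp_elem:
  assumes "t \<in> {X (k - 1)..X k}"
  shows "pw_interp X v t = v (k - 1) + (t - X (k - 1)) / hk X k * (v k - v (k - 1))"
proof (cases "t = X k")
  case True
  \<comment> \<open>The definition uses half-open elements, so at the right end point it reads off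
    the element k + 1.\<close>
  have "pw_interp X v t = v k"
    unfolding pw_interp_def using the_elem[of "k + 1" t] True X_step[of "k + 1"] by simp
  then show ?thesis using True X_step[of k] by (simp add: hk_def)
next
  case False
  then show ?thesis
    using assms the_elem[of k t] by (simp add: pw_interp_def hk_def)
qed

lemma hk_pos: "hk X k > 0"
  using X_step[of k] by (simp add: hk_def)

lemma pw_interp_node [simp]: "pw_interp X v (X k) = v k"
  using pw_interp_elem[of "X k" k v] hk_pos[of k] X_step[of k] by (simp add: hk_def)

lemma continuous_pw_interp: "isCont (pw_interp X v) t"
proof -
  obtain k where k: "X (k - 1) \<le> t" "t < X k" using ex_elem by blast
  define L where "L = {{X (k - 2)..X (k - 1)}, {X (k - 1)..X k}}"
  have aff: "continuous_on {X (j - 1)..X j} (pw_interp X v)" for j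
    by (subst continuous_on_cong[OF refl pw_interp_elem])
      (use hk_pos[of j] in \<open>auto intro!: continuous_intros\<close>)
  \<comment> \<open>If t is the node \<open>X (k - 1)\<close>, the element on its left is needed to
    obtain a neighbourhood of t.\<close>
  have "continuous_on ({X (k - 2)..X (k - 1)} \<union> {X (k - 1)..X k}) (pw_interp X v)"
    using aff[of "k - 1"] aff[of k] by (intro continuous_on_closed_Un) auto
  also have "{X (k - 2)..X (k - 1)} \<union> {X (k - 1)..X k} = {X (k - 2)..X k}"
    by (intro ivl_disj_un_two_touch) auto
  finally have "continuous_on {X (k - 2)<..<X k} (pw_interp X v)"
    by (rule continuous_on_subset) auto
  moreover have "X (k - 2) < X (k - 1)" by simp
  then have "t \<in> {X (k - 2)<..<X k}"
    using k unfolding greaterThanLessThan_iff by linarith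
  ultimately show ?thesis by (simp add: continuous_on_eq_continuous_at)
qed

lemma pw_interp_P1: "pw_interp X v \<in> P1 X"
  unfolding P1_def elem_def
proof (intro CollectI conjI allI)
  show "continuous_on UNIV (pw_interp X v)"
    by (simp add: continuous_on_eq_continuous_at continuous_pw_interp)
  fix k
  define b where "b = (v k - v (k - 1)) / hk X k"
  have "pw_interp X v t = (v (k - 1) - X (k - 1) * b) + b * t" if "t \<in> {X (k - 1)..X k}" for t
    unfolding pw_interp_elem[OF that] b_def using hk_pos[of k] by (simp add: field_simps)
  then show "\<exists>a b. \<forall>t\<in>{X (k - 1)..X k}. pw_interp X v t = a + b * t"
    by blast
qed

definition slope :: "(real \<Rightarrow> real) \<Rightarrow> int \<Rightarrow> real" where
  "slope g k = (g (X k) - g (X (k - 1))) / hk X k"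

lemma slope_hk: "hk X k * slope g k = g (X k) - g (X (k - 1))"
  using hk_pos[of k] by (simp add: slope_def)

lemma P1_elem:
  assumes "g \<in> P1 X" "t \<in> {X (k - 1)..X k}"
  shows "g t = g (X (k - 1)) + slope g k * (t - X (k - 1))"
proof -
  obtain a b where ab: "\<And>t. t \<in> {X (k - 1)..X k} \<Longrightarrow> g t = a + b * t"
    using assms(1) unfolding P1_def elem_def by blast
  have "g (X k) = a + b * X k" "g (X (k - 1)) = a + b * X (k - 1)"
    by (intro ab; simp)+
  then have "slope g k = b"
    using hk_pos[of k] by (simp add: slope_def hk_def field_simps)
  then show ?thesis using ab[OF assms(2)] ab[of "X (k - 1)"] by (simp add: algebra_simps)
qed

lemma P1_continuous: "g \<in> P1 X \<Longrightarrow> continuous_on UNIV g"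
  by (simp add: P1_def)

lemma P1_has_derivative:
  assumes "g \<in> P1 X" "t \<in> {X (k - 1)<..<X k}"
  shows "(g has_real_derivative slope g k) (at t)"
proof -
  have "((\<lambda>t. g (X (k - 1)) + slope g k * (t - X (k - 1))) has_real_derivative slope g k) (at t)"
    by (auto intro!: derivative_eq_intros)
  then show ?thesis
  proof (rule DERIV_cong_ev[THEN iffD1, rotated -1])
    have "\<forall>\<^sub>F s in nhds t. s \<in> {X (k - 1)<..<X k}"
      using assms(2) by (intro eventually_nhds_in_open) auto
    then show "\<forall>\<^sub>F s in nhds t. g (X (k - 1)) + slope g k * (s - X (k - 1)) = g s"
    proof eventually_elim
      case (elim s)
      then show ?case using P1_elem[OF assms(1), of s k] by simp
    qed
  qed simp_all
qed

lemma P1_deriv: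
  "g \<in> P1 X \<Longrightarrow> t \<in> {X (k - 1)<..<X k} \<Longrightarrow> deriv g t = slope g k"
  by (rule DERIV_imp_deriv) (rule P1_has_derivative)

lemma P1_cosparse_deriv:
  assumes "g \<in> P1 X"
  shows "\<forall>\<^sub>\<approx>t. (g has_real_derivative deriv g t) (at t)"
  by (rule cosparse_gridI) (simp add: P1_deriv[OF assms] P1_has_derivative[OF assms])

lemma pwc_P1_deriv: "g \<in> P1 X \<Longrightarrow> pwc (deriv g)"
  by (rule pwc_stepI) (rule P1_deriv)

lemma pwc_P1_comp_deriv: "g \<in> P1 X \<Longrightarrow> pwc (\<lambda>t. H (deriv g t))"
  by (rule pwc_stepI[where c = "\<lambda>k. H (slope g k)"]) (simp add: P1_deriv)

lemma P1_ftc: "g \<in> P1 X \<Longrightarrow> a \<le> b \<Longrightarrow> integral {a..b} (deriv g) = g b - g a"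
  by (intro integral_cosparse_ftc P1_continuous P1_cosparse_deriv)

lemma P1_add_cmult:
  assumes "g \<in> P1 X" "h \<in> P1 X"
  shows "(\<lambda>t. g t + c * h t) \<in> P1 X"
  unfolding P1_def
proof (intro CollectI conjI allI)
  show "continuous_on UNIV (\<lambda>t. g t + c * h t)"
    using assms by (auto simp: P1_def intro!: continuous_intros)
  fix k
  obtain a b a' b' where "\<forall>t\<in>elem X k. g t = a + b * t" "\<forall>t\<in>elem X k. h t = a' + b' * t"
    using assms unfolding P1_def by blast
  then have "\<forall>t\<in>elem X k. g t + c * h t = (a + c * a') + (b + c * b') * t"
    by (simp add: algebra_simps)
  then show "\<exists>a b. \<forall>t\<in>elem X k. g t + c * h t = a + b * t" by blast
qed

lemma slope_add_cmult: "slope (\<lambda>t. g t + c * h t) k = slope g k + c * slope h k"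
  by (simp add: slope_def field_simps add_divide_distrib diff_divide_distrib)

lemma hk_per: "hk X (k + int K) = hk X k"
  using X_per[of k] X_per[of "k - 1"] by (simp add: hk_def algebra_simps)

lemma pw_interp_per:
  assumes "\<And>k. v (k + int K) = v k + c"
  shows "pw_interp X v (t + 1) = pw_interp X v t + c"
proof -
  obtain k where "X (k - 1) \<le> t" "t < X k" using ex_elem by blast
  then have k: "t \<in> {X (k - 1)..X k}" "t + 1 \<in> {X (k + int K - 1)..X (k + int K)}"
    using X_per[of k] X_per[of "k - 1"] by (auto simp: algebra_simps)
  show ?thesis
    unfolding pw_interp_elem[OF k(1)] pw_interp_elem[OF k(2)] hk_per
    using X_per[of "k - 1"] assms[of k] assms[of "k - 1"] by (simp add: algebra_simps)
qed

lemma integral_grid_sum: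
  assumes "pwc g" "m \<le> n"
  shows "integral {X m..X n} g = (\<Sum>k\<in>{m + 1..n}. integral {X (k - 1)..X k} g)"
  using assms(2)
proof (induction n rule: int_ge_induct)
  case (step n)
  have "{m + 1..n + 1} = insert (n + 1) {m + 1..n}" using step by auto
  then have "(\<Sum>k\<in>{m + 1..n + 1}. integral {X (k - 1)..X k} g)
      = integral {X m..X n} g + integral {X n..X (n + 1)} g"
    using step by simp
  also have "\<dots> = integral {X m..X (n + 1)} g"
    using step by (intro Henstock_Kurzweil_Integration.integral_combine pwc_integrable assms) auto
  finally show ?case by simp
qed simp

text \<open>Integrating an interpolant means applying the trapezoidal rule, so the weighted lattice
  sum and the mesh quadrature of the forces are of one kind.\<close>

lemma integral_pw_interp_elem:
  "integral {X (k - 1)..X k} (pw_interp X v) = hk X k / 2 * (v (k - 1) + v k)"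
proof -
  let ?H = "\<lambda>t. v (k - 1) * t + (t - X (k - 1))\<^sup>2 / (2 * hk X k) * (v k - v (k - 1))"
  have "(pw_interp X v has_integral (?H (X k) - ?H (X (k - 1)))) {X (k - 1)..X k}"
  proof (rule fundamental_theorem_of_calculus)
    fix t assume t: "t \<in> {X (k - 1)..X k}"
    have "(?H has_real_derivative pw_interp X v t) (at t within {X (k - 1)..X k})"
      unfolding pw_interp_elem[OF t] using hk_pos[of k]
      by (auto intro!: derivative_eq_intros simp: field_simps)
    then show "(?H has_vector_derivative pw_interp X v t) (at t within {X (k - 1)..X k})"
      by (simp add: has_real_derivative_iff_has_vector_derivative)
  qed simp
  then have "integral {X (k - 1)..X k} (pw_interp X v) = ?H (X k) - ?H (X (k - 1))"
    by (rule integral_unique)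
  also have "\<dots> = hk X k / 2 * (v (k - 1) + v k)"
    using hk_pos[of k] by (simp add: hk_def field_simps power2_eq_square)
  finally show ?thesis .
qed

lemma integral_elem_const:
  assumes "\<And>t. t \<in> {X (k - 1)<..<X k} \<Longrightarrow> g t = c"
  shows "integral {X (k - 1)..X k} g = hk X k * c"
proof -
  have "integral {X (k - 1)..X k} g = integral {X (k - 1)..X k} (\<lambda>_. c)"
    by (rule integral_cosparse_cong) (simp add: assms)
  then show ?thesis using X_step[of k] by (simp add: hk_def)
qed

text \<open>The weight of the Peano kernel of the trapezoidal rule on the element containing \<open>t\<close>.\<close>

definition bubble :: "real \<Rightarrow> real" where
  "bubble t = (let k = (THE k. X (k - 1) \<le> t \<and> t < X k) in (t - X (k - 1)) * (X k - t) / 2)"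

lemma bubble_elem:
  "t \<in> {X (k - 1)<..<X k} \<Longrightarrow> bubble t = (t - X (k - 1)) * (X k - t) / 2"
  using the_elem[of k t] by (simp add: bubble_def)

lemma bubble_bounds:
  assumes "t \<in> {X (k - 1)<..<X k}"
  shows "0 \<le> bubble t" "bubble t \<le> (hk X k)\<^sup>2 / 8"
proof -
  show "0 \<le> bubble t" unfolding bubble_elem[OF assms] using assms by simp
  have "(X k - X (k - 1))\<^sup>2 - 4 * ((t - X (k - 1)) * (X k - t)) = ((t - X (k - 1)) - (X k - t))\<^sup>2"
    by algebra
  then have "4 * ((t - X (k - 1)) * (X k - t)) \<le> (X k - X (k - 1))\<^sup>2"
    by (smt (verit) zero_le_power2)
  then show "bubble t \<le> (hk X k)\<^sup>2 / 8"
    unfolding bubble_elem[OF assms] hk_def by linarith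
qed

lemma pwc_bubble: "pwc bubble"
proof (rule pwc_gridI[where B = "\<lambda>k. (hk X k)\<^sup>2 / 8"])
  fix k t assume t: "t \<in> {X (k - 1)<..<X k}"
  then have "\<forall>\<^sub>F s in nhds t. s \<in> {X (k - 1)<..<X k}"
    by (intro eventually_nhds_in_open) auto
  then have "\<forall>\<^sub>F s in nhds t. bubble s = (s - X (k - 1)) * (X k - s) / 2"
    by eventually_elim (rule bubble_elem)
  then have "isCont bubble t \<longleftrightarrow> isCont (\<lambda>s. (s - X (k - 1)) * (X k - s) / 2) t"
    by (rule isCont_cong)
  then show "isCont bubble t"
    by (simp add: continuous_intros)
  show "\<bar>bubble t\<bar> \<le> (hk X k)\<^sup>2 / 8" using bubble_bounds[OF t] by simp
qed

lemma bubble_per: "bubble (t + 1) = bubble t"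
proof -
  obtain k where k: "X (k - 1) \<le> t" "t < X k" using ex_elem by blast
  have *: "X (k + int K - 1) = X (k - 1) + 1"
    using X_per[of "k - 1"] by (simp add: algebra_simps)
  show ?thesis
    unfolding bubble_def the_elem[OF k] using k the_elem[of "k + int K" "t + 1"] X_per[of k] *
    by simp
qed

end

text \<open>The Peano kernel identity, obtained from the explicit primitive H. Bounding g1 on the
  open interval is enough: the factor (t - a)(b - t) makes H continuous at the end points, where g
  need not be differentiable.\<close>

lemma integral_trapezoid:
  fixes g :: "real \<Rightarrow> real"
  assumes ab: "a < b" and cont: "continuous_on {a..b} g"
    and d1: "\<And>t. t \<in> {a<..<b} \<Longrightarrow> (g has_real_derivative g1 t) (at t)"
    and d2: "\<And>t. t \<in> {a<..<b} \<Longrightarrow> (g1 has_real_derivative g2 t) (at t)"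
    and bd: "\<And>t. t \<in> {a<..<b} \<Longrightarrow> \<bar>g1 t\<bar> \<le> B"
  shows "integral {a..b} (\<lambda>t. (t - a) * (b - t) / 2 * g2 t + g t) = (b - a) / 2 * (g a + g b)"
proof -
  define H where "H t = (t - a) * (b - t) / 2 * g1 t - ((a + b) / 2 - t) * g t" for t
  let ?q = "\<lambda>t. (t - a) * (b - t) / 2 * g1 t"
  have q_lim: "(?q \<longlongrightarrow> ?q c) (at c within {a..b})" if c: "c = a \<or> c = b" for c
  proof -
    have "((\<lambda>t. (t - a) * (b - t) / 2 * B) \<longlongrightarrow> (c - a) * (b - c) / 2 * B) (at c within {a..b})"
      by (intro tendsto_intros) auto
    then have lim: "((\<lambda>t. (t - a) * (b - t) / 2 * B) \<longlongrightarrow> 0) (at c within {a..b})"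
      using c by auto
    have "\<forall>\<^sub>F t in at c within {a..b}. t \<in> {a<..<b}"
    proof -
      have "\<forall>\<^sub>F t in at c within {a..b}. t \<in> {a..b}"
        by (simp add: eventually_at_filter)
      moreover have "\<forall>\<^sub>F t in at c within {a..b}. t \<noteq> c"
        by (simp add: eventually_at_filter)
      moreover have "\<forall>\<^sub>F t in at c within {a..b}. t \<noteq> (if c = a then b else a)"
        using ab c by (intro tendsto_imp_eventually_ne[OF tendsto_ident_at]) auto
      ultimately show ?thesis
        by eventually_elim (use c in \<open>auto split: if_splits\<close>)
    qed
    then have "\<forall>\<^sub>F t in at c within {a..b}. norm (?q t) \<le> (t - a) * (b - t) / 2 * B"
    proof eventually_elim
      case (elim t)
      then show ?case using bd[of t] by (simp add: abs_mult mult_left_mono)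
    qed
    from Lim_null_comparison[OF this lim] show ?thesis using c by auto
  qed
  have "continuous_on {a..b} ?q"
    unfolding continuous_on_def
  proof
    fix c assume c: "c \<in> {a..b}"
    show "(?q \<longlongrightarrow> ?q c) (at c within {a..b})"
    proof (cases "c = a \<or> c = b")
      case False
      then have "isCont g1 c" using c d2[of c] by (auto intro: DERIV_isCont)
      then have "isCont ?q c" by (auto intro!: continuous_intros)
      then show ?thesis by (auto simp: isCont_def intro: tendsto_within_subset)
    qed (rule q_lim)
  qed
  then have contH: "continuous_on {a..b} H"
    unfolding H_def by (rule continuous_on_diff) (intro continuous_intros cont; simp)
  have "((\<lambda>t. (t - a) * (b - t) / 2 * g2 t + g t) has_integral (H b - H a)) {a..b}"
  proof (rule fundamental_theorem_of_calculus_interior[OF _ contH])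
    fix t assume t: "t \<in> {a<..<b}"
    have "(H has_real_derivative ((t - a) * (b - t) / 2 * g2 t + g t)) (at t)"
      unfolding H_def using ab
      by (auto intro!: derivative_eq_intros d1 d2 t simp: field_simps)
    then show "(H has_vector_derivative ((t - a) * (b - t) / 2 * g2 t + g t)) (at t)"
      by (simp add: has_real_derivative_iff_has_vector_derivative)
  qed (use ab in simp)
  then have "integral {a..b} (\<lambda>t. (t - a) * (b - t) / 2 * g2 t + g t) = H b - H a"
    by (rule integral_unique)
  also have "\<dots> = (b - a) / 2 * (g a + g b)"
    by (simp add: H_def field_simps)
  finally show ?thesis .
qed

section \<open>Geometry of bonds, lattice cells and mesh elements\<close>

locale qc_setting =
  fixes N K :: nat and La Ra :: real and X :: "int \<Rightarrow> real"
  assumes N_pos: "N \<ge> 1"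
    and Om_a: "-1/2 < La" "La < Ra" "Ra < 1/2" "Ra - La \<ge> 2 * eps N"
    and qc_mesh: "qc_mesh N La Ra K X"
begin

lemma eps_pos: "eps N > 0"
  using N_pos by (simp add: eps_def)

lemma eps_N: "eps N * real N = 1 / 2"
  using N_pos by (simp add: eps_def)

lemma lat_add: "lat N (l + j) = lat N l + eps N * of_int j"
  by (simp add: lat_def algebra_simps)

sublocale lattice: grid "lat N" "2 * N"
proof
  show "lat N (k - 1) < lat N k" for k
    using eps_pos by (simp add: lat_def algebra_simps)
  show "lat N (k + int (2 * N)) = lat N k + 1" for k
    using eps_N by (simp add: lat_add)
qed

sublocale mesh: grid X K
  by standard (use qc_mesh in \<open>auto simp: qc_mesh_def\<close>)

lemma lat_N: "lat N (int N) = 1 / 2" "lat N (- int N) = - 1 / 2"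
  using eps_N by (simp_all add: lat_def)

lemma hk_lat [simp]: "hk (lat N) l = eps N"
  using lat_add[of "l - 1" 1] by (simp add: hk_def)

section \<open>The periodic atomistic and continuum regions, and how elements lie in them\<close>

abbreviation "A \<equiv> periodic_ext {La<..<Ra}"
abbreviation "C \<equiv> periodic_ext (Om_c La Ra)"

lemma mem_A: "t \<in> A \<longleftrightarrow> (\<exists>m::int. La + m < t \<and> t < Ra + m)"
proof
  assume "\<exists>m::int. La + m < t \<and> t < Ra + m"
  then obtain m :: int where "La + m < t" "t < Ra + m" by blast
  then show "t \<in> A"
    unfolding periodic_ext_def by (intro UN_I[of m] image_eqI[of _ _ "t - m"]) auto
next
  assume "t \<in> A"
  then obtain m :: int where "t \<in> (\<lambda>t. t + of_int m) ` {La<..<Ra}"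
    unfolding periodic_ext_def by blast
  then show "\<exists>m::int. La + m < t \<and> t < Ra + m" by (intro exI[of _ m]) auto
qed

text \<open>Translates of \<open>Om\<close> overlap at the half-integers. This does no harm because
  La > -1/2 and Ra < 1/2 keep those points out of every translate of the atomistic interval.\<close>

lemma mem_C: "t \<in> C \<longleftrightarrow> t \<notin> A"
proof
  assume "t \<in> C"
  then obtain s :: real and m :: int where "t = s + m" "s \<in> {-1/2..1/2} - {La<..<Ra}"
    unfolding periodic_ext_def Om_c_def Om_def by blast
  then have m: "t - m \<in> {-1/2..1/2}" "t - m \<notin> {La<..<Ra}" by simp_all
  show "t \<notin> A"
  proof
    assume "t \<in> A"
    then obtain m' :: int where "La + m' < t" "t < Ra + m'" by (auto simp: mem_A)
    with m Om_a have "\<bar>real_of_int m - of_int m'\<bar> < 1" by auto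
    then have "m = m'" by linarith
    with m \<open>La + m' < t\<close> \<open>t < Ra + m'\<close> show False by auto
  qed
next
  assume A: "t \<notin> A"
  define m where "m = \<lceil>t - 1/2\<rceil>"
  have "t - m \<in> Om" unfolding m_def Om_def atLeastAtMost_iff by linarith
  moreover have "t - m \<notin> {La<..<Ra}" using A by (auto simp: mem_A algebra_simps)
  moreover have "t = (t - m) + m" by simp
  ultimately show "t \<in> C" unfolding periodic_ext_def Om_c_def by blast
qed

lemma A_shift [simp]: "t + of_int m \<in> A \<longleftrightarrow> t \<in> A"
proof
  assume "t \<in> A"
  then obtain n :: int where "La + n < t" "t < Ra + n" by (auto simp: mem_A)
  then show "t + of_int m \<in> A" unfolding mem_A by (intro exI[of _ "n + m"]) auto
next
  assume "t + of_int m \<in> A"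
  then obtain n :: int where "La + n < t + m" "t + m < Ra + n" by (auto simp: mem_A)
  then show "t \<in> A" unfolding mem_A by (intro exI[of _ "n - m"]) auto
qed

lemma A_shift1 [simp]: "t + 1 \<in> A \<longleftrightarrow> t \<in> A"
  using A_shift[of t 1] by simp

lemma gap_notin_A: "Ra + of_int m \<le> t \<Longrightarrow> t \<le> La + of_int m + 1 \<Longrightarrow> t \<notin> A"
proof
  assume "Ra + of_int m \<le> t" "t \<le> La + of_int m + 1" "t \<in> A"
  then obtain n :: int where "La + n < t" "t < Ra + n" by (auto simp: mem_A)
  with \<open>Ra + of_int m \<le> t\<close> \<open>t \<le> La + of_int m + 1\<close>
  have "real_of_int n < of_int (m + 1)" "real_of_int m < of_int n" by simp_all
  then show False by (simp only: of_int_less_iff)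
qed

text \<open>(T2) speaks of the one interval inside \<open>Om\<close>; both grids are invariant under
  integer shifts, so it passes to all translates.\<close>

lemma lattice_node:
  assumes "t \<in> A"
  shows "t \<in> range (lat N) \<longleftrightarrow> t \<in> range X"
proof -
  obtain m :: int where "t + of_int m \<in> {La<..<Ra}"
    using assms unfolding mem_A by (metis add_uminus_conv_diff diff_less_eq greaterThanLessThan_iff
        less_diff_eq of_int_minus)
  moreover have "{La<..<Ra} \<inter> range (lat N) = {La<..<Ra} \<inter> range X"
    using qc_mesh by (simp add: qc_mesh_def)
  ultimately have "t + of_int m \<in> range (lat N) \<longleftrightarrow> t + of_int m \<in> range X" by blast
  then show ?thesis by (simp add: lattice.range_X_shift mesh.range_X_shift)
qed

lemma interface_node: "La + of_int m \<in> range X" "Ra + of_int m \<in> range X"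
  using qc_mesh by (auto simp: qc_mesh_def mesh.range_X_shift)

lemma node_next: "t \<in> range X \<Longrightarrow> X (k - 1) < t \<Longrightarrow> X k \<le> t"
  by auto

text \<open>The interfaces and all their translates are nodes, so no element can cross one.\<close>

lemma elem_cases:
  obtains (atom) m :: int where "La + m \<le> X (k - 1)" "X k \<le> Ra + m"
  | (cont) m :: int where "Ra + m \<le> X (k - 1)" "X k \<le> La + m + 1"
proof -
  define m where "m = \<lfloor>X (k - 1) - La\<rfloor>"
  have m: "La + m \<le> X (k - 1)" "X (k - 1) < La + (m + 1)"
    unfolding m_def by linarith+
  show thesis
  proof (cases "X (k - 1) < Ra + m")
    case True
    then show ?thesis using atom[of m] m node_next[OF interface_node(2), of k m] by auto
  next
    case False
    then show ?thesis using cont[of m] m node_next[OF interface_node(1), of k "m + 1"] by auto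
  qed
qed

text \<open>The asymmetry between open and closed element reflects that A is open, with its end
  points on the continuum side.\<close>

lemma elem_A_or_C: "{X (k - 1)<..<X k} \<subseteq> A \<or> {X (k - 1)..X k} \<inter> A = {}"
proof (cases rule: elem_cases[of k])
  case (atom m)
  then have "{X (k - 1)<..<X k} \<subseteq> A" by (auto simp: mem_A intro!: exI[of _ m])
  then show ?thesis ..
next
  case (cont m)
  then have "{X (k - 1)..X k} \<inter> A = {}" using gap_notin_A[of m] by fastforce
  then show ?thesis ..
qed

lemma elem_C_size: "{X (k - 1)..X k} \<inter> A = {} \<Longrightarrow> hk X k \<ge> 2 * eps N"
proof -
  assume "{X (k - 1)..X k} \<inter> A = {}"
  then have "elem X k \<subseteq> C" unfolding elem_def using mem_C by blast
  then show ?thesis using qc_mesh unfolding qc_mesh_def by blast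
qed

text \<open>The element that starts at Ra lies in the gap before La + 1, and (T4) bounds its length
  from below. The gap is thus at least as long as any bond.\<close>

lemma gap_size: "1 - (Ra - La) \<ge> 2 * eps N"
proof -
  obtain j where j: "X j = Ra" using interface_node(2)[of 0] by auto
  have "X (j + 1) \<le> La + 1"
    using node_next[OF interface_node(1)[of 1], of "j + 1"] j Om_a by auto
  moreover from this have "{X (j + 1 - 1)..X (j + 1)} \<inter> A = {}"
    using gap_notin_A[of 0] j by auto
  then have "hk X (j + 1) \<ge> 2 * eps N" by (rule elem_C_size)
  ultimately show ?thesis using j by (simp add: hk_def)
qed

lemma interface_notin_A: "La + of_int m \<notin> A" "Ra + of_int m \<notin> A"
  using gap_notin_A[of "- 1" La] gap_notin_A[of 0 Ra] gap_size eps_pos by simp_all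

text \<open>An interval with points in two translates of the atomistic interval would contain the
  gap between them and be longer than 2 eps.\<close>

lemma short_interval_A:
  assumes "q - p \<le> 2 * eps N" "{p<..<q} \<inter> A \<noteq> {}"
  obtains m :: int where "{p<..<q} \<inter> A = {max p (La + m)<..<min q (Ra + m)}"
    "max p (La + m) < min q (Ra + m)"
proof -
  obtain t m where t: "p < t" "t < q" "La + of_int m < t" "t < Ra + of_int m"
    using assms(2) by (auto simp: mem_A)
  have "s \<in> {La + m<..<Ra + m}" if s: "s \<in> {p<..<q}" "s \<in> A" for s
  proof -
    obtain n where n: "La + of_int n < s" "s < Ra + of_int n" using s by (auto simp: mem_A)
    have "\<not> n < m"
    proof
      assume "n < m"
      then have "real_of_int n + 1 \<le> of_int m" by linarith
      then show False using n t s gap_size assms(1) by auto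
    qed
    moreover have "\<not> m < n"
    proof
      assume "m < n"
      then have "real_of_int m + 1 \<le> of_int n" by linarith
      then show False using n t s gap_size assms(1) by auto
    qed
    ultimately show ?thesis using n by simp
  qed
  moreover have "{La + m<..<Ra + m} \<subseteq> A" by (auto simp: mem_A)
  ultimately have "{p<..<q} \<inter> A = {max p (La + m)<..<min q (Ra + m)}" by auto
  with t show ?thesis by (intro that[of m]) auto
qed

text \<open>This is what turns a sum over bonds into a sum over nodes without double counting.\<close>

lemma node_unique:
  assumes "q - p \<le> 2 * eps N" "X i \<in> {p<..<q}" "X j \<in> {p<..<q}" "X i \<notin> A" "X j \<notin> A"
  shows "i = j"
proof -
  have False if ij: "i < j" "X i \<in> {p<..<q}" "X j \<in> {p<..<q}" "X i \<notin> A" "X j \<notin> A" for i j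
  proof (cases rule: elem_cases[of "i + 1"])
    case (atom m)
    \<comment> \<open>If the element after \<open>X i\<close> is atomistic, then \<open>X i\<close>
      is at the left interface, and the next node outside A is at least Ra - La further on.\<close>
    have "X i < X (i + 1)" "X (i + 1) \<le> X j" using ij by simp_all
    moreover have "\<not> (La + m < X i \<and> X i < Ra + m)" "\<not> (La + m < X j \<and> X j < Ra + m)"
      using ij(4,5) by (auto simp: mem_A)
    moreover have "La + m \<le> X i" "X (i + 1) \<le> Ra + m" using atom by simp_all
    ultimately have "X i \<le> La + m" "Ra + m \<le> X j" by linarith+
    then show False using ij Om_a assms(1) by auto
  next
    case (cont m)
    then have "{X (i + 1 - 1)..X (i + 1)} \<inter> A = {}" using gap_notin_A[of m] by auto
    then have "hk X (i + 1) \<ge> 2 * eps N" by (rule elem_C_size)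
    then have "X (i + 1) - X i \<ge> 2 * eps N" by (simp add: hk_def)
    moreover have "X (i + 1) \<le> X j" using ij by simp
    moreover have "p < X i" "X j < q" using ij by simp_all
    ultimately show False using assms(1) by linarith
  qed
  from this[of i j] this[of j i] assms show ?thesis by (cases i j rule: linorder_cases) auto
qed

lemma pwc_indicator_A: "pwc (indicat_real A)"
proof (rule mesh.pwc_stepI[where c = "\<lambda>k. of_bool ({X (k - 1)<..<X k} \<subseteq> A)"])
  fix k t assume t: "t \<in> {X (k - 1)<..<X k}"
  from elem_A_or_C[of k] show "indicat_real A t = of_bool ({X (k - 1)<..<X k} \<subseteq> A)"
  proof
    assume "{X (k - 1)<..<X k} \<subseteq> A"
    with t show ?thesis by auto
  next
    assume *: "{X (k - 1)..X k} \<inter> A = {}"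
    with t have "t \<notin> A" by (auto simp: disjoint_iff)
    with t show ?thesis by auto
  qed
qed

lemma pwc_if_A:
  assumes "pwc g" "pwc h"
  shows "pwc (\<lambda>t. if t \<in> A then g t else h t)"
proof -
  have "(\<lambda>t. if t \<in> A then g t else h t) = (\<lambda>t. indicat_real A t * (g t - h t) + h t)"
    by (auto simp: indicator_def)
  then show ?thesis by (auto intro!: pwc_intros pwc_indicator_A assms)
qed

section \<open>Bonds and their intersections with the atomistic region\<close>

abbreviation bl :: "int \<times> nat \<Rightarrow> real" where "bl b \<equiv> lat N (fst b)"
abbreviation br :: "int \<times> nat \<Rightarrow> real" where "br b \<equiv> lat N (fst b + int (snd b))"

lemma bond_len: "br b - bl b = eps N * rb b"
  by (simp add: lat_add rb_def)

lemma bond_short: "b \<in> bonds N \<Longrightarrow> br b - bl b \<le> 2 * eps N"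
  using eps_pos by (auto simp: bond_len bonds_def rb_def)

lemma rb_pos: "b \<in> bonds N \<Longrightarrow> rb b > 0"
  by (auto simp: bonds_def rb_def)

lemma bl_less_br: "b \<in> bonds N \<Longrightarrow> bl b < br b"
  using bond_len[of b] rb_pos[of b] eps_pos by (smt (verit) mult_pos_pos)

lemma measure_bond: "b \<in> bonds N \<Longrightarrow> measure lborel (bond N b) = eps N * rb b"
  using bl_less_br[of b] bond_len[of b] by (simp add: bond_def)

lemma diffq_open: "p < q \<Longrightarrow> diffq {p<..<q} v = (v q - v p) / (q - p)"
  by (simp add: diffq_def)

lemma diffq_bond: "b \<in> bonds N \<Longrightarrow> diffq (bond N b) v = (v (br b) - v (bl b)) / (eps N * rb b)"
  using bl_less_br[of b] by (simp add: bond_def diffq_open bond_len)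

lemma finite_bonds: "finite (bonds N)"
  by (simp add: bonds_def cell_def)

text \<open>The end points of the intersection are mesh nodes: each is an interface, or a lattice
  point inside A and hence a node by (T2). Difference quotients over it therefore see nodal values
  only.\<close>

lemma bond_a_cases:
  assumes "b \<in> bonds N"
  obtains (empty) "bond_a N La Ra b = {}"
  | (interval) p q where "bond_a N La Ra b = {p<..<q}" "p < q" "bl b \<le> p" "q \<le> br b"
      "p \<in> range X" "q \<in> range X"
proof (cases "bond_a N La Ra b = {}")
  case False
  then have "{bl b<..<br b} \<inter> A \<noteq> {}" by (simp add: bond_a_def bond_def)
  from short_interval_A[OF bond_short[OF assms] this]
  obtain m :: int where m: "{bl b<..<br b} \<inter> A = {max (bl b) (La + m)<..<min (br b) (Ra + m)}"
    "max (bl b) (La + m) < min (br b) (Ra + m)" by blast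
  have "max (bl b) (La + m) \<in> range X"
  proof (cases "bl b \<le> La + m")
    case False
    then have "bl b \<in> A" using m(2) by (auto simp: mem_A intro!: exI[of _ m])
    then have "bl b \<in> range X" using lattice_node by blast
    then show ?thesis using False by (simp add: max_def)
  qed (use interface_node in \<open>auto simp: max_def\<close>)
  moreover have "min (br b) (Ra + m) \<in> range X"
  proof (cases "br b < Ra + m")
    case True
    then have "br b \<in> A" using m(2) by (auto simp: mem_A intro!: exI[of _ m])
    then have "br b \<in> range X" using lattice_node by blast
    then show ?thesis using True by (simp add: min_def)
  qed (use interface_node in \<open>auto simp: min_def\<close>)
  ultimately show ?thesis
    using m by (intro interval[of "max (bl b) (La + m)" "min (br b) (Ra + m)"])
      (auto simp: bond_a_def bond_def)
qed

lemma if_not: "(if \<not> P then x else y) = (if P then y else x)"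
  by simp

text \<open>Merges the atomistic and the continuum part of a bond into one integrand, so that later
  estimates need no case distinction on how a bond meets an interface.\<close>

lemma bond_split:
  assumes "pwc g" "pwc h"
  shows "integral (bond_a N La Ra b) g + integral (bond_c N La Ra b) h
    = integral {bl b..br b} (\<lambda>t. if t \<in> A then g t else h t)"
proof -
  have "integral (bond_a N La Ra b) g = integral {bl b<..<br b} (\<lambda>t. if t \<in> A then g t else 0)"
    unfolding bond_a_def bond_def by (metis Int_commute integral_restrict_Int)
  moreover have "integral (bond_c N La Ra b) h
      = integral {bl b<..<br b} (\<lambda>t. if t \<in> C then h t else 0)"
    unfolding bond_c_def bond_def by (metis Int_commute integral_restrict_Int)
  ultimately have "integral (bond_a N La Ra b) g + integral (bond_c N La Ra b) h
    = integral {bl b..br b} (\<lambda>t. if t \<in> A then g t else 0)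
      + integral {bl b..br b} (\<lambda>t. if t \<in> A then 0 else h t)"
    by (simp only: integral_open_interval_real mem_C if_not)
  also have "\<dots> = integral {bl b..br b} (\<lambda>t. (if t \<in> A then g t else 0) + (if t \<in> A then 0 else h t))"
    by (rule integral_pwc_add[symmetric]) (auto intro!: pwc_if_A assms)
  also have "(\<lambda>t. (if t \<in> A then g t else 0) + (if t \<in> A then 0 else h t))
      = (\<lambda>t. if t \<in> A then g t else h t)" by auto
  finally show ?thesis .
qed

lemma measure_bond_a: "b \<in> bonds N \<Longrightarrow> integral (bond_a N La Ra b) (\<lambda>_. c) = measure lborel (bond_a N La Ra b) * c"
  by (erule bond_a_cases) (simp_all add: integral_open_interval_real[symmetric] del: integral_open_interval_real)

lemma bond_a_integral:
  assumes "b \<in> bonds N" "continuous_on UNIV w" "\<forall>\<^sub>\<approx>t. (w has_real_derivative w1 t) (at t)"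
  shows "integral {bl b..br b} (\<lambda>t. if t \<in> A then w1 t else 0)
    = measure lborel (bond_a N La Ra b) * diffq (bond_a N La Ra b) w"
proof -
  have eq: "integral {bl b..br b} (\<lambda>t. if t \<in> A then w1 t else 0) = integral (bond_a N La Ra b) w1"
    unfolding bond_a_def bond_def
    by (metis Int_commute integral_restrict_Int integral_open_interval_real)
  show ?thesis
  proof (cases rule: bond_a_cases[OF assms(1)])
    case 1
    then show ?thesis using eq by simp
  next
    case interval: (2 p q)
    then show ?thesis
      using integral_cosparse_ftc[OF _ assms(2,3), of p q] eq
      by (simp add: integral_open_interval_real diffq_open)
  qed
qed

text \<open>The measure factor covers the empty intersection, where \<open>diffq\<close> rests on
  unspecified values of \<open>Sup\<close> and \<open>Inf\<close>.\<close>

lemma bond_a_diffq_agree: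
  assumes "b \<in> bonds N" "\<And>t. t \<in> range X \<Longrightarrow> v t = w t"
  shows "measure lborel (bond_a N La Ra b) * diffq (bond_a N La Ra b) v
    = measure lborel (bond_a N La Ra b) * diffq (bond_a N La Ra b) w"
  by (cases rule: bond_a_cases[OF assms(1)]) (simp_all add: diffq_open assms(2))

section \<open>Nodes of one period, sums over bonds and over elements\<close>

lemma X_unit: "X ` {1..int K} = range X \<inter> {-1/2<..1/2}"
  using qc_mesh by (simp add: qc_mesh_def)

lemma node_to_unit:
  obtains k :: int and m :: int where "k \<in> {1..int K}" "X i = X k + m"
proof -
  define m where "m = \<lceil>X i - 1/2\<rceil>"
  have "X i - m \<in> {-1/2<..1/2}" unfolding m_def greaterThanAtMost_iff by linarith
  moreover have "X i - m \<in> range X" using mesh.range_X_shift[of "X i" "- m"] by simp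
  ultimately have "X i - m \<in> X ` {1..int K}" using X_unit by blast
  then obtain k where "k \<in> {1..int K}" "X i - m = X k" by (rule imageE)
  then show ?thesis using that[of k m] by simp
qed

lemma mem_K_c: "k \<in> K_c La Ra K X \<longleftrightarrow> k \<in> {1..int K} \<and> X k \<notin> A"
proof (cases "k \<in> {1..int K}")
  case True
  then have X: "X k \<in> {-1/2<..1/2}" using X_unit by blast
  have "X k \<in> Om_c La Ra \<longleftrightarrow> X k \<in> C"
  proof
    assume "X k \<in> Om_c La Ra"
    then have "X k + of_int 0 \<in> C" unfolding periodic_ext_def by blast
    then show "X k \<in> C" by simp
  next
    assume "X k \<in> C"
    then have "X k \<notin> {La<..<Ra}" by (auto simp: mem_C mem_A dest: spec[of _ 0])
    then show "X k \<in> Om_c La Ra" using X by (simp add: Om_c_def Om_def)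
  qed
  then show ?thesis using True by (simp add: K_c_def mem_C)
qed (auto simp: K_c_def)

lemma finite_K_c: "finite (K_c La Ra K X)"
  by (rule finite_subset[of _ "{1..int K}"]) (auto simp: K_c_def)

lemma bonds_at_nodeI:
  assumes "b \<in> bonds N" "X i \<in> {bl b<..<br b}" "X i \<notin> A"
  shows "\<exists>k\<in>K_c La Ra K X. b \<in> bonds_at N (X k)"
proof -
  obtain k and m :: int where k: "k \<in> {1..int K}" "X i = X k + m" by (rule node_to_unit)
  then have "k \<in> K_c La Ra K X" using assms(3) by (auto simp: mem_K_c)
  moreover have "b \<in> bonds_at N (X k)"
    using assms k unfolding bonds_at_def bond_def by auto
  ultimately show ?thesis by blast
qed

lemma unit_unique:
  assumes "k \<in> {1..int K}" "k' \<in> {1..int K}" "X k + of_int m = X k' + of_int m'"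
  shows "k = k'"
proof -
  have "X k \<in> {-1/2<..1/2}" "X k' \<in> {-1/2<..1/2}" using assms X_unit by blast+
  then have "\<bar>real_of_int (m - m')\<bar> < 1" using assms(3) by auto
  then have "m = m'" by linarith
  then show ?thesis using assms(3) by simp
qed

lemma bonds_at_disjoint:
  assumes "k \<in> K_c La Ra K X" "k' \<in> K_c La Ra K X" "k \<noteq> k'"
  shows "bonds_at N (X k) \<inter> bonds_at N (X k') = {}"
proof (rule ccontr)
  assume "\<not> ?thesis"
  then obtain b and m m' :: int where b: "b \<in> bonds N"
    "X k + m \<in> {bl b<..<br b}" "X k' + m' \<in> {bl b<..<br b}"
    by (auto simp: bonds_at_def bond_def)
  have "X (k + int K * m) = X (k' + int K * m')"
    using node_unique[OF bond_short[OF b(1)], of "k + int K * m" "k' + int K * m'"] b assms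
    by (simp add: mesh.X_per_mult mem_K_c)
  then have "X k + m = X k' + m'" by (simp only: mesh.X_per_mult)
  then show False using unit_unique[of k k' m m'] assms by (simp add: mem_K_c)
qed

lemma sum_bonds_at:
  fixes G :: "int \<times> nat \<Rightarrow> real"
  assumes "\<And>b. b \<in> bonds N \<Longrightarrow> \<forall>k\<in>K_c La Ra K X. b \<notin> bonds_at N (X k) \<Longrightarrow> G b = 0"
  shows "(\<Sum>b\<in>bonds N. G b) = (\<Sum>k\<in>K_c La Ra K X. \<Sum>b\<in>bonds_at N (X k). G b)"
proof -
  have fin: "finite (bonds_at N t)" for t
    using finite_bonds by (simp add: bonds_at_def)
  have "(\<Sum>b\<in>bonds N. G b) = (\<Sum>b\<in>(\<Union>k\<in>K_c La Ra K X. bonds_at N (X k)). G b)"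
    by (rule sum.mono_neutral_right) (use finite_bonds assms in \<open>auto simp: bonds_at_def\<close>)
  also have "\<dots> = (\<Sum>k\<in>K_c La Ra K X. \<Sum>b\<in>bonds_at N (X k). G b)"
    by (rule sum.UNION_disjoint) (use fin bonds_at_disjoint finite_K_c in auto)
  finally show ?thesis .
qed

text \<open>There are two reasons why the local strain is the bond strain. If the bond meets A, the
  interfaces of that translate are nodes outside A and so not in the bond, which then lies in A
  entirely. Otherwise the bond lies within a single continuum element, where y is affine.\<close>

lemma no_node_bond:
  assumes b: "b \<in> bonds N" "\<forall>k\<in>K_c La Ra K X. b \<notin> bonds_at N (X k)" and y: "y \<in> P1 X"
  shows "\<forall>\<^sub>\<approx>t. t \<in> {bl b<..<br b} \<longrightarrow>
    (if t \<in> A then diffq (bond_a N La Ra b) y else deriv y t) = diffq (bond N b) y"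
proof (rule mesh.cosparse_gridI, rule impI)
  fix k t assume t: "t \<in> {X (k - 1)<..<X k}" "t \<in> {bl b<..<br b}"
  have no: "s \<notin> {bl b<..<br b}" if "s \<in> range X" "s \<notin> A" for s
    using bonds_at_nodeI[OF b(1)] b(2) that by auto
  show "(if t \<in> A then diffq (bond_a N La Ra b) y else deriv y t) = diffq (bond N b) y"
  proof (cases "t \<in> A")
    case True
    then obtain m where m: "La + of_int m < t" "t < Ra + of_int m" by (auto simp: mem_A)
    have "La + of_int m \<le> bl b" "br b \<le> Ra + of_int m"
      using no[OF interface_node(1) interface_notin_A(1), of m]
        no[OF interface_node(2) interface_notin_A(2), of m] m t
      unfolding greaterThanLessThan_iff by linarith+
    then have "{bl b<..<br b} \<subseteq> A" by (auto simp: mem_A intro!: exI[of _ m])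
    then have "bond_a N La Ra b = bond N b" by (auto simp: bond_a_def bond_def)
    with True show ?thesis by simp
  next
    case False
    then have "{X (k - 1)..X k} \<inter> A = {}" using elem_A_or_C[of k] t by auto
    then have "X (k - 1) \<notin> A" "X k \<notin> A" using mesh.X_step[of k] by (auto simp: disjoint_iff)
    then have le: "X (k - 1) \<le> bl b" "br b \<le> X k"
      using no[of "X (k - 1)"] no[of "X k"] t by force+
    have "y (br b) - y (bl b) = mesh.slope y k * (br b - bl b)"
      using mesh.P1_elem[OF y, of "br b" k] mesh.P1_elem[OF y, of "bl b" k] le bl_less_br[OF b(1)]
      by (simp add: algebra_simps)
    then have "diffq (bond N b) y = mesh.slope y k"
      using bl_less_br[OF b(1)] by (simp add: bond_def diffq_open)
    with False show ?thesis using mesh.P1_deriv[OF y t(1)] by simp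
  qed
qed

lemma sum_bonds: "(\<Sum>b\<in>bonds N. G b) = (\<Sum>l\<in>cell N. G (l, 1) + (G (l, 2) :: real))"
proof -
  have "(\<Sum>b\<in>bonds N. G b) = (\<Sum>l\<in>cell N. \<Sum>j\<in>{1, 2}. G (l, j))"
    unfolding bonds_def by (simp only: sum.cartesian_product) simp
  then show ?thesis by simp
qed

lemma sum_cell_shift:
  assumes "\<And>l. g (l + 2 * int N) = (g l :: real)"
  shows "(\<Sum>l\<in>cell N. g (l + m)) = (\<Sum>l\<in>cell N. g l)"
proof -
  have step: "(\<Sum>l\<in>cell N. h (l + 1)) = (\<Sum>l\<in>cell N. h l)" if "\<And>l. h (l + 2 * int N) = (h l :: real)" for h
  proof -
    have "(\<Sum>l\<in>cell N. h (l + 1)) = (\<Sum>l\<in>insert (int N + 1) {- int N + 2..int N}. h l)"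
      using N_pos
      by (intro sum.reindex_bij_witness[of _ "\<lambda>l. l - 1" "\<lambda>l. l + 1"]) (auto simp: cell_def)
    also have "\<dots> = h (- int N + 1) + (\<Sum>l\<in>{- int N + 2..int N}. h l)"
      using that[of "- int N + 1"] by (simp add: algebra_simps)
    also have "\<dots> = (\<Sum>l\<in>insert (- int N + 1) {- int N + 2..int N}. h l)"
      by simp
    also have "insert (- int N + 1) {- int N + 2..int N} = cell N"
      using N_pos by (auto simp: cell_def)
    finally show ?thesis .
  qed
  have per: "g (l + 2 * int N + m) = g (l + m)" for l m
    using assms[of "l + m"] by (simp add: ac_simps)
  have shift: "(\<Sum>l\<in>cell N. g (l + (m + 1))) = (\<Sum>l\<in>cell N. g (l + m))" for m
    using step[of "\<lambda>l. g (l + m)", OF per] by (simp add: ac_simps)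
  show ?thesis
  proof (induction m rule: int_induct[of _ 0])
    case (step2 m)
    then show ?case using shift[of "m - 1"] by simp
  qed (simp_all add: shift)
qed

lemma reduce_cell:
  obtains l' m where "l = l' + int (2 * N) * m" "l' \<in> cell N"
proof -
  define m where "m = (l + int N - 1) div int (2 * N)"
  have "l = (l + int N - 1) mod int (2 * N) - int N + 1 + int (2 * N) * m"
    unfolding m_def using mult_div_mod_eq[of "int (2 * N)" "l + int N - 1"] by linarith
  moreover have "0 \<le> (l + int N - 1) mod int (2 * N)" "(l + int N - 1) mod int (2 * N) < int (2 * N)"
    using N_pos by (auto intro: pos_mod_bound)
  ultimately show ?thesis
    by (intro that[of "(l + int N - 1) mod int (2 * N) - int N + 1" m]) (auto simp: cell_def)
qed

lemma integral_lattice_sum: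
  assumes "pwc g"
  shows "integral {-1/2..1/2} g = (\<Sum>l\<in>cell N. integral {lat N (l - 1)..lat N l} g)"
  using lattice.integral_grid_sum[OF assms, of "- int N" "int N"] by (simp add: lat_N cell_def)

text \<open>The period from \<open>X 0\<close> to \<open>X (int K)\<close> need not start at -1/2;
  periodicity moves it there.\<close>

lemma integral_mesh_sum:
  assumes "pwc g" "\<And>t. g (t + 1) = g t"
  shows "integral {-1/2..1/2} g = (\<Sum>k\<in>{1..int K}. integral {X (k - 1)..X k} g)"
proof -
  have XK: "X (int K) = X 0 + 1" using mesh.X_per[of 0] by simp
  have "X (int K) \<in> {-1/2<..1/2}" using X_unit mesh.K_pos by auto
  then have "integral {X 0..X 0 + 1} g = integral {-1/2..-1/2 + 1} g"
    using XK by (intro integral_period_shift assms) auto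
  also have "integral {X 0..X 0 + 1} g = (\<Sum>k\<in>{1..int K}. integral {X (k - 1)..X k} g)"
    using mesh.integral_grid_sum[OF assms(1), of 0 "int K"] XK by simp
  finally show ?thesis by simp
qed

text \<open>Up to translation almost every point is covered by exactly j bonds of range j.\<close>

lemma sum_bond_integral:
  assumes g: "pwc g" "\<And>t. g (t + 1) = g t" and j: "j \<in> {1, 2}"
  shows "(\<Sum>l\<in>cell N. integral {bl (l, j)..br (l, j)} g) = real j * integral {-1/2..1/2} g"
proof -
  define c where "c l = integral {lat N (l - 1)..lat N l} g" for l
  have per: "c (l + 2 * int N) = c l" for l
  proof -
    have "lat N (l + 2 * int N) = lat N l + 1" "lat N (l + 2 * int N - 1) = lat N (l - 1) + 1"
      using lattice.X_per[of l] lattice.X_per[of "l - 1"] by (simp_all add: algebra_simps)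
    then show ?thesis unfolding c_def by (simp add: integral_shift_real g)
  qed
  have sum: "(\<Sum>l\<in>cell N. c (l + m)) = integral {-1/2..1/2} g" for m
    using sum_cell_shift[of c m, OF per] integral_lattice_sum[OF g(1)] by (simp add: c_def)
  have "integral {bl (l, 2)..br (l, 2)} g = c (l + 1) + c (l + 2)" for l
    unfolding c_def fst_conv snd_conv
    by (subst Henstock_Kurzweil_Integration.integral_combine[symmetric, of _ "lat N (l + 1)"])
      (auto intro: pwc_integrable g simp: algebra_simps)
  then show ?thesis
    using j sum[of 1] sum[of 2] by (auto simp: sum.distrib c_def)
qed

end

section \<open>The continuum cells and the consistency error of the forces\<close>

text \<open>Written with \<open>deriv\<close>, as the estimators are. Continuity of the second
  derivative is recorded because it makes this derivative piecewise continuous.\<close>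

definition C2_at :: "(real \<Rightarrow> real) \<Rightarrow> real \<Rightarrow> bool" where
  "C2_at f t \<longleftrightarrow> (f has_real_derivative deriv f t) (at t) \<and>
     (deriv f has_real_derivative deriv (deriv f) t) (at t) \<and> isCont (deriv (deriv f)) t"

lemma Ck_on_subset: "Ck_on n S f \<Longrightarrow> T \<subseteq> S \<Longrightarrow> Ck_on n T f"
proof -
  assume "Ck_on n S f" and T: "T \<subseteq> S"
  then obtain g where g: "\<forall>t\<in>S. g 0 t = f t"
    "\<forall>j<n. \<forall>t\<in>S. (g j has_real_derivative g (Suc j) t) (at t within S)" "continuous_on S (g n)"
    unfolding Ck_on_def by blast
  then have "\<forall>j<n. \<forall>t\<in>T. (g j has_real_derivative g (Suc j) t) (at t within T)"
    using T by (intro allI impI ballI DERIV_subset[OF _ T]) auto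
  with g T show "Ck_on n T f"
    unfolding Ck_on_def using continuous_on_subset by blast
qed

lemma Ck_on_less:
  assumes "Ck_on n S \<phi>" "m < n"
  shows "Ck_on m S \<phi>"
proof -
  obtain g where g0: "\<forall>t\<in>S. g 0 t = \<phi> t"
    and g: "\<And>j t. j < n \<Longrightarrow> t \<in> S \<Longrightarrow> (g j has_real_derivative g (Suc j) t) (at t within S)"
    using assms(1) unfolding Ck_on_def by blast
  have "continuous_on S (g m)"
    unfolding continuous_on_eq_continuous_within
    by (intro ballI DERIV_continuous) (rule g[OF assms(2)])
  moreover have "\<forall>j<m. \<forall>t\<in>S. (g j has_real_derivative g (Suc j) t) (at t within S)"
    using g assms(2) by simp
  ultimately show ?thesis unfolding Ck_on_def using g0 by blast
qed

text \<open>In the interior the relative derivatives are the ordinary ones. The functions g1 and g2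
  are continuous up to the boundary and later bound the derivatives of f near the end points of a
  cell.\<close>

lemma Ck_on_2_deriv:
  assumes "Ck_on 2 S f"
  obtains g1 g2 where "continuous_on S g1" "continuous_on S g2"
    "\<And>t. t \<in> interior S \<Longrightarrow> C2_at f t \<and> deriv f t = g1 t \<and> deriv (deriv f) t = g2 t"
proof -
  obtain g where g0: "\<And>t. t \<in> S \<Longrightarrow> g 0 t = f t"
    and g: "\<And>j t. j < 2 \<Longrightarrow> t \<in> S \<Longrightarrow> (g j has_real_derivative g (Suc j) t) (at t within S)"
    and cont: "continuous_on S (g 2)"
    using assms unfolding Ck_on_def by blast
  have c1: "continuous_on S (g 1)"
    unfolding continuous_on_eq_continuous_within
    by (intro ballI DERIV_continuous) (rule g, simp_all)
  have near: "\<forall>\<^sub>F s in nhds t. s \<in> interior S" if "t \<in> interior S" for t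
    using that by (intro eventually_nhds_in_open) auto
  have gi: "(g j has_real_derivative g (Suc j) t) (at t)" if "j < 2" "t \<in> interior S" for j t
    using g[OF that(1)] that(2) interior_subset[of S] by (metis at_within_interior subsetD)
  have d1: "(f has_real_derivative g 1 t) (at t)" if t: "t \<in> interior S" for t
  proof -
    have "\<forall>\<^sub>F s in nhds t. g 0 s = f s"
      using near[OF t] by eventually_elim (use g0 interior_subset in blast)
    then show ?thesis using gi[of 0 t] t DERIV_cong_ev[of t t "g 0" f] by simp
  qed
  then have e1: "deriv f t = g 1 t" if "t \<in> interior S" for t
    using that by (intro DERIV_imp_deriv) auto
  have d2: "(deriv f has_real_derivative g 2 t) (at t)" if t: "t \<in> interior S" for t
  proof -
    have "\<forall>\<^sub>F s in nhds t. g 1 s = deriv f s"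
      using near[OF t] by eventually_elim (simp add: e1)
    then show ?thesis
      using gi[of 1 t] t DERIV_cong_ev[of t t "g 1" "deriv f"] by (simp add: numeral_2_eq_2)
  qed
  then have e2: "deriv (deriv f) t = g 2 t" if "t \<in> interior S" for t
    using that by (intro DERIV_imp_deriv) auto
  have c2: "isCont (deriv (deriv f)) t" if t: "t \<in> interior S" for t
  proof -
    have "\<forall>\<^sub>F s in nhds t. deriv (deriv f) s = g 2 s"
      using near[OF t] by eventually_elim (simp add: e2)
    then have "isCont (deriv (deriv f)) t \<longleftrightarrow> isCont (g 2) t" by (rule isCont_cong)
    then show ?thesis using cont t by (simp add: continuous_on_interior)
  qed
  show ?thesis
    by (rule that[OF c1 cont]) (use d1 d2 c2 e1 e2 in \<open>simp add: C2_at_def\<close>)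
qed

text \<open>The derivative relations at t + 1 and at t are equivalent for every candidate value, so
  the equation also holds where h is not differentiable and \<open>deriv\<close> is a
  default.\<close>

lemma deriv_shift_affine:
  fixes h :: "real \<Rightarrow> real"
  assumes "\<And>t. h (t + 1) = h t + c"
  shows "deriv h (t + 1) = deriv h t"
proof -
  have eq: "(\<lambda>s. h (s + 1)) = (\<lambda>s. h s + c)" using assms by auto
  have "(h has_real_derivative D) (at (t + 1)) \<longleftrightarrow> ((\<lambda>s. h s + c) has_real_derivative D) (at t)" for D
    using DERIV_shift[of h D t 1] unfolding eq by simp
  moreover have "((\<lambda>s. h s + c) has_real_derivative D) (at t) \<longleftrightarrow> (h has_real_derivative D) (at t)" for D
    using DERIV_add[of "\<lambda>s. h s + c" D t UNIV "\<lambda>_. - c" 0] DERIV_add[of h D t UNIV "\<lambda>_. c" 0] by auto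
  ultimately show ?thesis by (simp add: deriv_def)
qed

lemma deriv_shift1:
  fixes h :: "real \<Rightarrow> real"
  assumes "\<And>t. h (t + 1) = h t"
  shows "deriv h (t + 1) = deriv h t"
  using deriv_shift_affine[of h 0 t] assms by simp

lemma isCont_shift1:
  fixes h :: "real \<Rightarrow> real"
  assumes "\<And>t. h (t + 1) = (h t :: real)"
  shows "isCont h (t + 1) \<longleftrightarrow> isCont h t"
proof
  assume "isCont h (t + 1)"
  then have "isCont (\<lambda>s. h (s + 1)) t"
    by (intro isCont_o2[of t "\<lambda>s. s + 1" h]) (auto intro!: continuous_intros)
  then show "isCont h t" using assms by simp
next
  assume "isCont h t"
  then have "isCont (\<lambda>s. h (s - 1)) (t + 1)"
    by (intro isCont_o2[of _ "\<lambda>s. s - 1" h]) (auto intro!: continuous_intros)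
  moreover have "h (s - 1) = h s" for s using assms[of "s - 1"] by simp
  ultimately show "isCont h (t + 1)" by simp
qed

lemma C2_at_shift1:
  assumes "\<And>t. f (t + 1) = (f t :: real)"
  shows "C2_at f (t + 1) \<longleftrightarrow> C2_at f t"
proof -
  have per: "deriv f (s + 1) = deriv f s" "deriv (deriv f) (s + 1) = deriv (deriv f) s" for s
    using assms by (intro deriv_shift1; simp)+
  have eq: "(\<lambda>s. f (s + 1)) = f" "(\<lambda>s. deriv f (s + 1)) = deriv f"
    using assms per by auto
  have "isCont (deriv (deriv f)) (t + 1) \<longleftrightarrow> isCont (deriv (deriv f)) t"
    by (rule isCont_shift1) (rule per)
  then show ?thesis
    unfolding C2_at_def using DERIV_shift[of f _ t 1] DERIV_shift[of "deriv f" _ t 1] eq per by simp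
qed

text \<open>Since w is affine on the element, (f w)'' = 2 f' w' + f'' w; the weight in front of it
  is the Peano kernel.\<close>

lemma (in grid) integral_trapezoid_elem:
  assumes w: "w \<in> P1 X" and f: "continuous_on UNIV f"
    and C2: "\<And>t. t \<in> {X (k - 1)<..<X k} \<Longrightarrow> C2_at f t"
    and bd: "\<And>t. t \<in> {X (k - 1)<..<X k} \<Longrightarrow> \<bar>deriv f t\<bar> \<le> B"
  shows "integral {X (k - 1)..X k} (pw_interp X (\<lambda>k. f (X k) * w (X k)))
    = integral {X (k - 1)..X k}
        (\<lambda>t. bubble t * (2 * deriv f t * deriv w t + deriv (deriv f) t * w t) + f t * w t)"
proof -
  define \<sigma> where "\<sigma> = slope w k"
  define g1 where "g1 t = deriv f t * w t + f t * \<sigma>" for t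
  define g2 where "g2 t = deriv (deriv f) t * w t + 2 * deriv f t * \<sigma>" for t
  have wc: "continuous_on UNIV w" using w by (rule P1_continuous)
  have "bounded (w ` {X (k - 1)..X k})" "bounded (f ` {X (k - 1)..X k})"
    by (intro pwc_bounded pwc_continuous wc f)+
  then obtain W V where W: "\<And>t. t \<in> {X (k - 1)..X k} \<Longrightarrow> \<bar>w t\<bar> \<le> W"
    and V: "\<And>t. t \<in> {X (k - 1)..X k} \<Longrightarrow> \<bar>f t\<bar> \<le> V"
    unfolding bounded_iff by force
  have dw: "(w has_real_derivative \<sigma>) (at t)" if "t \<in> {X (k - 1)<..<X k}" for t
    using that unfolding \<sigma>_def by (rule P1_has_derivative[OF w])
  have "hk X k / 2 * (f (X (k - 1)) * w (X (k - 1)) + f (X k) * w (X k))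
    = integral {X (k - 1)..X k} (\<lambda>t. (t - X (k - 1)) * (X k - t) / 2 * g2 t + f t * w t)"
    unfolding hk_def
  proof (rule integral_trapezoid[where g = "\<lambda>t. f t * w t", symmetric])
    show "continuous_on {X (k - 1)..X k} (\<lambda>t. f t * w t)"
      by (intro continuous_intros continuous_on_subset[OF f] continuous_on_subset[OF wc]) auto
    fix t assume t: "t \<in> {X (k - 1)<..<X k}"
    show "((\<lambda>t. f t * w t) has_real_derivative g1 t) (at t)"
      using C2[OF t] dw[OF t] unfolding C2_at_def g1_def
      by (auto intro!: derivative_eq_intros)
    show "(g1 has_real_derivative g2 t) (at t)"
      using C2[OF t] dw[OF t] unfolding C2_at_def g1_def g2_def
      by (auto intro!: derivative_eq_intros)
    have "\<bar>deriv f t * w t\<bar> \<le> B * W"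
      unfolding abs_mult using bd[OF t] W[of t] t by (intro mult_mono) auto
    moreover have "\<bar>f t * \<sigma>\<bar> \<le> V * \<bar>\<sigma>\<bar>"
      unfolding abs_mult using V[of t] t by (intro mult_right_mono) auto
    ultimately show "\<bar>g1 t\<bar> \<le> B * W + V * \<bar>\<sigma>\<bar>" unfolding g1_def by linarith
  qed simp
  also have "\<dots> = integral {X (k - 1)..X k}
        (\<lambda>t. bubble t * (2 * deriv f t * deriv w t + deriv (deriv f) t * w t) + f t * w t)"
    by (rule integral_cosparse_cong, rule always_eventually)
      (auto simp: bubble_elem P1_deriv[OF w] g2_def \<sigma>_def algebra_simps)
  finally show ?thesis by (simp add: integral_pw_interp_elem)
qed

context qc_setting
begin

section \<open>The continuum cells and their relation to mesh elements\<close>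

abbreviation "Ct \<equiv> Om_ct N La Ra"

lemma open_A: "open A"
proof -
  have "A = (\<Union>m::int. {La + m<..<Ra + m})" by (auto simp: mem_A)
  then show ?thesis by (metis open_UN open_greaterThanLessThan)
qed

text \<open>A point of the open cell outside A lies in a gap of positive length between two
  translates, and this gap meets the cell in an interval. Positive measure is thus the same as not
  lying inside A.\<close>

lemma LC_iff: "measure lborel (T_eps N l \<inter> C) > 0 \<longleftrightarrow> \<not> T_eps N l \<subseteq> A"
proof
  assume "measure lborel (T_eps N l \<inter> C) > 0"
  then have "T_eps N l \<inter> C \<noteq> {}" by auto
  then show "\<not> T_eps N l \<subseteq> A" using mem_C by auto
next
  assume "\<not> T_eps N l \<subseteq> A"
  then obtain t where "t \<in> T_eps N l" and tA: "t \<notin> A" by blast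
  then have t: "lat N (l - 1) < t" "t < lat N l" by (auto simp: T_eps_def)
  define m where "m = \<lfloor>t - Ra\<rfloor>"
  have m: "Ra + m \<le> t" "t < Ra + (m + 1)" unfolding m_def by linarith+
  moreover have "\<not> (La + of_int (m + 1) < t \<and> t < Ra + of_int (m + 1))" using tA unfolding mem_A by blast
  ultimately have m2: "t \<le> La + m + 1" by auto
  define p q where "p = max (lat N (l - 1)) (Ra + m)" and "q = min (lat N l) (La + m + 1)"
  have gap: "Ra + m < La + m + 1" using Om_a by linarith
  have pq: "p < q" using t m m2 gap unfolding p_def q_def by linarith
  have sub: "{p<..<q} \<subseteq> T_eps N l \<inter> C"
  proof
    fix s assume s: "s \<in> {p<..<q}"
    then have "s \<notin> A" by (intro gap_notin_A[of m]) (auto simp: p_def q_def)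
    with s show "s \<in> T_eps N l \<inter> C" by (auto simp: mem_C T_eps_def p_def q_def)
  qed
  have "C = - A" using mem_C by auto
  then have "C \<in> sets lborel" using open_A by auto
  then have "T_eps N l \<inter> C \<in> fmeasurable lborel"
    unfolding T_eps_def by (intro fmeasurable_Int_fmeasurable fmeasurableI) auto
  then have "measure lborel {p<..<q} \<le> measure lborel (T_eps N l \<inter> C)"
    using sub by (intro measure_mono_fmeasurable) auto
  then show "measure lborel (T_eps N l \<inter> C) > 0" using pq by simp
qed

lemma closure_T_eps: "closure (T_eps N l) = {lat N (l - 1)..lat N l}"
  using lattice.X_step[of l] by (simp add: T_eps_def)

lemma Ct_iff: "t \<in> Ct \<longleftrightarrow> (\<exists>l. \<not> T_eps N l \<subseteq> A \<and> lat N (l - 1) \<le> t \<and> t \<le> lat N l)"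
  unfolding Om_ct_def LC_iff closure_T_eps by auto

lemma T_eps_Ct: "t \<in> T_eps N l \<Longrightarrow> t \<in> Ct \<longleftrightarrow> \<not> T_eps N l \<subseteq> A"
proof
  assume t: "t \<in> T_eps N l" "t \<in> Ct"
  then obtain j where j: "\<not> T_eps N j \<subseteq> A" "lat N (j - 1) \<le> t" "t \<le> lat N j"
    using Ct_iff by blast
  have "lat N (l - 1) < lat N j" "lat N (j - 1) < lat N l"
    using t j unfolding T_eps_def greaterThanLessThan_iff by linarith+
  then have "l = j" by simp
  with j show "\<not> T_eps N l \<subseteq> A" by simp
qed (auto simp: Ct_iff T_eps_def)

text \<open>The end points of the cell are nodes by (T2) and (T3). A node strictly inside would lie
  in A and hence be a lattice point, which an open cell does not contain.\<close>

lemma atomistic_cell: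
  assumes "T_eps N l \<subseteq> A"
  obtains k where "X (k - 1) = lat N (l - 1)" "X k = lat N l"
proof -
  define c where "c = (lat N (l - 1) + lat N l) / 2"
  have c: "lat N (l - 1) < c" "c < lat N l" using lattice.X_step[of l] by (auto simp: c_def)
  then have "c \<in> A" using assms by (auto simp: T_eps_def)
  then obtain m where m: "La + of_int m < c" "c < Ra + of_int m" by (auto simp: mem_A)
  have out: "La + of_int m \<notin> T_eps N l" "Ra + of_int m \<notin> T_eps N l"
    using assms interface_notin_A by blast+
  then have le: "La + m \<le> lat N (l - 1)" "lat N l \<le> Ra + m"
    using m c by (auto simp: T_eps_def)
  have nodes: "t \<in> range X" if "t \<in> range (lat N)" "La + m \<le> t" "t \<le> Ra + m" for t
  proof (cases "t = La + m \<or> t = Ra + m")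
    case False
    then have "t \<in> A" using that by (auto simp: mem_A intro!: exI[of _ m])
    then show ?thesis using lattice_node that by blast
  qed (use interface_node in auto)
  obtain i j where ij: "lat N (l - 1) = X i" "lat N l = X j"
    using nodes[of "lat N (l - 1)"] nodes[of "lat N l"] le c by force
  then have "i < j" using lattice.X_step[of l] by simp
  moreover have "\<not> i + 1 < j"
  proof
    assume "i + 1 < j"
    then have *: "X (i + 1) \<in> T_eps N l" by (simp add: T_eps_def ij)
    then have "X (i + 1) \<in> range (lat N)" using assms lattice_node by blast
    then obtain n where "X (i + 1) = lat N n" by blast
    with * have "l - 1 < n" "n < l" by (simp_all add: T_eps_def)
    then show False by simp
  qed
  ultimately have "j = i + 1" by simp
  with ij show ?thesis by (intro that[of j]) simp_all
qed

text \<open>An element inside A cannot pass a lattice point, which would be a node; so it sits in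
  one cell, and unless that cell is inside A too, the element belongs to \<open>Ct\<close>. Each
  point of a continuum element lies in a closed cell whose interior has points outside A.\<close>

lemma elem_Ct_cases:
  obtains (cont) "{X (k - 1)..X k} \<subseteq> Ct"
  | (atom) l where "T_eps N l \<subseteq> A" "X (k - 1) = lat N (l - 1)" "X k = lat N l"
proof -
  from elem_A_or_C[of k] show thesis
  proof
    assume A: "{X (k - 1)<..<X k} \<subseteq> A"
    obtain l where l: "lat N (l - 1) \<le> X (k - 1)" "X (k - 1) < lat N l"
      using lattice.ex_elem by blast
    have "X k \<le> lat N l"
    proof (rule ccontr)
      assume "\<not> ?thesis"
      then have *: "lat N l \<in> {X (k - 1)<..<X k}" using l by simp
      then have "lat N l \<in> range X" using A lattice_node by blast
      then show False using * node_next[of "lat N l" k] by auto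
    qed
    show thesis
    proof (cases "T_eps N l \<subseteq> A")
      case False
      then have "{X (k - 1)..X k} \<subseteq> Ct" using l \<open>X k \<le> lat N l\<close>
        unfolding Ct_iff by (auto simp: Ct_iff intro!: exI[of _ l])
      then show ?thesis by (rule cont)
    next
      case True
      then obtain j where j: "X (j - 1) = lat N (l - 1)" "X j = lat N l" by (rule atomistic_cell)
      then have "k = j"
        using mesh.elem_unique[of k "X (k - 1)" j] l mesh.X_step[of k] by simp
      then show ?thesis using atom[OF True] j by simp
    qed
  next
    assume A: "{X (k - 1)..X k} \<inter> A = {}"
    have "t \<in> Ct" if t: "X (k - 1) \<le> t" "t \<le> X k" for t
    proof (cases "t < X k")
      case True
      obtain l where l: "lat N (l - 1) \<le> t" "t < lat N l" using lattice.ex_elem by blast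
      \<comment> \<open>Moving slightly to the right within the element reaches the interior of a
        cell.\<close>
      define s where "s = (t + min (lat N l) (X k)) / 2"
      have "t < s" "s < lat N l" "s < X k" using l True by (auto simp: s_def)
      then have "s \<in> T_eps N l" "s \<notin> A" using l t A by (auto simp: T_eps_def disjoint_iff)
      then show ?thesis using l unfolding Ct_iff by (intro exI[of _ l]) auto
    next
      case False
      \<comment> \<open>At the right end of the element the move has to go to the left instead, into
        the cell that contains or ends at t.\<close>
      then have tk: "t = X k" using t by simp
      obtain j where j: "lat N (j - 1) \<le> t" "t < lat N j" using lattice.ex_elem by blast
      define l where "l = (if lat N (j - 1) = t then j - 1 else j)"
      have l: "lat N (l - 1) < t" "t \<le> lat N l"
        using j lattice.X_step[of "j - 1"] by (auto simp: l_def)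
      define M where "M = max (lat N (l - 1)) (X (k - 1))"
      define s where "s = (t + M) / 2"
      have "M < t" using l(1) tk mesh.X_step[of k] by (auto simp: M_def)
      then have "s < t" "M < s" by (simp_all add: s_def)
      then have "s < t" "lat N (l - 1) < s" "X (k - 1) < s" by (simp_all add: M_def)
      then have "s \<in> T_eps N l" "s \<notin> A" using l tk A by (auto simp: T_eps_def disjoint_iff)
      then show ?thesis using l unfolding Ct_iff by (intro exI[of _ l]) auto
    qed
    then show thesis by (intro cont) auto
  qed
qed

lemma elems_c_iff: "k \<in> elems_c N La Ra K X \<longleftrightarrow> k \<in> {1..int K} \<and> {X (k - 1)..X k} \<subseteq> Ct"
  by (simp add: elems_c_def elem_def)

lemma elem_outside_Ct:
  assumes "\<not> {X (k - 1)..X k} \<subseteq> Ct"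
  shows "{X (k - 1)<..<X k} \<inter> Ct = {}"
proof (cases rule: elem_Ct_cases[of k])
  case (atom l)
  then have "{X (k - 1)<..<X k} = T_eps N l" by (simp add: T_eps_def)
  then show ?thesis using T_eps_Ct atom(1) by blast
qed (use assms in simp)

lemma T_eps_shift: "t + 1 \<in> T_eps N (l + int (2 * N)) \<longleftrightarrow> t \<in> T_eps N l"
  using lattice.X_per[of l] lattice.X_per[of "l - 1"] by (simp add: T_eps_def algebra_simps)

lemma T_eps_A_shift: "T_eps N (l + int (2 * N)) \<subseteq> A \<longleftrightarrow> T_eps N l \<subseteq> A"
proof -
  have "T_eps N l \<subseteq> A \<longleftrightarrow> (\<forall>t. t + 1 \<in> T_eps N (l + int (2 * N)) \<longrightarrow> t + 1 \<in> A)"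
    unfolding T_eps_shift by auto
  also have "\<dots> \<longleftrightarrow> (\<forall>t. t \<in> T_eps N (l + int (2 * N)) \<longrightarrow> t \<in> A)"
    by (metis diff_add_cancel)
  finally show ?thesis by auto
qed

lemma Ct_shift [simp]: "t + 1 \<in> Ct \<longleftrightarrow> t \<in> Ct"
proof
  assume "t \<in> Ct"
  then obtain l where "\<not> T_eps N l \<subseteq> A" "lat N (l - 1) \<le> t" "t \<le> lat N l" by (auto simp: Ct_iff)
  then show "t + 1 \<in> Ct"
    using lattice.X_per[of l] lattice.X_per[of "l - 1"] T_eps_A_shift[of l]
    unfolding Ct_iff by (intro exI[of _ "l + int (2 * N)"]) (simp add: algebra_simps)
next
  assume "t + 1 \<in> Ct"
  then obtain l where "\<not> T_eps N l \<subseteq> A" "lat N (l - 1) \<le> t + 1" "t + 1 \<le> lat N l"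
    by (auto simp: Ct_iff)
  then show "t \<in> Ct"
    using lattice.X_per[of "l - int (2 * N)"] lattice.X_per[of "l - int (2 * N) - 1"]
      T_eps_A_shift[of "l - int (2 * N)"]
    unfolding Ct_iff by (intro exI[of _ "l - int (2 * N)"]) (simp add: algebra_simps)
qed

lemma pwc_indicator_Ct: "pwc (indicat_real Ct)"
  by (rule lattice.pwc_stepI[where c = "\<lambda>l. of_bool (\<not> T_eps N l \<subseteq> A)"])
    (use T_eps_Ct in \<open>auto simp: T_eps_def indicator_def\<close>)

end

section \<open>Forces of class C2 on the continuum cells, and their quadrature errors\<close>

locale qc_force = qc_setting N K La Ra X
  for N K :: nat and La Ra :: real and X :: "int \<Rightarrow> real" +
  fixes f :: "real \<Rightarrow> real"
  assumes f_cont: "continuous_on UNIV f" and f_per: "f (t + 1) = f t"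
    and f_C2: "f_regular N La Ra X f"
begin

text \<open>The cut-off is there because f need not be differentiable off \<open>Ct\<close>, where
  \<open>deriv\<close> would be unspecified and the kernel terms have to vanish.\<close>

definition F1 :: "real \<Rightarrow> real" where "F1 t = indicat_real Ct t * deriv f t"
definition F2 :: "real \<Rightarrow> real" where "F2 t = indicat_real Ct t * deriv (deriv f) t"

lemma F1_per: "F1 (t + 1) = F1 t" and F2_per: "F2 (t + 1) = F2 t"
proof -
  have "deriv f (s + 1) = deriv f s" for s
    by (rule deriv_shift1) (rule f_per)
  moreover from this have "deriv (deriv f) (s + 1) = deriv (deriv f) s" for s
    by (rule deriv_shift1)
  ultimately show "F1 (t + 1) = F1 t" "F2 (t + 1) = F2 t"
    by (simp_all add: F1_def F2_def indicator_def)
qed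

lemma f_C2_unit: "Ck_on 2 (Ct \<inter> {-1/2..1/2}) f"
  using f_C2 by (simp add: f_regular_def)

text \<open>Regularity is given on [-1/2, 1/2]. As the end points are lattice points, every cell is
  a translate of one inside this interval; the bound comes from the one-sided derivatives on the
  closed cell.\<close>

lemma cell_C2:
  assumes "\<not> T_eps N l \<subseteq> A"
  shows "\<exists>B. \<forall>t\<in>T_eps N l. C2_at f t \<and> \<bar>F1 t\<bar> \<le> B \<and> \<bar>F2 t\<bar> \<le> B"
proof -
  define P where "P l \<longleftrightarrow> (\<not> T_eps N l \<subseteq> A \<longrightarrow>
    (\<exists>B. \<forall>t\<in>T_eps N l. C2_at f t \<and> \<bar>F1 t\<bar> \<le> B \<and> \<bar>F2 t\<bar> \<le> B))" for l
  have per: "P (l + int (2 * N)) = P l" for l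
  proof -
    have "(\<forall>t\<in>T_eps N (l + int (2 * N)). C2_at f t \<and> \<bar>F1 t\<bar> \<le> B \<and> \<bar>F2 t\<bar> \<le> B)
      \<longleftrightarrow> (\<forall>t\<in>T_eps N l. C2_at f t \<and> \<bar>F1 t\<bar> \<le> B \<and> \<bar>F2 t\<bar> \<le> B)" (is "?L \<longleftrightarrow> ?R") for B
    proof -
      have "?L \<longleftrightarrow> (\<forall>t. t + 1 \<in> T_eps N (l + int (2 * N)) \<longrightarrow>
          C2_at f (t + 1) \<and> \<bar>F1 (t + 1)\<bar> \<le> B \<and> \<bar>F2 (t + 1)\<bar> \<le> B)"
        by (metis diff_add_cancel)
      also have "\<dots> \<longleftrightarrow> ?R"
        unfolding T_eps_shift F1_per F2_per C2_at_shift1[of f, OF f_per] by blast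
      finally show ?thesis .
    qed
    then show ?thesis unfolding P_def T_eps_A_shift by simp
  qed
  have P: "P l" if l: "l \<in> cell N" for l
    unfolding P_def
  proof
    assume nA: "\<not> T_eps N l \<subseteq> A"
    let ?I = "{lat N (l - 1)..lat N l}"
    have "lat N (- int N) \<le> lat N (l - 1)" "lat N l \<le> lat N (int N)"
      using l by (auto simp: cell_def simp del: lat_N)
    then have "?I \<subseteq> {-1/2..1/2}" by (auto simp: lat_N)
    moreover have "?I \<subseteq> Ct" using nA by (auto simp: Ct_iff intro!: exI[of _ l])
    ultimately have "?I \<subseteq> Ct \<inter> {-1/2..1/2}" by blast
    then have "Ck_on 2 ?I f" using f_C2_unit Ck_on_subset by blast
    then obtain g1 g2 where g: "continuous_on ?I g1" "continuous_on ?I g2"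
      "\<And>t. t \<in> T_eps N l \<Longrightarrow> C2_at f t \<and> deriv f t = g1 t \<and> deriv (deriv f) t = g2 t"
      by (rule Ck_on_2_deriv) (use that in \<open>auto simp: T_eps_def\<close>)
    have "bounded (g1 ` ?I)" "bounded (g2 ` ?I)"
      using g by (auto intro!: compact_imp_bounded compact_continuous_image)
    then obtain B1 B2 where B: "\<And>t. t \<in> ?I \<Longrightarrow> \<bar>g1 t\<bar> \<le> B1" "\<And>t. t \<in> ?I \<Longrightarrow> \<bar>g2 t\<bar> \<le> B2"
      unfolding bounded_iff by force
    have "C2_at f t \<and> \<bar>F1 t\<bar> \<le> max B1 B2 \<and> \<bar>F2 t\<bar> \<le> max B1 B2" if t: "t \<in> T_eps N l" for t
      using g(3)[OF t] B[of t] t T_eps_Ct[OF t] nA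
      by (auto simp: F1_def F2_def T_eps_def le_max_iff_disj)
    then show "\<exists>B. \<forall>t\<in>T_eps N l. C2_at f t \<and> \<bar>F1 t\<bar> \<le> B \<and> \<bar>F2 t\<bar> \<le> B" by blast
  qed
  obtain l' m where "l = l' + int (2 * N) * m" "l' \<in> cell N" by (rule reduce_cell)
  then have "P l" using P lattice.per_mult[of P l' m, OF per] by simp
  then show ?thesis using assms by (simp add: P_def)
qed

lemma pwc_F1: "pwc F1" and pwc_F2: "pwc F2"
proof -
  have "\<exists>B. \<forall>t\<in>T_eps N l. isCont F1 t \<and> isCont F2 t \<and> \<bar>F1 t\<bar> \<le> B \<and> \<bar>F2 t\<bar> \<le> B" for l
  proof (cases "T_eps N l \<subseteq> A")
    case True
    have near: "\<forall>\<^sub>F s in nhds t. s \<in> T_eps N l" if "t \<in> T_eps N l" for t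
      using that by (intro eventually_nhds_in_open) (auto simp: T_eps_def)
    have zero: "F1 t = 0" "F2 t = 0" if "t \<in> T_eps N l" for t
      using that True T_eps_Ct by (auto simp: F1_def F2_def indicator_def)
    have "isCont F1 t \<and> isCont F2 t" if t: "t \<in> T_eps N l" for t
    proof -
      have "\<forall>\<^sub>F s in nhds t. F1 s = 0" "\<forall>\<^sub>F s in nhds t. F2 s = 0"
        using near[OF t] by (auto elim!: eventually_mono simp: zero)
      then show ?thesis using isCont_cong[of F1 "\<lambda>_. 0"] isCont_cong[of F2 "\<lambda>_. 0"] by simp
    qed
    then show ?thesis using zero by (intro exI[of _ 0]) auto
  next
    case False
    have near: "\<forall>\<^sub>F s in nhds t. s \<in> T_eps N l" if "t \<in> T_eps N l" for t
      using that by (intro eventually_nhds_in_open) (auto simp: T_eps_def)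
    have eq: "F1 t = deriv f t" "F2 t = deriv (deriv f) t" if "t \<in> T_eps N l" for t
      using that False T_eps_Ct by (auto simp: F1_def F2_def)
    obtain B where B: "\<And>t. t \<in> T_eps N l \<Longrightarrow> C2_at f t \<and> \<bar>F1 t\<bar> \<le> B \<and> \<bar>F2 t\<bar> \<le> B"
      using cell_C2[OF False] by blast
    have "isCont F1 t \<and> isCont F2 t" if t: "t \<in> T_eps N l" for t
    proof -
      have "\<forall>\<^sub>F s in nhds t. F1 s = deriv f s" "\<forall>\<^sub>F s in nhds t. F2 s = deriv (deriv f) s"
        using near[OF t] by (auto elim!: eventually_mono simp: eq)
      moreover have "isCont (deriv f) t" "isCont (deriv (deriv f)) t"
        using B[OF t] by (auto simp: C2_at_def intro: DERIV_isCont)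
      ultimately show ?thesis
        using isCont_cong[of F1 "deriv f"] isCont_cong[of F2 "deriv (deriv f)"] by simp
    qed
    then show ?thesis using B by blast
  qed
  then obtain B where "\<And>l t. t \<in> T_eps N l \<Longrightarrow>
      isCont F1 t \<and> isCont F2 t \<and> \<bar>F1 t\<bar> \<le> B l \<and> \<bar>F2 t\<bar> \<le> B l" by metis
  then show "pwc F1" "pwc F2"
    unfolding T_eps_def by (auto intro!: lattice.pwc_gridI[where B = B])
qed

text \<open>Unlike a cell, a mesh element may have a half-integer in its interior, where regularity
  on [-1/2, 1/2] is one-sided only. In that case 1/2 is not a node and the second clause of
  \<open>f_regular\<close> applies.\<close>

lemma elem_C2:
  assumes "{X (k - 1)..X k} \<subseteq> Ct" "t \<in> {X (k - 1)<..<X k}"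
  shows "C2_at f t"
proof -
  have shift: "C2_at f (s + of_int m) \<longleftrightarrow> C2_at f s" for s and m :: int
  proof (induction m rule: int_induct[of _ 0])
    case (step1 m)
    then show ?case using C2_at_shift1[of f "s + of_int m", OF f_per] by (simp add: algebra_simps)
  next
    case (step2 m)
    then show ?case using C2_at_shift1[of f "s + of_int (m - 1)", OF f_per] by (simp add: algebra_simps)
  qed simp
  have Ct_m: "s + of_int m \<in> Ct \<longleftrightarrow> s \<in> Ct" for s and m :: int
  proof (induction m rule: int_induct[of _ 0])
    case (step1 m)
    then show ?case using Ct_shift[of "s + of_int m"] by (simp add: algebra_simps del: Ct_shift)
  next
    case (step2 m)
    then show ?case using Ct_shift[of "s + of_int (m - 1)"] by (simp add: algebra_simps del: Ct_shift)
  qed simp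
  define m where "m = \<lfloor>t + 1/2\<rfloor>"
  define s where "s = t - of_int m"
  have s: "- 1/2 \<le> s" "s < 1/2" unfolding s_def m_def by linarith+
  have st: "t = s + of_int m" by (simp add: s_def)
  have "C2_at f s"
  proof (cases "s = - 1/2")
    case True
    have "t \<notin> range X" using assms(2) node_next[of t k] by auto
    then have "1/2 \<notin> range X"
      using True mesh.range_X_shift[of "1/2" "m - 1"] st by simp
    then obtain \<delta> where \<delta>: "\<delta> > 0" "Ck_on 2 {1/2 - \<delta><..<1/2 + \<delta>} f"
      using f_C2 by (auto simp: f_regular_def)
    obtain g1 g2 where "\<And>t. t \<in> interior {1/2 - \<delta><..<1/2 + \<delta>} \<Longrightarrow>
        C2_at f t \<and> deriv f t = g1 t \<and> deriv (deriv f) t = g2 t"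
      using Ck_on_2_deriv[OF \<delta>(2)] by metis
    then have "C2_at f (1/2)" using \<delta>(1) by simp
    then show ?thesis using True C2_at_shift1[of f s, OF f_per] by simp
  next
    case False
    define U where "U = {X (k - 1) - m<..<X k - m} \<inter> {-1/2<..<1/2}"
    have "u \<in> Ct \<inter> {-1/2..1/2}" if "u \<in> U" for u
    proof -
      have "u + m \<in> {X (k - 1)..X k}" using that by (auto simp: U_def)
      then have "u + m \<in> Ct" using assms(1) by blast
      then show ?thesis using that Ct_m[of u m] by (simp add: U_def)
    qed
    then have "s \<in> interior (Ct \<inter> {-1/2..1/2})"
      using False s assms(2) st by (intro interiorI[of U]) (auto simp: U_def)
    then show ?thesis using Ck_on_2_deriv[OF f_C2_unit] by metis
  qed
  then show ?thesis using shift[of s m] st by simp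
qed

lemma integral_Ct_trapezoid_cell:
  assumes w: "w \<in> P1 (lat N)"
  shows "integral {lat N (l - 1)..lat N l}
      (\<lambda>t. indicat_real Ct t * pw_interp (lat N) (\<lambda>l. f (lat N l) * w (lat N l)) t)
    = integral {lat N (l - 1)..lat N l}
      (\<lambda>t. lattice.bubble t * (2 * F1 t * deriv w t + F2 t * w t) + indicat_real Ct t * f t * w t)"
proof (cases "T_eps N l \<subseteq> A")
  case True
  then have "t \<notin> Ct" if "t \<in> {lat N (l - 1)<..<lat N l}" for t
    using T_eps_Ct[of t l] that by (auto simp: T_eps_def)
  then show ?thesis
    by (intro integral_cosparse_cong always_eventually) (simp add: F1_def F2_def)
next
  case False
  then have Ct: "t \<in> Ct" if "t \<in> {lat N (l - 1)<..<lat N l}" for t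
    using T_eps_Ct[of t l] that by (auto simp: T_eps_def)
  obtain B where B: "\<And>t. t \<in> T_eps N l \<Longrightarrow> C2_at f t \<and> \<bar>F1 t\<bar> \<le> B"
    using cell_C2[OF False] by blast
  have "integral {lat N (l - 1)..lat N l}
      (\<lambda>t. indicat_real Ct t * pw_interp (lat N) (\<lambda>l. f (lat N l) * w (lat N l)) t)
    = integral {lat N (l - 1)..lat N l} (pw_interp (lat N) (\<lambda>l. f (lat N l) * w (lat N l)))"
    by (intro integral_cosparse_cong always_eventually) (simp add: Ct)
  also have "\<dots> = integral {lat N (l - 1)..lat N l} (\<lambda>t. lattice.bubble t *
      (2 * deriv f t * deriv w t + deriv (deriv f) t * w t) + f t * w t)"
  proof (rule lattice.integral_trapezoid_elem[OF w f_cont])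
    fix t assume t: "t \<in> {lat N (l - 1)<..<lat N l}"
    then show "C2_at f t" "\<bar>deriv f t\<bar> \<le> B"
      using B[of t] Ct[OF t] by (simp_all add: T_eps_def F1_def)
  qed
  also have "\<dots> = integral {lat N (l - 1)..lat N l}
      (\<lambda>t. lattice.bubble t * (2 * F1 t * deriv w t + F2 t * w t) + indicat_real Ct t * f t * w t)"
    by (intro integral_cosparse_cong always_eventually) (simp add: Ct F1_def F2_def)
  finally show ?thesis .
qed

lemma integral_Ct_trapezoid_elem:
  assumes w: "w \<in> P1 X"
  shows "integral {X (k - 1)..X k}
      (\<lambda>t. indicat_real Ct t * pw_interp X (\<lambda>k. f (X k) * w (X k)) t)
    = integral {X (k - 1)..X k}
      (\<lambda>t. mesh.bubble t * (2 * F1 t * deriv w t + F2 t * w t) + indicat_real Ct t * f t * w t)"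
proof (cases "{X (k - 1)..X k} \<subseteq> Ct")
  case False
  then have "t \<notin> Ct" if "t \<in> {X (k - 1)<..<X k}" for t
    using elem_outside_Ct[of k] that by (auto simp: disjoint_iff)
  then show ?thesis
    by (intro integral_cosparse_cong always_eventually) (simp add: F1_def F2_def)
next
  case True
  then have Ct: "t \<in> Ct" if "t \<in> {X (k - 1)<..<X k}" for t
    using that by auto
  have "bounded (F1 ` {X (k - 1)..X k})" by (rule pwc_bounded) (rule pwc_F1)
  then obtain B where B: "\<And>t. t \<in> {X (k - 1)..X k} \<Longrightarrow> \<bar>F1 t\<bar> \<le> B"
    unfolding bounded_iff by force
  have "integral {X (k - 1)..X k}
      (\<lambda>t. indicat_real Ct t * pw_interp X (\<lambda>k. f (X k) * w (X k)) t)
    = integral {X (k - 1)..X k} (pw_interp X (\<lambda>k. f (X k) * w (X k)))"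
    by (intro integral_cosparse_cong always_eventually) (simp add: Ct)
  also have "\<dots> = integral {X (k - 1)..X k} (\<lambda>t. mesh.bubble t *
      (2 * deriv f t * deriv w t + deriv (deriv f) t * w t) + f t * w t)"
  proof (rule mesh.integral_trapezoid_elem[OF w f_cont])
    fix t assume t: "t \<in> {X (k - 1)<..<X k}"
    then show "C2_at f t" by (rule elem_C2[OF True])
    show "\<bar>deriv f t\<bar> \<le> B" using B[of t] Ct[OF t] t by (simp add: F1_def)
  qed
  also have "\<dots> = integral {X (k - 1)..X k}
      (\<lambda>t. mesh.bubble t * (2 * F1 t * deriv w t + F2 t * w t) + indicat_real Ct t * f t * w t)"
    by (intro integral_cosparse_cong always_eventually) (simp add: Ct F1_def F2_def)
  finally show ?thesis .
qed

text \<open>Each lattice value is the right end of one cell and the left end of the next;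
  periodicity merges the two halves of its weight.\<close>

lemma ip_eps_integral:
  assumes "\<And>t. v (t + 1) = v t"
  shows "ip_eps N f (nodal N v)
    = integral {-1/2..1/2} (pw_interp (lat N) (\<lambda>l. f (lat N l) * v (lat N l)))"
proof -
  define g where "g l = f (lat N l) * v (lat N l)" for l
  have per: "g (l + 2 * int N) = g l" for l
    using lattice.X_per[of l] by (simp add: g_def assms f_per)
  have "integral {-1/2..1/2} (pw_interp (lat N) g) = (\<Sum>l\<in>cell N. eps N / 2 * (g (l - 1) + g l))"
    using lattice.continuous_pw_interp
    by (subst integral_lattice_sum)
      (auto simp: lattice.integral_pw_interp_elem intro!: pwc_continuous continuous_at_imp_continuous_on)
  also have "\<dots> = eps N / 2 * ((\<Sum>l\<in>cell N. g (l + (- 1))) + (\<Sum>l\<in>cell N. g l))"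
    by (simp add: sum_distrib_left sum.distrib distrib_left)
  also have "\<dots> = eps N * (\<Sum>l\<in>cell N. g l)"
    unfolding sum_cell_shift[of g, OF per] by simp
  finally show ?thesis by (simp add: ip_eps_def nodal_def g_def[abs_def])
qed

text \<open>Outside \<open>Ct\<close> the lattice cells are mesh elements, so that both quadrature rules agree there;
  inside, both are compared with the exact integral through the Peano kernel.\<close>

lemma force_error:
  assumes v: "v \<in> P1 (lat N)" "\<And>t. v (t + 1) = v t" and w: "w \<in> P1 X" "\<And>t. w (t + 1) = w t"
    and agree: "\<And>t. t \<in> range (lat N) \<Longrightarrow> t \<in> range X \<Longrightarrow> v t = w t"
  shows "ip_eps N f (nodal N v) - ip_h X f w = integral {-1/2..1/2}
    (\<lambda>t. lattice.bubble t * (2 * F1 t * deriv v t + F2 t * v t)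
      - mesh.bubble t * (2 * F1 t * deriv w t + F2 t * w t)
      + indicat_real Ct t * (f t * (v t - w t)))"
proof -
  let ?P = "pw_interp (lat N) (\<lambda>l. f (lat N l) * v (lat N l))"
  let ?Q = "pw_interp X (\<lambda>k. f (X k) * w (X k))"
  let ?p = "\<lambda>t. lattice.bubble t * (2 * F1 t * deriv v t + F2 t * v t) + indicat_real Ct t * f t * v t"
  let ?q = "\<lambda>t. mesh.bubble t * (2 * F1 t * deriv w t + F2 t * w t) + indicat_real Ct t * f t * w t"
  have dper: "deriv v (t + 1) = deriv v t" "deriv w (t + 1) = deriv w t" for t
    using v w by (auto intro: deriv_shift1)
  have Ct_per: "indicat_real Ct (t + 1) = indicat_real Ct t" for t
    by (simp add: indicator_def)
  have Qper: "?Q (t + 1) = ?Q t" for t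
    using mesh.pw_interp_per[of "\<lambda>k. f (X k) * w (X k)" 0] by (simp add: mesh.X_per f_per w)
  have pwc: "pwc ?P" "pwc ?Q"
    using lattice.continuous_pw_interp mesh.continuous_pw_interp
    by (auto intro!: pwc_continuous continuous_at_imp_continuous_on)
  note pI = pwc_intros pwc_indicator_Ct pwc_F1 pwc_F2 lattice.pwc_bubble mesh.pwc_bubble
    lattice.pwc_P1_deriv[OF v(1)] mesh.pwc_P1_deriv[OF w(1)] pwc
    pwc_continuous[OF f_cont] pwc_continuous[OF lattice.P1_continuous[OF v(1)]]
    pwc_continuous[OF mesh.P1_continuous[OF w(1)]]
  have outside: "\<forall>\<^sub>\<approx>t. t \<notin> Ct \<longrightarrow> ?P t = ?Q t"
  proof (rule mesh.cosparse_gridI, rule impI)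
    fix k t assume t: "t \<in> {X (k - 1)<..<X k}" "t \<notin> Ct"
    then have "t \<in> {X (k - 1)..X k}" by simp
    then have "\<not> {X (k - 1)..X k} \<subseteq> Ct" using t(2) by blast
    then obtain l where l: "X (k - 1) = lat N (l - 1)" "X k = lat N l"
      using elem_Ct_cases[of k] by blast
    have "v (X (k - 1)) = w (X (k - 1))" "v (X k) = w (X k)"
      by (rule agree; use l in \<open>metis rangeI\<close>)+
    then show "?P t = ?Q t"
      using t l lattice.pw_interp_elem[of t l] mesh.pw_interp_elem[of t k] by (simp add: hk_def)
  qed
  have "ip_eps N f (nodal N v) - ip_h X f w = integral {-1/2..1/2} (\<lambda>t. ?P t - ?Q t)"
    by (simp add: ip_eps_integral v ip_h_def I_h_def Om_def integral_pwc_diff pwc)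
  also have "\<dots> = integral {-1/2..1/2} (\<lambda>t. indicat_real Ct t * ?P t - indicat_real Ct t * ?Q t)"
    by (rule integral_cosparse_cong, rule eventually_mono[OF outside]) (auto simp: indicator_def)
  also have "\<dots> = integral {-1/2..1/2} (\<lambda>t. indicat_real Ct t * ?P t)
      - integral {-1/2..1/2} (\<lambda>t. indicat_real Ct t * ?Q t)"
    by (intro integral_pwc_diff pI)
  also have "integral {-1/2..1/2} (\<lambda>t. indicat_real Ct t * ?P t) = integral {-1/2..1/2} ?p"
    by (subst (1 2) integral_lattice_sum) (auto intro!: pI sum.cong integral_Ct_trapezoid_cell v)
  also have "integral {-1/2..1/2} (\<lambda>t. indicat_real Ct t * ?Q t) = integral {-1/2..1/2} ?q"
    by (subst (1 2) integral_mesh_sum)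
      (auto intro!: pI sum.cong integral_Ct_trapezoid_elem
        simp: w dper F1_per F2_per f_per mesh.bubble_per Qper Ct_per)
  also have "integral {-1/2..1/2} ?p - integral {-1/2..1/2} ?q = integral {-1/2..1/2} (\<lambda>t. ?p t - ?q t)"
    by (intro integral_pwc_diff[symmetric] pI)
  also have "(\<lambda>t. ?p t - ?q t) = (\<lambda>t. lattice.bubble t * (2 * F1 t * deriv v t + F2 t * v t)
      - mesh.bubble t * (2 * F1 t * deriv w t + F2 t * w t)
      + indicat_real Ct t * (f t * (v t - w t)))"
    by (auto simp: algebra_simps)
  finally show ?thesis .
qed

end

section \<open>Consistency of the energy\<close>

text \<open>Without integrability this holds because \<open>integral\<close> defaults to 0.\<close>

lemma L1norm_nonneg: "L1norm S g \<ge> 0"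
  by (cases "(\<lambda>t. \<bar>g t\<bar>) integrable_on S")
    (auto simp: L1norm_def not_integrable_integral intro!: integral_nonneg)

text \<open>The open set U is left free: for a lattice function the formula is used on the
  intersection of a cell with a mesh element on which f is known to be C2.\<close>

lemma (in grid) deriv2_mult:
  assumes w: "w \<in> P1 X" and U: "open U" "t \<in> U" "U \<subseteq> {X (k - 1)<..<X k}"
    and C2: "\<And>s. s \<in> U \<Longrightarrow> C2_at f s"
  shows "deriv (deriv (\<lambda>s. f s * w s)) t = 2 * deriv f t * deriv w t + deriv (deriv f) t * w t"
proof -
  have dw: "(w has_real_derivative slope w k) (at s)" if "s \<in> U" for s
    using that U(3) by (intro P1_has_derivative[OF w]) auto
  have d1: "deriv (\<lambda>s. f s * w s) s = deriv f s * w s + f s * slope w k" if "s \<in> U" for s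
    using C2[OF that] dw[OF that] unfolding C2_at_def
    by (intro DERIV_imp_deriv) (auto intro!: derivative_eq_intros)
  have "\<forall>\<^sub>F s in nhds t. s \<in> U" using U by (intro eventually_nhds_in_open)
  then have "\<forall>\<^sub>F s in nhds t. deriv (\<lambda>s. f s * w s) s = deriv f s * w s + f s * slope w k"
    by eventually_elim (rule d1)
  then have "deriv (deriv (\<lambda>s. f s * w s)) t = deriv (\<lambda>s. deriv f s * w s + f s * slope w k) t"
    by (intro deriv_cong_ev) auto
  also have "\<dots> = 2 * deriv f t * slope w k + deriv (deriv f) t * w t"
    using C2[OF U(2)] dw[OF U(2)] unfolding C2_at_def
    by (intro DERIV_imp_deriv) (auto intro!: derivative_eq_intros)
  also have "slope w k = deriv w t" using P1_deriv[OF w] U by auto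
  finally show ?thesis .
qed

lemma (in grid) jump_deriv:
  assumes "u \<in> P1 X"
  shows "jump (deriv u) (X k) = slope u (k + 1) - slope u k"
proof -
  have "\<forall>\<^sub>F s in at_right (X k). s \<in> {X (k + 1 - 1)<..<X (k + 1)}"
    using X_step[of "k + 1"] by (auto simp: eventually_at_right_field intro!: exI[of _ "X (k + 1)"])
  then have "\<forall>\<^sub>F s in at_right (X k). slope u (k + 1) = deriv u s"
    by eventually_elim (simp add: P1_deriv[OF assms, of _ "k + 1"])
  then have "(deriv u \<longlongrightarrow> slope u (k + 1)) (at_right (X k))"
    by (rule Lim_transform_eventually[OF tendsto_const])
  then have r: "Lim (at_right (X k)) (deriv u) = slope u (k + 1)"
    by (intro tendsto_Lim) auto
  have "\<forall>\<^sub>F s in at_left (X k). s \<in> {X (k - 1)<..<X k}"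
    using X_step[of k] by (auto simp: eventually_at_left_field intro!: exI[of _ "X (k - 1)"])
  then have "\<forall>\<^sub>F s in at_left (X k). slope u k = deriv u s"
    by eventually_elim (simp add: P1_deriv[OF assms, of _ k])
  then have "(deriv u \<longlongrightarrow> slope u k) (at_left (X k))"
    by (rule Lim_transform_eventually[OF tendsto_const])
  then have "Lim (at_left (X k)) (deriv u) = slope u k"
    by (intro tendsto_Lim) auto
  with r show ?thesis by (simp add: jump_def)
qed

context qc_setting
begin

section \<open>Bond defects and the interaction part of the energy\<close>

lemma ldiff_bonds:
  "rb (l, 1) * diffq (bond N (l, 1)) y = ldiff N (nodal N y) (l + 1)"
  "rb (l, 2) * diffq (bond N (l, 2)) y = ldiff N (nodal N y) (l + 1) + ldiff N (nodal N y) (l + 2)"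
proof -
  have lt: "lat N l < lat N (l + 1)" "lat N l < lat N (l + 2)" by simp_all
  have len: "lat N (l + 1) - lat N l = eps N" "lat N (l + 2) - lat N l = 2 * eps N"
    using lat_add[of l 1] lat_add[of l 2] by simp_all
  have idx: "l + 1 - 1 = l" "l + 2 - 1 = l + 1" by simp_all
  show "rb (l, 1) * diffq (bond N (l, 1)) y = ldiff N (nodal N y) (l + 1)"
    unfolding ldiff_def nodal_def idx bond_def rb_def fst_conv snd_conv
    using lt by (simp add: diffq_open len)
  show "rb (l, 2) * diffq (bond N (l, 2)) y = ldiff N (nodal N y) (l + 1) + ldiff N (nodal N y) (l + 2)"
    unfolding ldiff_def nodal_def idx bond_def rb_def fst_conv snd_conv
    using lt eps_pos by (simp add: diffq_open len diff_divide_distrib)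
qed

lemma ldiff_per:
  assumes "\<And>l. v (l + 2 * int N) = v l + c"
  shows "ldiff N v (l + 2 * int N) = ldiff N v l"
  using assms[of l] assms[of "l - 1"] by (simp add: ldiff_def algebra_simps)

lemma nodal_per:
  assumes "\<And>t. y (t + 1) = y t + c"
  shows "nodal N y (l + 2 * int N) = nodal N y l + c"
  using lattice.X_per[of l] assms[of "lat N l"] by (simp add: nodal_def)

text \<open>Bonds are indexed by their left end, the atomistic energy by the right end of the last
  difference; periodicity absorbs the shift. H has two arguments so as to serve both the energy and
  its first variation.\<close>

lemma sum_bonds_ldiff:
  assumes "\<And>t. y (t + 1) = y t + c" "\<And>t. v (t + 1) = v t + d"
  shows "(\<Sum>b\<in>bonds N. H (rb b * diffq (bond N b) y) (rb b * diffq (bond N b) v))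
    = (\<Sum>l\<in>cell N. H (ldiff N (nodal N y) l) (ldiff N (nodal N v) l)
        + (H (ldiff N (nodal N y) (l - 1) + ldiff N (nodal N y) l)
            (ldiff N (nodal N v) (l - 1) + ldiff N (nodal N v) l) :: real))"
proof -
  let ?d = "ldiff N (nodal N y)" and ?e = "ldiff N (nodal N v)"
  have per: "?d (l + 2 * int N) = ?d l" "?e (l + 2 * int N) = ?e l" for l
    by (rule ldiff_per, rule nodal_per, rule assms)+
  have per': "?d (l + 2 * int N - 1) = ?d (l - 1)" "?e (l + 2 * int N - 1) = ?e (l - 1)" for l
    using per[of "l - 1"] by (simp_all add: algebra_simps)
  have idx: "l + 2 - 1 = l + 1" for l :: int by simp
  have "(\<Sum>b\<in>bonds N. H (rb b * diffq (bond N b) y) (rb b * diffq (bond N b) v))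
    = (\<Sum>l\<in>cell N. H (?d (l + 1)) (?e (l + 1)) + H (?d (l + 2 - 1) + ?d (l + 2)) (?e (l + 2 - 1) + ?e (l + 2)))"
    unfolding sum_bonds ldiff_bonds idx ..
  also have "\<dots> = (\<Sum>l\<in>cell N. H (?d (l + 1)) (?e (l + 1)))
      + (\<Sum>l\<in>cell N. H (?d (l + 2 - 1) + ?d (l + 2)) (?e (l + 2 - 1) + ?e (l + 2)))"
    by (rule sum.distrib)
  also have "(\<Sum>l\<in>cell N. H (?d (l + 1)) (?e (l + 1))) = (\<Sum>l\<in>cell N. H (?d l) (?e l))"
    by (rule sum_cell_shift) (simp add: per)
  also have "(\<Sum>l\<in>cell N. H (?d (l + 2 - 1) + ?d (l + 2)) (?e (l + 2 - 1) + ?e (l + 2)))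
      = (\<Sum>l\<in>cell N. H (?d (l - 1) + ?d l) (?e (l - 1) + ?e l))"
    by (rule sum_cell_shift) (simp add: per per')
  finally show ?thesis by (simp add: sum.distrib)
qed

lemma E_a_int_bonds:
  assumes "\<And>t. y (t + 1) = y t + c"
  shows "E_a_int N \<phi> (nodal N y) = eps N * (\<Sum>b\<in>bonds N. \<phi> (rb b * diffq (bond N b) y))"
  unfolding E_a_int_def sum_bonds_ldiff[of y c y c "\<lambda>s _. \<phi> s", OF assms assms] ..

text \<open>Atomistic minus quasicontinuum density along a bond. With \<psi> = \<phi> its integrals
  give \<open>mu_k\<close>, with \<psi> the derivative of \<phi> the integrals of its square give
  \<open>eta_sq\<close>.\<close>

definition bond_defect :: "(real \<Rightarrow> real) \<Rightarrow> (real \<Rightarrow> real) \<Rightarrow> int \<times> nat \<Rightarrow> real \<Rightarrow> real" where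
  "bond_defect \<psi> y b t = \<psi> (rb b * diffq (bond N b) y)
     - (if t \<in> A then \<psi> (rb b * diffq (bond_a N La Ra b) y) else \<psi> (rb b * deriv y t))"

lemma pwc_bond_defect: "y \<in> P1 X \<Longrightarrow> pwc (bond_defect \<psi> y b)"
  unfolding bond_defect_def[abs_def]
  by (intro pwc_intros pwc_if_A mesh.pwc_P1_comp_deriv[of y "\<lambda>s. \<psi> (rb b * s)"])

lemma bond_defect_zero:
  assumes "b \<in> bonds N" "\<forall>k\<in>K_c La Ra K X. b \<notin> bonds_at N (X k)" "y \<in> P1 X"
  shows "\<forall>\<^sub>\<approx>t. t \<in> {bl b<..<br b} \<longrightarrow> bond_defect \<psi> y b t = 0"
  using no_node_bond[OF assms]
  by (rule eventually_mono) (auto simp: bond_defect_def split: if_splits)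

lemma bond_defect_integral:
  assumes "y \<in> P1 X" "b \<in> bonds N"
  shows "measure lborel (bond_a N La Ra b) / rb b
       * (\<phi> (rb b * diffq (bond N b) y) - \<phi> (rb b * diffq (bond_a N La Ra b) y))
     + 1 / rb b * integral (bond_c N La Ra b)
         (\<lambda>t. \<phi> (rb b * diffq (bond N b) y) - \<phi> (rb b * deriv y t))
    = 1 / rb b * integral {bl b..br b} (bond_defect \<phi> y b)"
proof -
  let ?a = "\<phi> (rb b * diffq (bond N b) y) - \<phi> (rb b * diffq (bond_a N La Ra b) y)"
  let ?c = "\<lambda>t. \<phi> (rb b * diffq (bond N b) y) - \<phi> (rb b * deriv y t)"
  have "measure lborel (bond_a N La Ra b) * ?a + integral (bond_c N La Ra b) ?c
    = integral (bond_a N La Ra b) (\<lambda>_. ?a) + integral (bond_c N La Ra b) ?c"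
    by (simp add: measure_bond_a assms)
  also have "\<dots> = integral {bl b..br b} (\<lambda>t. if t \<in> A then ?a else ?c t)"
    by (rule bond_split) (intro pwc_intros mesh.pwc_P1_comp_deriv[of y "\<lambda>s. \<phi> (rb b * s)"] assms)+
  also have "(\<lambda>t. if t \<in> A then ?a else ?c t) = bond_defect \<phi> y b"
    by (auto simp: bond_defect_def)
  finally show ?thesis by (simp add: field_simps add_divide_distrib[symmetric])
qed

lemma E_qc_int_bonds:
  assumes y: "y \<in> P1 X"
  shows "E_qc_int N La Ra \<phi> y = (\<Sum>b\<in>bonds N. 1 / rb b * integral {bl b..br b}
    (\<lambda>t. if t \<in> A then \<phi> (rb b * diffq (bond_a N La Ra b) y) else \<phi> (rb b * deriv y t)))"
  unfolding E_qc_int_def sum_distrib_left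
proof (rule sum.cong)
  fix b assume b: "b \<in> bonds N"
  let ?a = "\<phi> (rb b * diffq (bond_a N La Ra b) y)"
  have "eps N * (a_bond N La Ra \<phi> y b + c_bond N La Ra \<phi> y b)
    = 1 / rb b * (measure lborel (bond_a N La Ra b) * ?a
      + integral (bond_c N La Ra b) (\<lambda>t. \<phi> (rb b * deriv y t)))"
    using eps_pos rb_pos[OF b]
    by (simp add: a_bond_def c_bond_def measure_bond[OF b] field_simps)
  also have "measure lborel (bond_a N La Ra b) * ?a = integral (bond_a N La Ra b) (\<lambda>_. ?a)"
    by (simp add: measure_bond_a[OF b])
  also have "integral (bond_a N La Ra b) (\<lambda>_. ?a) + integral (bond_c N La Ra b) (\<lambda>t. \<phi> (rb b * deriv y t))
    = integral {bl b..br b} (\<lambda>t. if t \<in> A then ?a else \<phi> (rb b * deriv y t))"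
    by (rule bond_split) (intro pwc_intros mesh.pwc_P1_comp_deriv[of y "\<lambda>s. \<phi> (rb b * s)"] y)+
  finally show "eps N * (a_bond N La Ra \<phi> y b + c_bond N La Ra \<phi> y b) = 1 / rb b * integral {bl b..br b}
      (\<lambda>t. if t \<in> A then ?a else \<phi> (rb b * deriv y t))" .
qed simp

lemma energy_defect:
  assumes y: "y \<in> P1 X" "\<And>t. y (t + 1) = y t + c"
  shows "E_a_int N \<phi> (nodal N y) - E_qc_int N La Ra \<phi> y
    = (\<Sum>b\<in>bonds N. 1 / rb b * integral {bl b..br b} (bond_defect \<phi> y b))"
proof -
  have "eps N * \<phi> (rb b * diffq (bond N b) y) - 1 / rb b * integral {bl b..br b}
      (\<lambda>t. if t \<in> A then \<phi> (rb b * diffq (bond_a N La Ra b) y) else \<phi> (rb b * deriv y t))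
    = 1 / rb b * integral {bl b..br b} (bond_defect \<phi> y b)" if b: "b \<in> bonds N" for b
  proof -
    have "integral {bl b..br b} (bond_defect \<phi> y b)
      = integral {bl b..br b} (\<lambda>t. \<phi> (rb b * diffq (bond N b) y)) - integral {bl b..br b}
        (\<lambda>t. if t \<in> A then \<phi> (rb b * diffq (bond_a N La Ra b) y) else \<phi> (rb b * deriv y t))"
      unfolding bond_defect_def[abs_def]
      by (intro integral_pwc_diff pwc_intros pwc_if_A mesh.pwc_P1_comp_deriv[of y "\<lambda>s. \<phi> (rb b * s)"] y)
    then show ?thesis
      using bl_less_br[OF b] rb_pos[OF b] bond_len[of b] by (simp add: field_simps)
  qed
  then show ?thesis
    by (simp add: E_a_int_bonds[of y c, OF y(2)] E_qc_int_bonds[OF y(1)] sum_distrib_left sum_subtractf[symmetric])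
qed

lemma energy_defect_le:
  assumes y: "y \<in> P1 X" "\<And>t. y (t + 1) = y t + c"
  shows "\<bar>E_a_int N \<phi> (nodal N y) - E_qc_int N La Ra \<phi> y\<bar> \<le> mu_est N La Ra K X \<phi> y"
proof -
  define G where "G b = 1 / rb b * integral {bl b..br b} (bond_defect \<phi> y b)" for b
  have G0: "G b = 0" if "b \<in> bonds N" "\<forall>k\<in>K_c La Ra K X. b \<notin> bonds_at N (X k)" for b
  proof -
    have "integral {bl b..br b} (bond_defect \<phi> y b) = integral {bl b..br b} (\<lambda>_. 0)"
      by (rule integral_cosparse_cong) (rule bond_defect_zero[OF that y(1)])
    then show ?thesis by (simp add: G_def)
  qed
  have mu: "mu_k N La Ra X \<phi> y k = \<bar>\<Sum>b\<in>bonds_at N (X k). G b\<bar>" for k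
    unfolding mu_k_def G_def
    by (intro arg_cong[where f = abs] sum.cong refl bond_defect_integral y) (simp add: bonds_at_def)
  have "E_a_int N \<phi> (nodal N y) - E_qc_int N La Ra \<phi> y = (\<Sum>b\<in>bonds N. G b)"
    unfolding G_def by (rule energy_defect[OF y])
  also have "\<dots> = (\<Sum>k\<in>K_c La Ra K X. \<Sum>b\<in>bonds_at N (X k). G b)"
    by (rule sum_bonds_at) (rule G0)
  finally show ?thesis
    unfolding mu_est_def mu by (simp add: sum_abs)
qed

text \<open>With a single kink at s the interpolation error is the slope jump times a hat function
  of height (s - a)(b - s)/(b - a), which is below (b - a)/2.\<close>

lemma kink_bound:
  fixes a b s t p q :: real
  assumes "a < s" "s < b" "t \<in> {a..b}"
    and u: "u t = u s + (if t \<le> s then p else q) * (t - s)" "u a = u s + p * (a - s)" "u b = u s + q * (b - s)"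
  shows "\<bar>u a + (t - a) / (b - a) * (u b - u a) - u t\<bar> \<le> (b - a) / 2 * \<bar>q - p\<bar>"
proof -
  define d where "d = (if t \<le> s then (t - a) * (b - s) else (b - t) * (s - a))"
  define E where "E = u a + (t - a) / (b - a) * (u b - u a) - u t"
  have "(b - a) * ((t - a) / (b - a) * (u b - u a)) = (t - a) * (u b - u a)"
    using assms by simp
  then have "(b - a) * E = (b - a) * (u a - u t) + (t - a) * (u b - u a)"
    unfolding E_def by (simp add: distrib_left right_diff_distrib)
  also have "\<dots> = d * (q - p)"
    unfolding u d_def by (auto simp: algebra_simps)
  finally have eq: "E = d * (q - p) / (b - a)"
    using assms by (simp add: eq_divide_eq mult.commute)
  have "d \<le> (s - a) * (b - s)"
    using assms unfolding d_def by (auto intro: mult_mono simp: mult.commute)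
  also have "\<dots> \<le> (b - a)\<^sup>2 / 2"
  proof -
    have "(b - a)\<^sup>2 - 4 * ((s - a) * (b - s)) = ((s - a) - (b - s))\<^sup>2" by algebra
    moreover have "0 \<le> ((s - a) - (b - s))\<^sup>2" "0 \<le> (b - a)\<^sup>2" by simp_all
    ultimately show ?thesis by linarith
  qed
  finally have "d \<le> (b - a)\<^sup>2 / 2" .
  moreover have "0 \<le> d" using assms unfolding d_def by auto
  ultimately have "\<bar>d * (q - p)\<bar> \<le> (b - a)\<^sup>2 / 2 * \<bar>q - p\<bar>"
    unfolding abs_mult by (intro mult_right_mono) auto
  then show ?thesis
    unfolding E_def[symmetric] eq using assms by (simp add: field_simps power2_eq_square)
qed

text \<open>Nodes in A are lattice points, and an open cell contains none.\<close>

lemma cell_node_C: "X i \<in> T_eps N l \<Longrightarrow> X i \<notin> A"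
proof
  assume i: "X i \<in> T_eps N l" "X i \<in> A"
  then obtain n where "X i = lat N n" using lattice_node by blast
  with i have "l - 1 < n" "n < l" by (simp_all add: T_eps_def)
  then show False by simp
qed

lemma cell_node_unique: "X i \<in> T_eps N l \<Longrightarrow> X j \<in> T_eps N l \<Longrightarrow> i = j"
  using node_unique[of "lat N l" "lat N (l - 1)" i j] cell_node_C[of i l] cell_node_C[of j l]
    eps_pos lat_add[of "l - 1" 1] by (simp add: T_eps_def)

lemma I_eps_elem:
  "t \<in> {lat N (l - 1)..lat N l} \<Longrightarrow> I_eps N u t = u (lat N (l - 1))
    + (t - lat N (l - 1)) / (lat N l - lat N (l - 1)) * (u (lat N l) - u (lat N (l - 1)))"
  unfolding I_eps_def by (subst lattice.pw_interp_elem) (auto simp: nodal_def hk_def)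

lemma I_eps_error_no_node:
  assumes u: "u \<in> P1 X" and no: "\<And>i. X i \<notin> T_eps N l" and t: "t \<in> {lat N (l - 1)..lat N l}"
  shows "I_eps N u t = u t"
proof -
  obtain k where k: "X (k - 1) \<le> lat N (l - 1)" "lat N (l - 1) < X k" using mesh.ex_elem by blast
  then have k': "lat N l \<le> X k" using no[of k] by (auto simp: T_eps_def)
  have el: "u s = u (X (k - 1)) + mesh.slope u k * (s - X (k - 1))"
    if "s \<in> {lat N (l - 1)..lat N l}" for s
    using that k k' by (intro mesh.P1_elem[OF u]) auto
  have lt: "lat N (l - 1) < lat N l" by simp
  have "u (lat N l) - u (lat N (l - 1)) = mesh.slope u k * (lat N l - lat N (l - 1))"
    "u t = u (lat N (l - 1)) + mesh.slope u k * (t - lat N (l - 1))"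
    using el[OF t] el[of "lat N l"] el[of "lat N (l - 1)"] lt by (simp_all add: algebra_simps)
  then show ?thesis
    unfolding I_eps_elem[OF t] using lt by simp
qed

lemma I_eps_error_node:
  assumes u: "u \<in> P1 X" and k: "X k \<in> T_eps N l" and t: "t \<in> {lat N (l - 1)..lat N l}"
  shows "\<bar>I_eps N u t - u t\<bar> \<le> eps N / 2 * \<bar>jump (deriv u) (X k)\<bar>"
proof -
  have "X (k - 1) \<notin> T_eps N l" "X (k + 1) \<notin> T_eps N l"
    using cell_node_unique[OF k] by force+
  moreover have "X (k - 1) < X k" "X k < X (k + 1)" by simp_all
  ultimately have le: "X (k - 1) \<le> lat N (l - 1)" "lat N l \<le> X (k + 1)"
    "lat N (l - 1) < X k" "X k < lat N l"
    using k unfolding T_eps_def greaterThanLessThan_iff by linarith+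
  have left: "u s = u (X k) + mesh.slope u k * (s - X k)" if "lat N (l - 1) \<le> s" "s \<le> X k" for s
    using mesh.P1_elem[OF u, of s k] mesh.P1_elem[OF u, of "X k" k] that le by (simp add: algebra_simps)
  have right: "u s = u (X k) + mesh.slope u (k + 1) * (s - X k)" if "X k \<le> s" "s \<le> lat N l" for s
    using mesh.P1_elem[OF u, of s "k + 1"] that le by simp
  have "\<bar>u (lat N (l - 1)) + (t - lat N (l - 1)) / (lat N l - lat N (l - 1))
        * (u (lat N l) - u (lat N (l - 1))) - u t\<bar>
      \<le> (lat N l - lat N (l - 1)) / 2 * \<bar>mesh.slope u (k + 1) - mesh.slope u k\<bar>"
  proof (rule kink_bound)
    show "lat N (l - 1) < X k" "X k < lat N l" "t \<in> {lat N (l - 1)..lat N l}"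
      using le t by simp_all
    show "u t = u (X k) + (if t \<le> X k then mesh.slope u k else mesh.slope u (k + 1)) * (t - X k)"
      using left[of t] right[of t] t by simp
    show "u (lat N (l - 1)) = u (X k) + mesh.slope u k * (lat N (l - 1) - X k)"
      using le by (intro left) simp_all
    show "u (lat N l) = u (X k) + mesh.slope u (k + 1) * (lat N l - X k)"
      using le by (intro right) simp_all
  qed
  then show ?thesis
    unfolding I_eps_elem[OF t] mesh.jump_deriv[OF u] using hk_lat[of l] by (simp add: hk_def)
qed

lemma omega_T_eps: "t \<in> T_eps N l \<Longrightarrow> omega N t = T_eps N l"
proof -
  assume t: "t \<in> T_eps N l"
  have "j = l" if "t \<in> T_eps N j" for j
  proof -
    have "lat N (l - 1) < lat N j" "lat N (j - 1) < lat N l"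
      using t that unfolding T_eps_def greaterThanLessThan_iff by linarith+
    then show ?thesis by simp
  qed
  then have "{j. t \<in> T_eps N j} = {l}" using t by blast
  then show ?thesis by (simp add: omega_def)
qed

lemma cell_node_K_c:
  assumes "l \<in> cell N" "X i \<in> T_eps N l"
  shows "i \<in> K_c La Ra K X"
proof -
  have "lat N (- int N) \<le> lat N (l - 1)" "lat N l \<le> lat N (int N)"
    using assms(1) by (auto simp: cell_def simp del: lat_N)
  then have "X i \<in> {-1/2<..1/2}" using assms(2) by (auto simp: T_eps_def lat_N)
  then have "X i \<in> X ` {1..int K}" using X_unit by blast
  then have "i \<in> {1..int K}" by auto
  then show ?thesis using cell_node_C[OF assms(2)] by (simp add: mem_K_c)
qed

lemma cell_kink_integral:
  assumes u: "u \<in> P1 X" and f: "continuous_on UNIV f" and l: "l \<in> cell N"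
  shows "integral {lat N (l - 1)..lat N l} (\<lambda>t. \<bar>f t\<bar> * \<bar>I_eps N u t - u t\<bar>)
    \<le> (\<Sum>k\<in>{k \<in> K_c La Ra K X. X k \<in> T_eps N l}.
        eps N / 2 * L1norm (omega N (X k)) f * \<bar>jump (deriv u) (X k)\<bar>)"
proof (cases "\<exists>i. X i \<in> T_eps N l")
  case False
  then have "I_eps N u t = u t" if "t \<in> {lat N (l - 1)..lat N l}" for t
    using I_eps_error_no_node[OF u _ that] by blast
  then have "integral {lat N (l - 1)..lat N l} (\<lambda>t. \<bar>f t\<bar> * \<bar>I_eps N u t - u t\<bar>)
      = integral {lat N (l - 1)..lat N l} (\<lambda>_. 0)"
    by (intro integral_cosparse_cong always_eventually) auto
  also have "\<dots> = 0" by simp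
  finally show ?thesis using False by simp
next
  case True
  then obtain k where k: "X k \<in> T_eps N l" by blast
  have "j = k" if "X j \<in> T_eps N l" for j
    using cell_node_unique[OF that k] .
  then have set: "{k \<in> K_c La Ra K X. X k \<in> T_eps N l} = {k}"
    using k cell_node_K_c[OF l k] by blast
  have cont: "pwc (I_eps N u)" "pwc u" "pwc f"
    unfolding I_eps_def using lattice.continuous_pw_interp mesh.P1_continuous[OF u] f
    by (auto intro!: pwc_continuous continuous_at_imp_continuous_on)
  have "integral {lat N (l - 1)..lat N l} (\<lambda>t. \<bar>f t\<bar> * \<bar>I_eps N u t - u t\<bar>)
    \<le> integral {lat N (l - 1)..lat N l} (\<lambda>t. \<bar>f t\<bar> * (eps N / 2 * \<bar>jump (deriv u) (X k)\<bar>))"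
    by (intro integral_cosparse_mono pwc_intros cont always_eventually allI impI mult_left_mono
        I_eps_error_node[OF u k]) auto
  also have "\<dots> = eps N / 2 * integral {lat N (l - 1)..lat N l} (\<lambda>t. \<bar>f t\<bar>) * \<bar>jump (deriv u) (X k)\<bar>"
    by simp
  also have "integral {lat N (l - 1)..lat N l} (\<lambda>t. \<bar>f t\<bar>) = L1norm (omega N (X k)) f"
    unfolding L1norm_def omega_T_eps[OF k] T_eps_def by (rule integral_open_interval_real)
  finally show ?thesis by (simp add: set)
qed

text \<open>A node lies in at most one open cell, so no jump is charged twice; a node at a lattice
  point lies in none and causes no interpolation error.\<close>

lemma kink_integral:
  assumes u: "u \<in> P1 X" and f: "continuous_on UNIV f"
  shows "integral {-1/2..1/2} (\<lambda>t. \<bar>f t\<bar> * \<bar>I_eps N u t - u t\<bar>)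
    \<le> (\<Sum>k\<in>K_c La Ra K X. eps N / 2 * L1norm (omega N (X k)) f * \<bar>jump (deriv u) (X k)\<bar>)"
proof -
  define m where "m k = eps N / 2 * L1norm (omega N (X k)) f * \<bar>jump (deriv u) (X k)\<bar>" for k
  have m_nonneg: "m k \<ge> 0" for k
    unfolding m_def using eps_pos by (intro mult_nonneg_nonneg L1norm_nonneg) auto
  have cont: "pwc (I_eps N u)" "pwc u" "pwc f"
    unfolding I_eps_def using lattice.continuous_pw_interp mesh.P1_continuous[OF u] f
    by (auto intro!: pwc_continuous continuous_at_imp_continuous_on)
  have "integral {-1/2..1/2} (\<lambda>t. \<bar>f t\<bar> * \<bar>I_eps N u t - u t\<bar>)
    = (\<Sum>l\<in>cell N. integral {lat N (l - 1)..lat N l} (\<lambda>t. \<bar>f t\<bar> * \<bar>I_eps N u t - u t\<bar>))"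
    by (intro integral_lattice_sum pwc_intros cont)
  also have "\<dots> \<le> (\<Sum>l\<in>cell N. \<Sum>k\<in>{k \<in> K_c La Ra K X. X k \<in> T_eps N l}. m k)"
    unfolding m_def by (intro sum_mono cell_kink_integral u f)
  also have "\<dots> = (\<Sum>k\<in>K_c La Ra K X. \<Sum>l\<in>{l \<in> cell N. X k \<in> T_eps N l}. m k)"
    using finite_K_c by (intro sum.swap_restrict) (auto simp: cell_def)
  also have "\<dots> \<le> (\<Sum>k\<in>K_c La Ra K X. m k)"
  proof (rule sum_mono)
    fix k
    have "l = l'" if "X k \<in> T_eps N l" "X k \<in> T_eps N l'" for l l'
    proof -
      have "lat N (l - 1) < lat N l'" "lat N (l' - 1) < lat N l"
        using that unfolding T_eps_def greaterThanLessThan_iff by linarith+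
      then show ?thesis by simp
    qed
    moreover have "finite {l \<in> cell N. X k \<in> T_eps N l}"
      by (rule finite_subset[of _ "cell N"]) (auto simp: cell_def)
    ultimately have "card {l \<in> cell N. X k \<in> T_eps N l} \<le> 1"
      by (subst One_nat_def, subst card_le_Suc0_iff_eq) auto
    then have "real (card {l \<in> cell N. X k \<in> T_eps N l}) * m k \<le> 1 * m k"
      by (intro mult_right_mono m_nonneg) simp
    then show "(\<Sum>l\<in>{l \<in> cell N. X k \<in> T_eps N l}. m k) \<le> m k" by simp
  qed
  finally show ?thesis by (simp add: m_def)
qed

end

context qc_force
begin

text \<open>Here q stands for either kernel weight. Its bound and the identification of h with g are
  asked for off a sparse set, because lattice points may lie inside an element.\<close>

lemma trapezoid_L1:
  assumes g: "pwc g" "\<And>t. g (t + 1) = g t" and q: "pwc q" "\<And>t. q (t + 1) = q t"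
    and qb: "\<And>k. k \<in> elems_c N La Ra K X \<Longrightarrow>
      \<forall>\<^sub>\<approx>t. t \<in> {X (k - 1)<..<X k} \<longrightarrow> 0 \<le> q t \<and> q t \<le> c k"
    and g0: "\<And>t. t \<notin> Ct \<Longrightarrow> g t = 0"
    and h: "\<And>k. k \<in> elems_c N La Ra K X \<Longrightarrow> \<forall>\<^sub>\<approx>t. t \<in> {X (k - 1)<..<X k} \<longrightarrow> h t = g t"
  shows "integral {-1/2..1/2} (\<lambda>t. \<bar>q t * g t\<bar>) \<le> (\<Sum>k\<in>elems_c N La Ra K X. c k * L1norm (elem X k) h)"
proof -
  have "integral {-1/2..1/2} (\<lambda>t. \<bar>q t * g t\<bar>)
    = (\<Sum>k\<in>{1..int K}. integral {X (k - 1)..X k} (\<lambda>t. \<bar>q t * g t\<bar>))"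
    by (intro integral_mesh_sum pwc_intros g q) (simp add: g q)
  also have "\<dots> = (\<Sum>k\<in>elems_c N La Ra K X. integral {X (k - 1)..X k} (\<lambda>t. \<bar>q t * g t\<bar>))"
  proof (intro sum.mono_neutral_right ballI)
    fix k assume "k \<in> {1..int K} - elems_c N La Ra K X"
    then have "{X (k - 1)<..<X k} \<inter> Ct = {}" by (intro elem_outside_Ct) (auto simp: elems_c_iff)
    then have "integral {X (k - 1)..X k} (\<lambda>t. \<bar>q t * g t\<bar>) = integral {X (k - 1)..X k} (\<lambda>_. 0)"
      by (intro integral_cosparse_cong always_eventually) (auto simp: g0 disjoint_iff)
    then show "integral {X (k - 1)..X k} (\<lambda>t. \<bar>q t * g t\<bar>) = 0" by simp
  qed (auto simp: elems_c_def)
  also have "\<dots> \<le> (\<Sum>k\<in>elems_c N La Ra K X. c k * L1norm (elem X k) h)"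
  proof (rule sum_mono)
    fix k assume k: "k \<in> elems_c N La Ra K X"
    have "integral {X (k - 1)..X k} (\<lambda>t. \<bar>q t * g t\<bar>) \<le> integral {X (k - 1)..X k} (\<lambda>t. c k * \<bar>g t\<bar>)"
      by (intro integral_cosparse_mono pwc_intros g q, rule eventually_mono[OF qb[OF k]])
        (auto simp: abs_mult intro!: mult_right_mono)
    also have "\<dots> = c k * integral {X (k - 1)..X k} (\<lambda>t. \<bar>g t\<bar>)" by simp
    also have "integral {X (k - 1)..X k} (\<lambda>t. \<bar>g t\<bar>) = integral {X (k - 1)..X k} (\<lambda>t. \<bar>h t\<bar>)"
      by (rule integral_cosparse_cong, rule eventually_mono[OF h[OF k]]) auto
    finally show "integral {X (k - 1)..X k} (\<lambda>t. \<bar>q t * g t\<bar>) \<le> c k * L1norm (elem X k) h"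
      by (simp add: L1norm_def elem_def)
  qed
  finally show ?thesis .
qed

text \<open>The lattice pairing sees lattice values only, so u may be replaced there by its lattice
  interpolant v. The error then splits into two quadrature errors and the integral of f (v - u), to
  which only kinks inside cells contribute.\<close>

lemma force_defect_le:
  assumes u: "u \<in> P1 X" "\<And>t. u (t + 1) = u t"
  shows "\<bar>ip_eps N f (nodal N u) - ip_h X f u\<bar>
    \<le> (\<Sum>k\<in>K_c La Ra K X. eps N / 2 * L1norm (omega N (X k)) f * \<bar>jump (deriv u) (X k)\<bar>)
      + (\<Sum>k\<in>elems_c N La Ra K X.
          (eps N)\<^sup>2 / 4 * L1norm (elem X k) (deriv (deriv (\<lambda>t. f t * I_eps N u t)))
          + (hk X k)\<^sup>2 / 4 * L1norm (elem X k) (deriv (deriv (\<lambda>t. f t * u t))))"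
proof -
  define v where "v = I_eps N u"
  have v: "v \<in> P1 (lat N)" unfolding v_def I_eps_def by (rule lattice.pw_interp_P1)
  have node: "v (lat N l) = u (lat N l)" for l
    by (simp add: v_def I_eps_def nodal_def)
  have vper: "v (t + 1) = v t" for t
    using lattice.pw_interp_per[of "nodal N u" 0] lattice.X_per u(2)
    by (simp add: v_def I_eps_def nodal_def)
  have dper: "deriv v (t + 1) = deriv v t" "deriv u (t + 1) = deriv u t" for t
    using vper u by (auto intro: deriv_shift1)
  note pI = pwc_intros pwc_indicator_Ct pwc_F1 pwc_F2 lattice.pwc_bubble mesh.pwc_bubble
    lattice.pwc_P1_deriv[OF v(1)] mesh.pwc_P1_deriv[OF u(1)]
    pwc_continuous[OF f_cont] pwc_continuous[OF lattice.P1_continuous[OF v(1)]]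
    pwc_continuous[OF mesh.P1_continuous[OF u(1)]]
  let ?gv = "\<lambda>t. 2 * F1 t * deriv v t + F2 t * v t"
  let ?gu = "\<lambda>t. 2 * F1 t * deriv u t + F2 t * u t"
  have Fin: "F1 t = deriv f t" "F2 t = deriv (deriv f) t" if "t \<in> Ct" for t
    using that by (simp_all add: F1_def F2_def)
  have Fout: "F1 t = 0" "F2 t = 0" if "t \<notin> Ct" for t
    using that by (simp_all add: F1_def F2_def)
  have qv: "integral {-1/2..1/2} (\<lambda>t. \<bar>lattice.bubble t * ?gv t\<bar>)
    \<le> (\<Sum>k\<in>elems_c N La Ra K X. (eps N)\<^sup>2 / 8 * L1norm (elem X k) (deriv (deriv (\<lambda>t. f t * v t))))"
  proof (rule trapezoid_L1)
    fix k assume k: "k \<in> elems_c N La Ra K X"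
    show "\<forall>\<^sub>\<approx>t. t \<in> {X (k - 1)<..<X k} \<longrightarrow> 0 \<le> lattice.bubble t \<and> lattice.bubble t \<le> (eps N)\<^sup>2 / 8"
      by (rule lattice.cosparse_gridI) (use lattice.bubble_bounds in auto)
    show "\<forall>\<^sub>\<approx>t. t \<in> {X (k - 1)<..<X k} \<longrightarrow> deriv (deriv (\<lambda>t. f t * v t)) t = ?gv t"
    proof (rule lattice.cosparse_gridI, rule impI)
      fix l t assume t: "t \<in> {lat N (l - 1)<..<lat N l}" "t \<in> {X (k - 1)<..<X k}"
      have "t \<in> Ct" using t k by (auto simp: elems_c_iff)
      moreover have "deriv (deriv (\<lambda>t. f t * v t)) t = 2 * deriv f t * deriv v t + deriv (deriv f) t * v t"
        using t k by (intro lattice.deriv2_mult[OF v, of "{lat N (l - 1)<..<lat N l} \<inter> {X (k - 1)<..<X k}"])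
          (auto simp: elems_c_iff intro: elem_C2)
      ultimately show "deriv (deriv (\<lambda>t. f t * v t)) t = ?gv t" by (simp add: Fin)
    qed
  qed (auto intro!: pI simp: lattice.bubble_per F1_per F2_per dper vper Fout)
  have qu: "integral {-1/2..1/2} (\<lambda>t. \<bar>mesh.bubble t * ?gu t\<bar>)
    \<le> (\<Sum>k\<in>elems_c N La Ra K X. (hk X k)\<^sup>2 / 8 * L1norm (elem X k) (deriv (deriv (\<lambda>t. f t * u t))))"
  proof (rule trapezoid_L1)
    fix k assume k: "k \<in> elems_c N La Ra K X"
    show "\<forall>\<^sub>\<approx>t. t \<in> {X (k - 1)<..<X k} \<longrightarrow> 0 \<le> mesh.bubble t \<and> mesh.bubble t \<le> (hk X k)\<^sup>2 / 8"
      by (rule always_eventually) (use mesh.bubble_bounds in auto)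
    have "deriv (deriv (\<lambda>t. f t * u t)) t = ?gu t" if t: "t \<in> {X (k - 1)<..<X k}" for t
    proof -
      have "t \<in> Ct" using t k by (auto simp: elems_c_iff)
      moreover have "deriv (deriv (\<lambda>t. f t * u t)) t = 2 * deriv f t * deriv u t + deriv (deriv f) t * u t"
        using t k by (intro mesh.deriv2_mult[OF u(1), of "{X (k - 1)<..<X k}"])
          (auto simp: elems_c_iff intro: elem_C2)
      ultimately show ?thesis by (simp add: Fin)
    qed
    then show "\<forall>\<^sub>\<approx>t. t \<in> {X (k - 1)<..<X k} \<longrightarrow> deriv (deriv (\<lambda>t. f t * u t)) t = ?gu t"
      by (simp add: always_eventually)
  qed (auto intro!: pI simp: mesh.bubble_per F1_per F2_per dper u Fout)
  have pD: "pwc (\<lambda>t. lattice.bubble t * ?gv t - mesh.bubble t * ?gu t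
      + indicat_real Ct t * (f t * (v t - u t)))"
    by (intro pI)
  have nodal_v: "nodal N v = nodal N u"
    by (auto simp: nodal_def node)
  have eq: "ip_eps N f (nodal N u) - ip_h X f u = integral {-1/2..1/2}
      (\<lambda>t. lattice.bubble t * ?gv t - mesh.bubble t * ?gu t + indicat_real Ct t * (f t * (v t - u t)))"
    by (rule force_error[OF v vper u, unfolded nodal_v]) (metis node rangeE)
  have "\<bar>ip_eps N f (nodal N u) - ip_h X f u\<bar> \<le> integral {-1/2..1/2}
      (\<lambda>t. \<bar>lattice.bubble t * ?gv t - mesh.bubble t * ?gu t + indicat_real Ct t * (f t * (v t - u t))\<bar>)"
    unfolding eq by (rule integral_pwc_abs_le[OF pD])
  also have "\<dots> \<le> integral {-1/2..1/2}
      (\<lambda>t. \<bar>f t\<bar> * \<bar>v t - u t\<bar> + (\<bar>lattice.bubble t * ?gv t\<bar> + \<bar>mesh.bubble t * ?gu t\<bar>))"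
  proof (intro integral_cosparse_mono pI always_eventually allI impI)
    fix t
    have "\<bar>indicat_real Ct t * (f t * (v t - u t))\<bar> \<le> \<bar>f t\<bar> * \<bar>v t - u t\<bar>"
      by (simp add: abs_mult indicator_def)
    then show "\<bar>lattice.bubble t * ?gv t - mesh.bubble t * ?gu t + indicat_real Ct t * (f t * (v t - u t))\<bar>
      \<le> \<bar>f t\<bar> * \<bar>v t - u t\<bar> + (\<bar>lattice.bubble t * ?gv t\<bar> + \<bar>mesh.bubble t * ?gu t\<bar>)"
      by linarith
  qed
  also have "\<dots> = integral {-1/2..1/2} (\<lambda>t. \<bar>f t\<bar> * \<bar>v t - u t\<bar>)
      + (integral {-1/2..1/2} (\<lambda>t. \<bar>lattice.bubble t * ?gv t\<bar>)
        + integral {-1/2..1/2} (\<lambda>t. \<bar>mesh.bubble t * ?gu t\<bar>))"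
    by (subst integral_pwc_add, (intro pI)+)+ (rule refl)
  also have "\<dots> \<le> (\<Sum>k\<in>K_c La Ra K X. eps N / 2 * L1norm (omega N (X k)) f * \<bar>jump (deriv u) (X k)\<bar>)
      + ((\<Sum>k\<in>elems_c N La Ra K X. (eps N)\<^sup>2 / 8 * L1norm (elem X k) (deriv (deriv (\<lambda>t. f t * v t))))
        + (\<Sum>k\<in>elems_c N La Ra K X. (hk X k)\<^sup>2 / 8 * L1norm (elem X k) (deriv (deriv (\<lambda>t. f t * u t)))))"
    by (intro add_mono qv qu) (use kink_integral[OF u(1) f_cont] in \<open>simp add: v_def\<close>)
  \<comment> \<open>The kernels are at most one eighth of the squared mesh size, while the estimator
    allows one quarter.\<close>
  also have "\<dots> \<le> (\<Sum>k\<in>K_c La Ra K X. eps N / 2 * L1norm (omega N (X k)) f * \<bar>jump (deriv u) (X k)\<bar>)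
      + (\<Sum>k\<in>elems_c N La Ra K X.
          (eps N)\<^sup>2 / 4 * L1norm (elem X k) (deriv (deriv (\<lambda>t. f t * v t)))
          + (hk X k)\<^sup>2 / 4 * L1norm (elem X k) (deriv (deriv (\<lambda>t. f t * u t))))"
    unfolding sum.distrib[symmetric]
    by (intro add_left_mono sum_mono add_mono mult_right_mono L1norm_nonneg) auto
  finally show ?thesis by (simp add: v_def)
qed

lemma energy_consistency:
  assumes y: "y \<in> Y_h F X"
  shows "\<bar>E_a N F \<phi> f (nodal N y) - E_qc N F La Ra X \<phi> f y\<bar>
    \<le> mu_est N La Ra K X \<phi> y + mu_f N F La Ra K X f y + mu_q N F La Ra K X f y"
proof -
  define u where "u = (\<lambda>t. y t - F * t)"
  have u: "u \<in> P1 X" "\<And>t. u (t + 1) = u t" using y by (auto simp: Y_h_def U_h_def u_def)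
  have yP: "y \<in> P1 X" using y by (simp add: Y_h_def)
  have yper: "y (t + 1) = y t + F" for t using u(2)[of t] by (simp add: u_def algebra_simps)
  have "(\<lambda>l. nodal N y l - F * lat N l) = nodal N u" by (auto simp: nodal_def u_def)
  then have "E_a N F \<phi> f (nodal N y) - E_qc N F La Ra X \<phi> f y
    = (E_a_int N \<phi> (nodal N y) - E_qc_int N La Ra \<phi> y) - (ip_eps N f (nodal N u) - ip_h X f u)"
    by (simp add: E_a_def E_qc_def u_def)
  moreover have "\<bar>ip_eps N f (nodal N u) - ip_h X f u\<bar> \<le> mu_f N F La Ra K X f y + mu_q N F La Ra K X f y"
    unfolding mu_f_def mu_q_def Let_def u_def[symmetric] by (rule force_defect_le[OF u])
  moreover note energy_defect_le[OF yP yper, of \<phi>]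
  ultimately show ?thesis by linarith
qed

end

section \<open>The residual\<close>

lemma young:
  fixes a b :: real
  assumes "\<alpha> > 0"
  shows "a * b \<le> \<alpha> / 2 * a\<^sup>2 + b\<^sup>2 / (2 * \<alpha>)"
proof -
  have "0 \<le> (\<alpha> * a - b)\<^sup>2 / (2 * \<alpha>)" using assms by simp
  also have "\<dots> = \<alpha> / 2 * a\<^sup>2 + b\<^sup>2 / (2 * \<alpha>) - a * b"
    using assms by (simp add: power2_eq_square field_simps)
  finally show ?thesis by simp
qed

lemma L2norm_sq: "(L2norm S g)\<^sup>2 = integral S (\<lambda>t. (g t)\<^sup>2)"
proof -
  have "integral S (\<lambda>t. (g t)\<^sup>2) \<ge> 0"
    by (cases "(\<lambda>t. (g t)\<^sup>2) integrable_on S")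
      (auto simp: not_integrable_integral intro!: integral_nonneg)
  then show ?thesis by (simp add: L2norm_def)
qed

lemma periodic_bounded:
  fixes w :: "real \<Rightarrow> real"
  assumes "continuous_on UNIV w" and per: "\<And>t. w (t + 1) = w t"
  obtains W where "\<And>t. \<bar>w t\<bar> \<le> W"
proof -
  obtain W where W: "\<And>t. t \<in> {0..1} \<Longrightarrow> \<bar>w t\<bar> \<le> W"
    using pwc_bounded[OF pwc_continuous[OF assms(1)], of 0 1] unfolding bounded_iff by force
  have shift: "w (t + of_int m) = w t" for t and m :: int
  proof (induction m rule: int_induct[of _ 0])
    case (step1 m)
    then show ?case using per[of "t + of_int m"] by (simp add: algebra_simps)
  next
    case (step2 m)
    then show ?case using per[of "t + of_int (m - 1)"] by (simp add: algebra_simps)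
  qed simp
  have "\<bar>w t\<bar> \<le> W" for t
    using W[of "frac t"] shift[of "frac t" "\<lfloor>t\<rfloor>"] frac_lt_1[of t] frac_ge_0[of t]
    by (simp add: frac_def)
  then show ?thesis by (rule that)
qed

lemma pw_interp_add_cmult:
  "pw_interp X (\<lambda>k. a k + s * b k) t = pw_interp X a t + s * pw_interp X b t"
  by (simp add: pw_interp_def Let_def algebra_simps diff_divide_distrib add_divide_distrib)

text \<open>A zero at 0 and, by periodicity, at 1 allows \<open>poincare_zero\<close> on [0, 1]. Its
  bound does not depend on t, so integrating over a unit interval preserves it.\<close>

lemma periodic_poincare:
  fixes w :: "real \<Rightarrow> real"
  assumes w: "continuous_on UNIV w" "\<forall>\<^sub>\<approx>t. (w has_real_derivative deriv w t) (at t)" "pwc (deriv w)"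
    and per: "\<And>t. w (t + 1) = w t" and zero: "w 0 = 0"
  shows "integral {-1/2..1/2} (\<lambda>t. (w t)\<^sup>2) \<le> integral {-1/2..1/2} (\<lambda>t. (deriv w t)\<^sup>2) / 4"
proof -
  have dper: "deriv w (t + 1) = deriv w t" for t using per by (rule deriv_shift1)
  have shift: "integral {-1/2..1/2} g = integral {0..1} g" if "pwc g" "\<And>t. g (t + 1) = g t" for g
    using integral_period_shift[of g "-1/2" 0] that by simp
  have "w 1 = 0" using per[of 0] zero by simp
  then have bd: "(w t)\<^sup>2 \<le> integral {0..1} (\<lambda>t. (deriv w t)\<^sup>2) / 4" if "t \<in> {0..1}" for t
    using poincare_zero[OF that w] zero by simp
  have "integral {0..1} (\<lambda>t. (w t)\<^sup>2) \<le> integral {0..1} (\<lambda>_::real. integral {0..1} (\<lambda>t. (deriv w t)\<^sup>2) / 4)"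
    using bd by (intro integral_cosparse_mono pwc_intros pwc_continuous w always_eventually) auto
  then show ?thesis
    using shift[of "\<lambda>t. (w t)\<^sup>2"] shift[of "\<lambda>t. (deriv w t)\<^sup>2"]
    by (simp add: per dper pwc_intros pwc_continuous w)
qed

context qc_setting
begin

text \<open>The reciprocal of the range cancels the multiplicity with which bonds of that range
  cover a point, so a continuum element contributes one plain integral per range.\<close>

lemma sum_bonds_cont:
  assumes "\<And>j. pwc (h j)" "\<And>j t. h j (t + 1) = h j t"
  shows "(\<Sum>b\<in>bonds N. 1 / rb b * integral {bl b..br b} (\<lambda>t. if t \<in> A then 0 else h (rb b) t))
    = (\<Sum>k\<in>{1..int K}. of_bool ({X (k - 1)..X k} \<inter> A = {}) *
        (integral {X (k - 1)..X k} (h 1) + integral {X (k - 1)..X k} (h 2)))"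
proof -
  define g where "g j t = (if t \<in> A then 0 else h j t)" for j t
  have g: "pwc (g j)" "g j (t + 1) = g j t" for j t
    by (auto simp: g_def[abs_def] assms(2) intro!: pwc_if_A assms(1))
  have el: "integral {X (k - 1)..X k} (g j)
      = of_bool ({X (k - 1)..X k} \<inter> A = {}) * integral {X (k - 1)..X k} (h j)" for j k
  proof (cases "{X (k - 1)..X k} \<inter> A = {}")
    case True
    then have "integral {X (k - 1)..X k} (g j) = integral {X (k - 1)..X k} (h j)"
      by (intro integral_cong) (auto simp: g_def disjoint_iff)
    with True show ?thesis by simp
  next
    case False
    then have "{X (k - 1)<..<X k} \<subseteq> A" using elem_A_or_C by blast
    then have "integral {X (k - 1)..X k} (g j) = integral {X (k - 1)..X k} (\<lambda>_. 0)"
      by (intro integral_cosparse_cong always_eventually) (auto simp: g_def)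
    with False show ?thesis by simp
  qed
  have "(\<Sum>b\<in>bonds N. 1 / rb b * integral {bl b..br b} (g (rb b)))
    = (\<Sum>l\<in>cell N. integral {bl (l, 1)..br (l, 1)} (g 1))
      + (\<Sum>l\<in>cell N. integral {bl (l, 2)..br (l, 2)} (g 2)) / 2"
    unfolding sum_bonds rb_def by (simp add: sum.distrib sum_divide_distrib)
  also have "\<dots> = integral {-1/2..1/2} (g 1) + integral {-1/2..1/2} (g 2)"
    using sum_bond_integral[of "g 1" 1] sum_bond_integral[of "g 2" 2] g by simp
  also have "\<dots> = (\<Sum>k\<in>{1..int K}. integral {X (k - 1)..X k} (g 1) + integral {X (k - 1)..X k} (g 2))"
    using integral_mesh_sum[of "g 1"] integral_mesh_sum[of "g 2"] g by (simp add: sum.distrib)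
  finally show ?thesis unfolding el by (simp only: g_def[abs_def] distrib_left)
qed

text \<open>A weight in place of a restricted index set, so that all sums run over one full period
  of elements.\<close>

definition cont_elem :: "int \<Rightarrow> real" where
  "cont_elem k = of_bool ({X (k - 1)..X k} \<inter> A = {}) * hk X k"

lemma bond_if_integral:
  assumes "b \<in> bonds N" "pwc h"
  shows "integral {bl b..br b} (\<lambda>t. if t \<in> A then a else h t)
    = measure lborel (bond_a N La Ra b) * a + integral {bl b..br b} (\<lambda>t. if t \<in> A then 0 else h t)"
  using bond_split[of "\<lambda>_. a" h b] bond_split[of "\<lambda>_. 0" h b] measure_bond_a[OF assms(1), of a] assms(2)
  by simp

lemma integral_elem_slope:
  assumes "y \<in> P1 X"
  shows "integral {X (k - 1)..X k} (\<lambda>t. H (deriv y t)) = hk X k * H (mesh.slope y k)"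
  by (rule mesh.integral_elem_const) (simp add: mesh.P1_deriv[OF assms])

text \<open>In this form the energy along \<open>y + s * w\<close> is a finite sum of values of
  \<phi>, and can be differentiated in s without touching an integral.\<close>

lemma E_qc_int_sum:
  assumes y: "y \<in> P1 X" "\<And>t. y (t + 1) = y t + c"
  shows "E_qc_int N La Ra \<phi> y
    = (\<Sum>b\<in>bonds N. measure lborel (bond_a N La Ra b) / rb b * \<phi> (rb b * diffq (bond_a N La Ra b) y))
      + (\<Sum>k\<in>{1..int K}. cont_elem k * (\<phi> (mesh.slope y k) + \<phi> (2 * mesh.slope y k)))"
proof -
  let ?h = "\<lambda>j t. \<phi> (j * deriv y t)"
  have pwc: "pwc (?h j)" for j
    by (rule mesh.pwc_P1_comp_deriv[OF y(1), of "\<lambda>s. \<phi> (j * s)"])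
  have per: "?h j (t + 1) = ?h j t" for j t
    using deriv_shift_affine[of y c t, OF y(2)] by simp
  have split: "1 / r * x = m / r * a + 1 / r * z" if "x = m * a + z" for r x m a z :: real
    using that by (simp add: distrib_left)
  have el: "integral {X (k - 1)..X k} (?h j) = hk X k * \<phi> (j * mesh.slope y k)" for j k
    by (rule integral_elem_slope[OF y(1)])
  have "E_qc_int N La Ra \<phi> y
    = (\<Sum>b\<in>bonds N. measure lborel (bond_a N La Ra b) / rb b * \<phi> (rb b * diffq (bond_a N La Ra b) y)
      + 1 / rb b * integral {bl b..br b} (\<lambda>t. if t \<in> A then 0 else ?h (rb b) t))"
    unfolding E_qc_int_bonds[OF y(1)]
  proof (rule sum.cong[OF refl])
    fix b assume "b \<in> bonds N"
    from bond_if_integral[OF this pwc[of "rb b"]]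
    show "1 / rb b * integral {bl b..br b}
        (\<lambda>t. if t \<in> A then \<phi> (rb b * diffq (bond_a N La Ra b) y) else ?h (rb b) t)
      = measure lborel (bond_a N La Ra b) / rb b * \<phi> (rb b * diffq (bond_a N La Ra b) y)
      + 1 / rb b * integral {bl b..br b} (\<lambda>t. if t \<in> A then 0 else ?h (rb b) t)"
      by (rule split)
  qed
  moreover have "of_bool ({X (k - 1)..X k} \<inter> A = {}) *
      (integral {X (k - 1)..X k} (?h 1) + integral {X (k - 1)..X k} (?h 2))
    = cont_elem k * (\<phi> (mesh.slope y k) + \<phi> (2 * mesh.slope y k))" for k
    unfolding el cont_elem_def by (simp only: mult_1 distrib_left mult.assoc)
  ultimately show ?thesis
    by (simp only: sum.distrib sum_bonds_cont[of ?h, OF pwc per])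
qed

lemma slope_pos:
  assumes "y \<in> Y_h_pos F X"
  shows "mesh.slope y k > 0"
proof -
  have "(X (k - 1) + X k) / 2 \<in> {X (k - 1)<..<X k}" using mesh.X_step[of k] by auto
  then show ?thesis
    using assms mesh.P1_deriv[of y "(X (k - 1) + X k) / 2" k]
    unfolding Y_h_pos_def Y_h_def by fastforce
qed

lemma nodes_mono:
  assumes "\<And>k. mesh.slope y k > 0" "i < j"
  shows "y (X i) < y (X j)"
  using assms(2)
proof (induction j rule: int_gr_induct)
  case base
  then show ?case using mesh.slope_hk[of "i + 1" y] assms(1)[of "i + 1"] mesh.hk_pos[of "i + 1"]
    by (smt (verit) add_diff_cancel_right' mult_pos_pos)
next
  case (step j)
  then show ?case using mesh.slope_hk[of "j + 1" y] assms(1)[of "j + 1"] mesh.hk_pos[of "j + 1"]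
    by (smt (verit) add_diff_cancel_right' mult_pos_pos)
qed

lemma bond_a_diffq_pos:
  assumes "\<And>k. mesh.slope y k > 0" "b \<in> bonds N" "measure lborel (bond_a N La Ra b) \<noteq> 0"
  shows "diffq (bond_a N La Ra b) y > 0"
proof (cases rule: bond_a_cases[OF assms(2)])
  case interval: (2 p q)
  then obtain i j where ij: "p = X i" "q = X j" by blast
  then have "y p < y q" using nodes_mono[OF assms(1), of i j] interval by simp
  then show ?thesis using interval by (simp add: diffq_open)
qed (use assms in simp)

lemma ip_h_add_cmult:
  assumes "continuous_on UNIV f" "continuous_on UNIV u" "continuous_on UNIV w"
  shows "ip_h X f (\<lambda>t. u t + s * w t) = ip_h X f u + s * ip_h X f w"
proof -
  have pwc: "pwc (pw_interp X v)" for v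
    using mesh.continuous_pw_interp by (auto intro!: pwc_continuous continuous_at_imp_continuous_on)
  have "pw_interp X (\<lambda>k. f (X k) * (u (X k) + s * w (X k)))
    = (\<lambda>t. pw_interp X (\<lambda>k. f (X k) * u (X k)) t + s * pw_interp X (\<lambda>k. f (X k) * w (X k)) t)"
    unfolding pw_interp_add_cmult[symmetric] by (simp add: algebra_simps)
  then show ?thesis
    by (simp add: ip_h_def I_h_def Om_def integral_pwc_add pwc pwc_intros)
qed

lemma slope_per:
  assumes "\<And>t. y (t + 1) = y t + c"
  shows "mesh.slope y (k + int K) = mesh.slope y k"
  using mesh.X_per[of k] mesh.X_per[of "k - 1"] mesh.hk_per[of k] assms[of "X k"] assms[of "X (k - 1)"]
  by (simp add: mesh.slope_def algebra_simps)

lemma ex_unit_index: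
  obtains k' m where "k = k' + int K * m" "k' \<in> {1..int K}"
proof -
  define m where "m = (k - 1) div int K"
  have "k = (k - 1) mod int K + 1 + int K * m"
    unfolding m_def using mult_div_mod_eq[of "int K" "k - 1"] by linarith
  moreover have "0 \<le> (k - 1) mod int K" "(k - 1) mod int K < int K"
    using mesh.K_pos by (auto intro: pos_mod_bound)
  ultimately show ?thesis by (intro that[of "(k - 1) mod int K + 1" m]) auto
qed

lemma Y_h_per: "y \<in> Y_h F X \<Longrightarrow> y (t + 1) = y t + F"
  unfolding Y_h_def U_h_def by (auto simp: algebra_simps dest: spec[of _ t])

text \<open>Slopes are periodic in the index, so positivity is an open condition on finitely many of
  them.\<close>

lemma Y_h_pos_perturb:
  assumes y: "y \<in> Y_h_pos F X" and w: "w \<in> U_h X"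
  shows "\<forall>\<^sub>F s in nhds 0. (\<lambda>t. y t + s * w t) \<in> Y_h_pos F X"
proof -
  have yY: "y \<in> Y_h F X" and yP: "y \<in> P1 X" and wP: "w \<in> P1 X"
    using y w by (auto simp: Y_h_pos_def Y_h_def U_h_def)
  have per: "mesh.slope y (k + int K) = mesh.slope y k" "mesh.slope w (k + int K) = mesh.slope w k" for k
    using slope_per[of y F k] Y_h_per[OF yY] slope_per[of w 0 k] w by (auto simp: U_h_def)
  have "\<forall>\<^sub>F s in nhds 0. \<forall>k\<in>{1..int K}. mesh.slope y k + s * mesh.slope w k > 0"
  proof (rule eventually_ball_finite)
    show "\<forall>k\<in>{1..int K}. \<forall>\<^sub>F s in nhds 0. mesh.slope y k + s * mesh.slope w k > 0"
    proof
      fix k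
      have "((\<lambda>s. mesh.slope y k + s * mesh.slope w k) \<longlongrightarrow> mesh.slope y k + 0 * mesh.slope w k) (nhds 0)"
        by (intro tendsto_intros filterlim_ident)
      then show "\<forall>\<^sub>F s in nhds 0. mesh.slope y k + s * mesh.slope w k > 0"
        using slope_pos[OF y, of k] by (intro order_tendstoD(1)) auto
    qed
  qed simp
  then show ?thesis
  proof eventually_elim
    case (elim s)
    have P1: "(\<lambda>t. y t + s * w t) \<in> P1 X" by (rule mesh.P1_add_cmult[OF yP wP])
    have "mesh.slope (\<lambda>t. y t + s * w t) k > 0" for k
    proof -
      obtain k' m where k: "k = k' + int K * m" "k' \<in> {1..int K}" by (rule ex_unit_index)
      then show ?thesis
        using elim mesh.per_mult[of "mesh.slope y" k' m, OF per(1)]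
          mesh.per_mult[of "mesh.slope w" k' m, OF per(2)]
        by (simp add: mesh.slope_add_cmult)
    qed
    then have "\<forall>k. \<forall>t\<in>{X (k - 1)<..<X k}. deriv (\<lambda>t. y t + s * w t) t > 0"
      by (simp add: mesh.P1_deriv[OF P1])
    moreover have "(\<lambda>t. (y t - F * t) + s * w t) \<in> P1 X"
      using yY wP by (intro mesh.P1_add_cmult) (auto simp: Y_h_def U_h_def)
    then have "(\<lambda>t. y t + s * w t - F * t) \<in> U_h X"
      using yY w by (auto simp: Y_h_def U_h_def algebra_simps)
    ultimately show ?case using P1 by (simp add: Y_h_pos_def Y_h_def)
  qed
qed

lemma qc_critical:
  assumes f: "continuous_on UNIV f"
    and min: "local_minimizer (E_qc N F La Ra X \<phi> f) (Y_h_pos F X) y" and w: "w \<in> U_h X"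
    and \<phi>: "\<And>s. s > 0 \<Longrightarrow> (\<phi> has_real_derivative \<phi>' s) (at s)"
  shows "(\<Sum>b\<in>bonds N. measure lborel (bond_a N La Ra b)
        * (\<phi>' (rb b * diffq (bond_a N La Ra b) y) * diffq (bond_a N La Ra b) w))
      + (\<Sum>k\<in>{1..int K}. cont_elem k
        * ((\<phi>' (mesh.slope y k) + 2 * \<phi>' (2 * mesh.slope y k)) * mesh.slope w k))
    = ip_h X f w" (is "?D1 + ?D2 = _")
proof -
  have y: "y \<in> Y_h_pos F X" using min by (simp add: local_minimizer_def)
  have yY: "y \<in> Y_h F X" and yP: "y \<in> P1 X" and wP: "w \<in> P1 X" and uP: "(\<lambda>t. y t - F * t) \<in> P1 X"
    using y w by (auto simp: Y_h_pos_def Y_h_def U_h_def)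
  have wper: "w (t + 1) = w t" for t using w by (simp add: U_h_def)
  let ?z = "\<lambda>s t. y t + s * w t"
  let ?I = "\<lambda>s. (\<Sum>b\<in>bonds N. measure lborel (bond_a N La Ra b) / rb b
        * \<phi> (rb b * (diffq (bond_a N La Ra b) y + s * diffq (bond_a N La Ra b) w)))
      + (\<Sum>k\<in>{1..int K}. cont_elem k * (\<phi> (mesh.slope y k + s * mesh.slope w k)
        + \<phi> (2 * (mesh.slope y k + s * mesh.slope w k))))"
  have diffq_z: "diffq \<omega> (?z s) = diffq \<omega> y + s * diffq \<omega> w" for \<omega> s
    by (simp add: diffq_def add_divide_distrib diff_divide_distrib algebra_simps)
  have E: "E_qc N F La Ra X \<phi> f (?z s) = ?I s - (ip_h X f (\<lambda>t. y t - F * t) + s * ip_h X f w)" for s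
  proof -
    have "E_qc_int N La Ra \<phi> (?z s) = ?I s"
      using E_qc_int_sum[of "?z s" F \<phi>] mesh.P1_add_cmult[OF yP wP, of s] Y_h_per[OF yY]
      by (simp add: diffq_z mesh.slope_add_cmult wper)
    moreover have "(\<lambda>t. ?z s t - F * t) = (\<lambda>t. (y t - F * t) + s * w t)" by auto
    ultimately show ?thesis
      unfolding E_qc_def using ip_h_add_cmult[OF f mesh.P1_continuous[OF uP] mesh.P1_continuous[OF wP]]
      by simp
  qed
  have "((\<lambda>s. measure lborel (bond_a N La Ra b) / rb b
        * \<phi> (rb b * (diffq (bond_a N La Ra b) y + s * diffq (bond_a N La Ra b) w)))
      has_real_derivative measure lborel (bond_a N La Ra b)
        * (\<phi>' (rb b * diffq (bond_a N La Ra b) y) * diffq (bond_a N La Ra b) w)) (at 0)"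
    if b: "b \<in> bonds N" for b
  \<comment> \<open>Positivity of the strain, needed to differentiate \<phi>, is known for nonempty
    intersections; otherwise both sides carry the factor 0.\<close>
  proof (cases "measure lborel (bond_a N La Ra b) = 0")
    case False
    then have "rb b * diffq (bond_a N La Ra b) y > 0"
      using bond_a_diffq_pos[OF slope_pos[OF y] b] rb_pos[OF b] by simp
    then have "(\<phi> has_real_derivative \<phi>' (rb b * diffq (bond_a N La Ra b) y))
        (at (rb b * (diffq (bond_a N La Ra b) y + 0 * diffq (bond_a N La Ra b) w)))"
      using \<phi> by simp
    then show ?thesis
      using rb_pos[OF b] by (auto intro!: derivative_eq_intros DERIV_chain2[of \<phi>])
  qed simp
  moreover have "((\<lambda>s. cont_elem k * (\<phi> (mesh.slope y k + s * mesh.slope w k)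
        + \<phi> (2 * (mesh.slope y k + s * mesh.slope w k))))
      has_real_derivative cont_elem k
        * ((\<phi>' (mesh.slope y k) + 2 * \<phi>' (2 * mesh.slope y k)) * mesh.slope w k)) (at 0)" for k
  proof -
    have "(\<phi> has_real_derivative \<phi>' (mesh.slope y k)) (at (mesh.slope y k + 0 * mesh.slope w k))"
      "(\<phi> has_real_derivative \<phi>' (2 * mesh.slope y k)) (at (2 * (mesh.slope y k + 0 * mesh.slope w k)))"
      using \<phi> slope_pos[OF y, of k] by simp_all
    then show ?thesis
      by (auto intro!: derivative_eq_intros DERIV_chain2[of \<phi>] simp: algebra_simps)
  qed
  ultimately have "(?I has_real_derivative ?D1 + ?D2) (at 0)"
    by (intro DERIV_add DERIV_sum) auto
  moreover have "((\<lambda>s. ip_h X f (\<lambda>t. y t - F * t) + s * ip_h X f w)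
      has_real_derivative ip_h X f w) (at 0)"
    by (auto intro!: derivative_eq_intros)
  ultimately have "((\<lambda>s. ?I s - (ip_h X f (\<lambda>t. y t - F * t) + s * ip_h X f w))
      has_real_derivative ?D1 + ?D2 - ip_h X f w) (at 0)"
    by (rule DERIV_diff)
  then have der: "((\<lambda>s. E_qc N F La Ra X \<phi> f (?z s)) has_real_derivative ?D1 + ?D2 - ip_h X f w) (at 0)"
    unfolding E .
  obtain \<delta> where \<delta>: "\<delta> > 0" "\<And>z. z \<in> Y_h_pos F X \<Longrightarrow> \<forall>t. \<bar>z t - y t\<bar> < \<delta> \<Longrightarrow>
      E_qc N F La Ra X \<phi> f y \<le> E_qc N F La Ra X \<phi> f z"
    using min by (auto simp: local_minimizer_def)
  \<comment> \<open>A continuous periodic direction is bounded, so small s stay within the sup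
    distance of the local minimality.\<close>
  obtain W where W: "\<And>t. \<bar>w t\<bar> \<le> W"
    using periodic_bounded[OF mesh.P1_continuous[OF wP] wper] by blast
  have "((\<lambda>s. \<bar>s\<bar> * W) \<longlongrightarrow> \<bar>0\<bar> * W) (nhds 0)"
    by (intro tendsto_intros filterlim_ident)
  then have "\<forall>\<^sub>F s in nhds 0. \<bar>s\<bar> * W < \<delta>" using \<delta>(1) by (intro order_tendstoD(2)) auto
  then have "\<forall>\<^sub>F s in nhds 0. E_qc N F La Ra X \<phi> f (?z 0) \<le> E_qc N F La Ra X \<phi> f (?z s)"
    using Y_h_pos_perturb[OF y w]
  proof eventually_elim
    case (elim s)
    have "\<bar>?z s t - y t\<bar> < \<delta>" for t
      using elim(1) mult_left_mono[OF W[of t], of "\<bar>s\<bar>"] by (simp add: abs_mult)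
    then show ?case using \<delta>(2)[OF elim(2)] by simp
  qed
  then obtain d where "d > 0" "\<And>s. dist s 0 < d \<Longrightarrow> E_qc N F La Ra X \<phi> f (?z 0) \<le> E_qc N F La Ra X \<phi> f (?z s)"
    unfolding eventually_nhds_metric by blast
  then have "?D1 + ?D2 - ip_h X f w = 0"
    by (intro DERIV_local_min[OF der, of d]) (auto simp: dist_real_def)
  then show ?thesis by simp
qed

text \<open>The quasicontinuum stress is constant on the atomistic part of a bond and on each
  continuum element, so a test function enters through its increment between mesh nodes only. There
  v and w agree; hence w may be exchanged for v, and all terms combine into the defect times the
  gradient of v.\<close>

lemma internal_residual:
  assumes y: "y \<in> P1 X" "\<And>t. y (t + 1) = y t + c"
    and v: "v \<in> P1 (lat N)" "\<And>t. v (t + 1) = v t"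
    and agree: "\<And>t. t \<in> range X \<Longrightarrow> v t = w t"
  shows "eps N * (\<Sum>l\<in>cell N. \<psi> (ldiff N (nodal N y) l) * ldiff N (nodal N v) l
      + \<psi> (ldiff N (nodal N y) (l - 1) + ldiff N (nodal N y) l)
        * (ldiff N (nodal N v) (l - 1) + ldiff N (nodal N v) l))
    - ((\<Sum>b\<in>bonds N. measure lborel (bond_a N La Ra b)
          * (\<psi> (rb b * diffq (bond_a N La Ra b) y) * diffq (bond_a N La Ra b) w))
      + (\<Sum>k\<in>{1..int K}. cont_elem k
          * ((\<psi> (mesh.slope y k) + 2 * \<psi> (2 * mesh.slope y k)) * mesh.slope w k)))
    = (\<Sum>b\<in>bonds N. integral {bl b..br b} (\<lambda>t. bond_defect \<psi> y b t * deriv v t))"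
proof -
  let ?h = "\<lambda>j t. j * \<psi> (j * deriv y t) * deriv v t"
  have pv: "pwc (deriv v)" by (rule lattice.pwc_P1_deriv[OF v(1)])
  have py: "pwc (\<lambda>t. \<psi> (j * deriv y t))" for j
    by (rule mesh.pwc_P1_comp_deriv[OF y(1), of "\<lambda>s. \<psi> (j * s)"])
  have ph: "pwc (?h j)" for j by (intro pwc_intros pv py)
  have perh: "?h j (t + 1) = ?h j t" for j t
    using deriv_shift_affine[of y c t, OF y(2)] deriv_shift1[of v t, OF v(2)] by simp
  have elem: "integral {X (k - 1)..X k} (?h j) = j * \<psi> (j * mesh.slope y k) * (hk X k * mesh.slope w k)" for j k
  proof -
    have "integral {X (k - 1)..X k} (?h j)
        = integral {X (k - 1)..X k} (\<lambda>t. (j * \<psi> (j * mesh.slope y k)) * deriv v t)"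
      by (intro integral_cosparse_cong always_eventually) (simp add: mesh.P1_deriv[OF y(1)])
    also have "\<dots> = j * \<psi> (j * mesh.slope y k) * integral {X (k - 1)..X k} (deriv v)"
      by (rule integral_mult_right)
    also have "integral {X (k - 1)..X k} (deriv v) = v (X k) - v (X (k - 1))"
      by (rule lattice.P1_ftc[OF v(1)]) simp
    also have "\<dots> = hk X k * mesh.slope w k"
      unfolding mesh.slope_hk by (simp add: agree)
    finally show ?thesis .
  qed
  have contsum: "(\<Sum>k\<in>{1..int K}. cont_elem k
        * ((\<psi> (mesh.slope y k) + 2 * \<psi> (2 * mesh.slope y k)) * mesh.slope w k))
      = (\<Sum>b\<in>bonds N. 1 / rb b * integral {bl b..br b} (\<lambda>t. if t \<in> A then 0 else ?h (rb b) t))"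
    unfolding sum_bonds_cont[of ?h, OF ph perh] elem cont_elem_def
    by (rule sum.cong[OF refl]) (simp only: mult_1 distrib_left distrib_right mult.assoc mult.left_commute)
  have atomsum: "eps N * (\<Sum>l\<in>cell N. \<psi> (ldiff N (nodal N y) l) * ldiff N (nodal N v) l
      + \<psi> (ldiff N (nodal N y) (l - 1) + ldiff N (nodal N y) l)
        * (ldiff N (nodal N v) (l - 1) + ldiff N (nodal N v) l))
    = (\<Sum>b\<in>bonds N. eps N * (\<psi> (rb b * diffq (bond N b) y) * (rb b * diffq (bond N b) v)))"
  proof -
    have "v (t + 1) = v t + 0" for t by (simp add: v)
    from sum_bonds_ldiff[of y c v 0 "\<lambda>r s. \<psi> r * s", OF y(2) this]
    show ?thesis unfolding sum_distrib_left[symmetric] by (rule arg_cong[OF sym])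
  qed
  have bond: "eps N * (\<psi> (rb b * diffq (bond N b) y) * (rb b * diffq (bond N b) v))
      - (measure lborel (bond_a N La Ra b)
          * (\<psi> (rb b * diffq (bond_a N La Ra b) y) * diffq (bond_a N La Ra b) w)
        + 1 / rb b * integral {bl b..br b} (\<lambda>t. if t \<in> A then 0 else ?h (rb b) t))
      = integral {bl b..br b} (\<lambda>t. bond_defect \<psi> y b t * deriv v t)" if b: "b \<in> bonds N" for b
  proof -
    let ?p = "\<psi> (rb b * diffq (bond N b) y)" and ?q = "\<psi> (rb b * diffq (bond_a N La Ra b) y)"
    let ?A = "\<lambda>t. if t \<in> A then deriv v t else 0"
    let ?C = "\<lambda>t. if t \<in> A then 0 else \<psi> (rb b * deriv y t) * deriv v t"
    have "eps N * (rb b * diffq (bond N b) v) = v (br b) - v (bl b)"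
      using rb_pos[OF b] eps_pos by (simp add: diffq_bond[OF b])
    moreover have "integral {bl b..br b} (deriv v) = v (br b) - v (bl b)"
      using bl_less_br[OF b] by (intro lattice.P1_ftc[OF v(1)]) simp
    ultimately have 1: "eps N * (?p * (rb b * diffq (bond N b) v)) = ?p * integral {bl b..br b} (deriv v)"
      by (simp only: mult.left_commute[of "eps N" ?p])
    have "measure lborel (bond_a N La Ra b) * diffq (bond_a N La Ra b) w
        = measure lborel (bond_a N La Ra b) * diffq (bond_a N La Ra b) v"
      by (rule bond_a_diffq_agree[OF b, symmetric]) (rule agree)
    also have "\<dots> = integral {bl b..br b} ?A"
      by (rule bond_a_integral[OF b, symmetric])
        (rule lattice.P1_continuous[OF v(1)], rule lattice.P1_cosparse_deriv[OF v(1)])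
    finally have 2: "measure lborel (bond_a N La Ra b) * (?q * diffq (bond_a N La Ra b) w)
        = ?q * integral {bl b..br b} ?A"
      by (simp only: mult.left_commute[of "measure lborel (bond_a N La Ra b)" ?q])
    have "(\<lambda>t. if t \<in> A then 0 else ?h (rb b) t) = (\<lambda>t. rb b * ?C t)" by auto
    then have 3: "1 / rb b * integral {bl b..br b} (\<lambda>t. if t \<in> A then 0 else ?h (rb b) t)
        = integral {bl b..br b} ?C"
      using rb_pos[OF b] by (simp only: integral_mult_right) simp
    have pA: "pwc ?A" and pC: "pwc ?C" by (intro pwc_if_A pwc_intros pv py)+
    have "(\<lambda>t. bond_defect \<psi> y b t * deriv v t) = (\<lambda>t. ?p * deriv v t - (?q * ?A t + ?C t))"
      by (auto simp: bond_defect_def algebra_simps)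
    then have "integral {bl b..br b} (\<lambda>t. bond_defect \<psi> y b t * deriv v t)
      = integral {bl b..br b} (\<lambda>t. ?p * deriv v t) - integral {bl b..br b} (\<lambda>t. ?q * ?A t + ?C t)"
      using integral_pwc_diff[of "\<lambda>t. ?p * deriv v t" "\<lambda>t. ?q * ?A t + ?C t"] pA pC pv
      by (simp only: pwc_intros)
    also have "integral {bl b..br b} (\<lambda>t. ?q * ?A t + ?C t)
      = integral {bl b..br b} (\<lambda>t. ?q * ?A t) + integral {bl b..br b} ?C"
      by (intro integral_pwc_add pwc_intros pA pC)
    finally show ?thesis unfolding 1 2 3 by (simp only: integral_mult_right)
  qed
  show ?thesis
    unfolding contsum atomsum sum.distrib[symmetric] sum_subtractf[symmetric]
    by (rule sum.cong[OF refl bond])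
qed

text \<open>Bonds without a continuum node contribute nothing by \<open>bond_defect_zero\<close>, so
  the nodal sum in the estimator is a sum over all bonds.\<close>

lemma eta_sq_sum:
  assumes y: "y \<in> P1 X"
  shows "(eta N La Ra K X \<psi> y)\<^sup>2
    = 3 * (\<Sum>b\<in>bonds N. integral {bl b..br b} (\<lambda>t. (bond_defect (deriv \<psi>) y b t)\<^sup>2))"
proof -
  let ?G = "\<lambda>b. integral {bl b..br b} (\<lambda>t. (bond_defect (deriv \<psi>) y b t)\<^sup>2)"
  have py: "pwc (\<lambda>t. deriv \<psi> (j * deriv y t))" for j
    by (rule mesh.pwc_P1_comp_deriv[OF y, of "\<lambda>s. deriv \<psi> (j * s)"])
  have eq: "eta_sq N La Ra X \<psi> y k = (\<Sum>b\<in>bonds_at N (X k). ?G b)" for k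
    unfolding eta_sq_def L2norm_sq
  proof (rule sum.cong[OF refl])
    fix b assume "b \<in> bonds_at N (X k)"
    let ?a = "\<lambda>t. (deriv \<psi> (rb b * diffq (bond N b) y) - deriv \<psi> (rb b * diffq (bond_a N La Ra b) y))\<^sup>2"
    let ?c = "\<lambda>t. (deriv \<psi> (rb b * diffq (bond N b) y) - deriv \<psi> (rb b * deriv y t))\<^sup>2"
    have "integral (bond_a N La Ra b) ?a + integral (bond_c N La Ra b) ?c
      = integral {bl b..br b} (\<lambda>t. if t \<in> A then ?a t else ?c t)"
      by (rule bond_split) (intro pwc_intros py)+
    also have "(\<lambda>t. if t \<in> A then ?a t else ?c t) = (\<lambda>t. (bond_defect (deriv \<psi>) y b t)\<^sup>2)"
      by (auto simp: bond_defect_def)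
    finally show "integral (bond_a N La Ra b) ?a + integral (bond_c N La Ra b) ?c = ?G b" .
  qed
  have zero: "?G b = 0" if "b \<in> bonds N" "\<forall>k\<in>K_c La Ra K X. b \<notin> bonds_at N (X k)" for b
  proof -
    have "?G b = integral {bl b..br b} (\<lambda>_. 0)"
      by (rule integral_cosparse_cong, rule eventually_mono[OF bond_defect_zero[OF that y]]) auto
    then show ?thesis by simp
  qed
  have nonneg: "(\<Sum>b\<in>bonds N. ?G b) \<ge> 0"
    by (intro sum_nonneg integral_nonneg pwc_integrable pwc_intros pwc_bond_defect y) auto
  have "(\<Sum>k\<in>K_c La Ra K X. eta_sq N La Ra X \<psi> y k) = (\<Sum>b\<in>bonds N. ?G b)"
    unfolding eq by (rule sum_bonds_at[symmetric]) (rule zero)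
  then show ?thesis
    unfolding eta_def using nonneg by simp
qed

text \<open>Young's inequality with weight 3\<alpha> on every bond: the bonds cover a point 1 + 2 =
  3 times, which cancels the 3 in the gradient term, and in the defect term the 3 is the one built
  into \<open>eta\<close>.\<close>

lemma internal_residual_le:
  assumes y: "y \<in> P1 X" and v: "v \<in> P1 (lat N)" "\<And>t. v (t + 1) = v t" and \<alpha>: "\<alpha> > 0"
  shows "(\<Sum>b\<in>bonds N. integral {bl b..br b} (\<lambda>t. bond_defect (deriv \<psi>) y b t * deriv v t))
    \<le> \<alpha> / 2 * (eta N La Ra K X \<psi> y)\<^sup>2 + integral {-1/2..1/2} (\<lambda>t. (deriv v t)\<^sup>2) / (2 * \<alpha>)"
proof -
  let ?S = "\<lambda>b t. bond_defect (deriv \<psi>) y b t"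
  have pv: "pwc (\<lambda>t. (deriv v t)\<^sup>2)" by (intro pwc_intros lattice.pwc_P1_deriv[OF v(1)])
  have perv: "(deriv v (t + 1))\<^sup>2 = (deriv v t)\<^sup>2" for t using deriv_shift1[of v t, OF v(2)] by simp
  have "(\<Sum>b\<in>bonds N. integral {bl b..br b} (\<lambda>t. ?S b t * deriv v t))
    \<le> (\<Sum>b\<in>bonds N. 3 * \<alpha> / 2 * integral {bl b..br b} (\<lambda>t. (?S b t)\<^sup>2)
      + 1 / (6 * \<alpha>) * integral {bl b..br b} (\<lambda>t. (deriv v t)\<^sup>2))"
  proof (rule sum_mono)
    fix b assume "b \<in> bonds N"
    have pS: "pwc (?S b)" by (rule pwc_bond_defect[OF y])
    have "integral {bl b..br b} (\<lambda>t. ?S b t * deriv v t)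
      \<le> integral {bl b..br b} (\<lambda>t. 3 * \<alpha> / 2 * (?S b t)\<^sup>2 + 1 / (6 * \<alpha>) * (deriv v t)\<^sup>2)"
    proof (intro integral_cosparse_mono pwc_intros pS pv lattice.pwc_P1_deriv[OF v(1)] always_eventually allI impI)
      fix t
      have "?S b t * deriv v t \<le> 3 * \<alpha> / 2 * (?S b t)\<^sup>2 + (deriv v t)\<^sup>2 / (2 * (3 * \<alpha>))"
        by (rule young) (use \<alpha> in simp)
      then show "?S b t * deriv v t \<le> 3 * \<alpha> / 2 * (?S b t)\<^sup>2 + 1 / (6 * \<alpha>) * (deriv v t)\<^sup>2" by simp
    qed
    also have "\<dots> = integral {bl b..br b} (\<lambda>t. 3 * \<alpha> / 2 * (?S b t)\<^sup>2)
        + integral {bl b..br b} (\<lambda>t. 1 / (6 * \<alpha>) * (deriv v t)\<^sup>2)"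
      by (intro integral_pwc_add pwc_intros pS pv)
    finally show "integral {bl b..br b} (\<lambda>t. ?S b t * deriv v t)
      \<le> 3 * \<alpha> / 2 * integral {bl b..br b} (\<lambda>t. (?S b t)\<^sup>2)
      + 1 / (6 * \<alpha>) * integral {bl b..br b} (\<lambda>t. (deriv v t)\<^sup>2)"
      unfolding integral_mult_right .
  qed
  also have "\<dots> = 3 * \<alpha> / 2 * (\<Sum>b\<in>bonds N. integral {bl b..br b} (\<lambda>t. (?S b t)\<^sup>2))
      + 1 / (6 * \<alpha>) * (\<Sum>b\<in>bonds N. integral {bl b..br b} (\<lambda>t. (deriv v t)\<^sup>2))"
    by (simp only: sum.distrib sum_distrib_left)
  also have "(\<Sum>b\<in>bonds N. integral {bl b..br b} (\<lambda>t. (deriv v t)\<^sup>2))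
      = 3 * integral {-1/2..1/2} (\<lambda>t. (deriv v t)\<^sup>2)"
    unfolding sum_bonds sum.distrib
    using sum_bond_integral[OF pv perv, of 1] sum_bond_integral[OF pv perv, of 2] by simp
  finally show ?thesis
    unfolding eta_sq_sum[OF y] by simp
qed

text \<open>The slope of w is the mean of the gradient of v over the element, so subtracting it
  leaves the variance. Nonnegativity of the variance is the first claim;
  \<open>poincare_zero\<close> for v - w turns the variance into the second.\<close>

lemma elem_interp_bounds:
  assumes v: "v \<in> P1 (lat N)" and w: "w \<in> P1 X" and agree: "\<And>t. t \<in> range X \<Longrightarrow> v t = w t"
  shows "integral {X (k - 1)..X k} (\<lambda>t. (deriv w t)\<^sup>2) \<le> integral {X (k - 1)..X k} (\<lambda>t. (deriv v t)\<^sup>2)"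
    and "t \<in> {X (k - 1)..X k} \<Longrightarrow>
      (v t - w t)\<^sup>2 \<le> hk X k / 4 * integral {X (k - 1)..X k} (\<lambda>t. (deriv v t)\<^sup>2)"
proof -
  let ?I = "{X (k - 1)..X k}" and ?s = "mesh.slope w k"
  have pv: "pwc (deriv v)" and pw: "pwc (deriv w)"
    by (rule lattice.pwc_P1_deriv[OF v], rule mesh.pwc_P1_deriv[OF w])
  have "integral ?I (deriv v) = v (X k) - v (X (k - 1))"
    by (rule lattice.P1_ftc[OF v]) simp
  then have mean: "integral ?I (deriv v) = hk X k * ?s"
    unfolding mesh.slope_hk by (simp add: agree)
  have ww: "integral ?I (\<lambda>t. (deriv w t)\<^sup>2) = hk X k * ?s\<^sup>2"
    by (rule integral_elem_slope[OF w])
  have e1: "(\<lambda>t. (deriv v t - ?s)\<^sup>2) = (\<lambda>t. (deriv v t)\<^sup>2 - (2 * ?s * deriv v t - ?s\<^sup>2))"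
    by (auto simp: power2_eq_square algebra_simps)
  have e2: "integral ?I (\<lambda>t. (deriv v t)\<^sup>2 - (2 * ?s * deriv v t - ?s\<^sup>2))
      = integral ?I (\<lambda>t. (deriv v t)\<^sup>2) - (integral ?I (\<lambda>t. 2 * ?s * deriv v t) - integral ?I (\<lambda>_. ?s\<^sup>2))"
    by (subst integral_pwc_diff, (intro pwc_intros pv)+)+ (rule refl)
  have e3: "integral ?I (\<lambda>_. ?s\<^sup>2) = hk X k * ?s\<^sup>2"
    by (rule mesh.integral_elem_const) simp
  have e4: "integral ?I (\<lambda>t. 2 * ?s * deriv v t) = 2 * (hk X k * ?s\<^sup>2)"
    unfolding integral_mult_right mean by (simp add: power2_eq_square)
  have var: "integral ?I (\<lambda>t. (deriv v t - ?s)\<^sup>2) = integral ?I (\<lambda>t. (deriv v t)\<^sup>2) - hk X k * ?s\<^sup>2"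
    unfolding e1 e2 e3 e4 by simp
  have "integral ?I (\<lambda>t. (deriv v t - ?s)\<^sup>2) \<ge> 0"
    by (intro integral_nonneg pwc_integrable pwc_intros pv) auto
  then show "integral ?I (\<lambda>t. (deriv w t)\<^sup>2) \<le> integral ?I (\<lambda>t. (deriv v t)\<^sup>2)"
    unfolding ww var by simp
  assume t: "t \<in> ?I"
  have "\<forall>\<^sub>\<approx>t. ((\<lambda>t. v t - w t) has_real_derivative deriv v t - deriv w t) (at t)"
    using lattice.P1_cosparse_deriv[OF v] mesh.P1_cosparse_deriv[OF w]
    by eventually_elim (rule DERIV_diff)
  then have "(v t - w t)\<^sup>2 \<le> (X k - X (k - 1)) / 4 * integral ?I (\<lambda>t. (deriv v t - deriv w t)\<^sup>2)"
    using lattice.P1_continuous[OF v] mesh.P1_continuous[OF w]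
    by (intro poincare_zero[OF t]) (auto intro!: continuous_intros pwc_intros pv pw simp: agree)
  also have "integral ?I (\<lambda>t. (deriv v t - deriv w t)\<^sup>2) = integral ?I (\<lambda>t. (deriv v t - ?s)\<^sup>2)"
    by (intro integral_cosparse_cong always_eventually) (simp add: mesh.P1_deriv[OF w])
  also have "(X k - X (k - 1)) / 4 * \<dots> \<le> hk X k / 4 * integral ?I (\<lambda>t. (deriv v t)\<^sup>2)"
    unfolding var hk_def[symmetric] using mesh.hk_pos[of k] by (intro mult_left_mono) auto
  finally show "(v t - w t)\<^sup>2 \<le> hk X k / 4 * integral ?I (\<lambda>t. (deriv v t)\<^sup>2)" .
qed

end

text \<open>Used with \<open>P = \<pi>\<close> and the lattice and mesh bubbles for \<open>p\<close> and \<open>q\<close>.\<close>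

lemma force_integrand_young:
  fixes p q e h f0 f1 f2 v v1 w w1 P \<alpha> :: real
  assumes p: "0 \<le> p" "p \<le> e\<^sup>2 / 8" and q: "0 \<le> q" "q \<le> h\<^sup>2 / 8" and h: "h > 0" and P: "P > 0" and \<alpha>: "\<alpha> > 0"
  shows "\<bar>p * (2 * f1 * v1 + f2 * v) - q * (2 * f1 * w1 + f2 * w) + f0 * (v - w)\<bar>
    \<le> \<alpha> / 2 * ((e ^ 4 + h ^ 4) * f1\<^sup>2 + (e ^ 4 + h ^ 4) / (4 * P\<^sup>2) * f2\<^sup>2 + h\<^sup>2 / P\<^sup>2 * f0\<^sup>2)
      + 1 / (2 * \<alpha>) * ((v1\<^sup>2 + w1\<^sup>2) / 16 + P\<^sup>2 / 16 * (v\<^sup>2 + w\<^sup>2) + P\<^sup>2 / h\<^sup>2 * (v - w)\<^sup>2)"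
proof -
  have t1: "\<bar>r * (2 * f1 * z1 + f2 * z)\<bar>
    \<le> \<alpha> / 2 * (s ^ 4 * f1\<^sup>2 + s ^ 4 / (4 * P\<^sup>2) * f2\<^sup>2) + 1 / (2 * \<alpha>) * (z1\<^sup>2 / 16 + P\<^sup>2 / 16 * z\<^sup>2)"
    if r: "0 \<le> r" "r \<le> s\<^sup>2 / 8" for r s z1 z :: real
  proof -
    have "\<bar>r * (2 * f1 * z1 + f2 * z)\<bar> \<le> s\<^sup>2 / 8 * (2 * \<bar>f1\<bar> * \<bar>z1\<bar> + \<bar>f2\<bar> * \<bar>z\<bar>)"
      unfolding abs_mult
      using r abs_triangle_ineq[of "2 * f1 * z1" "f2 * z"]
      by (intro mult_mono) (auto simp: abs_mult)
    \<comment> \<open>For P = \<pi> the squares of the first factors are the densities in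
      \<open>eta_q\<close>; the second factors take what is left of the constants.\<close>
    also have "\<dots> = (s\<^sup>2 * \<bar>f1\<bar>) * (\<bar>z1\<bar> / 4) + (s\<^sup>2 * \<bar>f2\<bar> / (2 * P)) * (P * \<bar>z\<bar> / 4)"
      using P by (simp add: field_simps)
    also have "\<dots> \<le> (\<alpha> / 2 * (s\<^sup>2 * \<bar>f1\<bar>)\<^sup>2 + (\<bar>z1\<bar> / 4)\<^sup>2 / (2 * \<alpha>))
        + (\<alpha> / 2 * (s\<^sup>2 * \<bar>f2\<bar> / (2 * P))\<^sup>2 + (P * \<bar>z\<bar> / 4)\<^sup>2 / (2 * \<alpha>))"
      by (intro add_mono young \<alpha>)
    also have "\<dots> = \<alpha> / 2 * (s ^ 4 * f1\<^sup>2 + s ^ 4 / (4 * P\<^sup>2) * f2\<^sup>2) + 1 / (2 * \<alpha>) * (z1\<^sup>2 / 16 + P\<^sup>2 / 16 * z\<^sup>2)"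
      using P \<alpha> by (simp add: power_mult_distrib power_divide field_simps)
    finally show ?thesis .
  qed
  have t2: "\<bar>f0 * (v - w)\<bar> \<le> \<alpha> / 2 * (h\<^sup>2 / P\<^sup>2 * f0\<^sup>2) + 1 / (2 * \<alpha>) * (P\<^sup>2 / h\<^sup>2 * (v - w)\<^sup>2)"
  proof -
    \<comment> \<open>The same idea with the density of \<open>eta_f\<close>; the inverse power of h
      is later compensated by the interpolation bound for v - w.\<close>
    have "\<bar>f0 * (v - w)\<bar> = (h * \<bar>f0\<bar> / P) * (P * \<bar>v - w\<bar> / h)"
      using P h by (simp add: abs_mult)
    also have "\<dots> \<le> \<alpha> / 2 * (h * \<bar>f0\<bar> / P)\<^sup>2 + (P * \<bar>v - w\<bar> / h)\<^sup>2 / (2 * \<alpha>)"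
      by (rule young[OF \<alpha>])
    also have "\<dots> = \<alpha> / 2 * (h\<^sup>2 / P\<^sup>2 * f0\<^sup>2) + 1 / (2 * \<alpha>) * (P\<^sup>2 / h\<^sup>2 * (v - w)\<^sup>2)"
      by (simp add: power_mult_distrib power_divide)
    finally show ?thesis .
  qed
  have "\<bar>p * (2 * f1 * v1 + f2 * v) - q * (2 * f1 * w1 + f2 * w) + f0 * (v - w)\<bar>
    \<le> \<bar>p * (2 * f1 * v1 + f2 * v)\<bar> + \<bar>q * (2 * f1 * w1 + f2 * w)\<bar> + \<bar>f0 * (v - w)\<bar>"
    by linarith
  also have "\<dots> \<le> (\<alpha> / 2 * (e ^ 4 * f1\<^sup>2 + e ^ 4 / (4 * P\<^sup>2) * f2\<^sup>2) + 1 / (2 * \<alpha>) * (v1\<^sup>2 / 16 + P\<^sup>2 / 16 * v\<^sup>2))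
    + (\<alpha> / 2 * (h ^ 4 * f1\<^sup>2 + h ^ 4 / (4 * P\<^sup>2) * f2\<^sup>2) + 1 / (2 * \<alpha>) * (w1\<^sup>2 / 16 + P\<^sup>2 / 16 * w\<^sup>2))
    + (\<alpha> / 2 * (h\<^sup>2 / P\<^sup>2 * f0\<^sup>2) + 1 / (2 * \<alpha>) * (P\<^sup>2 / h\<^sup>2 * (v - w)\<^sup>2))"
    by (intro add_mono t1 t2 p q)
  also have "\<dots> = \<alpha> / 2 * ((e ^ 4 + h ^ 4) * f1\<^sup>2 + (e ^ 4 + h ^ 4) / (4 * P\<^sup>2) * f2\<^sup>2 + h\<^sup>2 / P\<^sup>2 * f0\<^sup>2)
      + 1 / (2 * \<alpha>) * ((v1\<^sup>2 + w1\<^sup>2) / 16 + P\<^sup>2 / 16 * (v\<^sup>2 + w\<^sup>2) + P\<^sup>2 / h\<^sup>2 * (v - w)\<^sup>2)"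
    by (simp only: distrib_left distrib_right add_divide_distrib)
  finally show ?thesis .
qed

context qc_force
begin

lemma elem_L2norm:
  assumes "k \<in> elems_c N La Ra K X"
  shows "(L2norm (elem X k) (deriv f))\<^sup>2 = integral {X (k - 1)..X k} (\<lambda>t. (F1 t)\<^sup>2)"
    and "(L2norm (elem X k) (deriv (deriv f)))\<^sup>2 = integral {X (k - 1)..X k} (\<lambda>t. (F2 t)\<^sup>2)"
proof -
  have "F1 t = deriv f t" "F2 t = deriv (deriv f) t" if "t \<in> {X (k - 1)..X k}" for t
    using assms that by (auto simp: F1_def F2_def elems_c_iff)
  then show "(L2norm (elem X k) (deriv f))\<^sup>2 = integral {X (k - 1)..X k} (\<lambda>t. (F1 t)\<^sup>2)"
    "(L2norm (elem X k) (deriv (deriv f)))\<^sup>2 = integral {X (k - 1)..X k} (\<lambda>t. (F2 t)\<^sup>2)"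
    unfolding L2norm_sq elem_def by (auto intro: integral_cong)
qed

text \<open>The 1/8 collects two gradient terms with weight 1/16, since the gradient of w is
  controlled by that of v; \<pi>^2/4 is the weight \<pi>^2/h^2 times the h^2/4 from integrating the
  pointwise bound on v - w.\<close>

lemma force_residual_elem:
  assumes v: "v \<in> P1 (lat N)" and w: "w \<in> P1 X"
    and agree: "\<And>t. t \<in> range X \<Longrightarrow> v t = w t" and \<alpha>: "\<alpha> > 0"
    and k: "k \<in> elems_c N La Ra K X"
  shows "integral {X (k - 1)..X k}
      (\<lambda>t. \<bar>lattice.bubble t * (2 * F1 t * deriv v t + F2 t * v t)
        - mesh.bubble t * (2 * F1 t * deriv w t + F2 t * w t)
        + indicat_real Ct t * (f t * (v t - w t))\<bar>)
    \<le> \<alpha> / 2 * ((hk X k)\<^sup>2 / pi\<^sup>2 * (L2norm (elem X k) f)\<^sup>2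
        + ((eps N ^ 4 + hk X k ^ 4) * (L2norm (elem X k) (deriv f))\<^sup>2
          + (eps N ^ 4 + hk X k ^ 4) / (4 * pi\<^sup>2) * (L2norm (elem X k) (deriv (deriv f)))\<^sup>2))
      + 1 / (2 * \<alpha>) * ((1 / 8 + pi\<^sup>2 / 4) * integral {X (k - 1)..X k} (\<lambda>t. (deriv v t)\<^sup>2)
        + pi\<^sup>2 / 16 * (integral {X (k - 1)..X k} (\<lambda>t. (v t)\<^sup>2) + integral {X (k - 1)..X k} (\<lambda>t. (w t)\<^sup>2)))"
    (is "integral ?I ?D \<le> _")
proof -
  let ?e = "eps N ^ 4 + hk X k ^ 4"
  let ?G = "\<lambda>t. ?e * (F1 t)\<^sup>2 + ?e / (4 * pi\<^sup>2) * (F2 t)\<^sup>2 + (hk X k)\<^sup>2 / pi\<^sup>2 * (f t)\<^sup>2"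
  let ?Z = "\<lambda>t. 1 / 16 * ((deriv v t)\<^sup>2 + (deriv w t)\<^sup>2) + pi\<^sup>2 / 16 * ((v t)\<^sup>2 + (w t)\<^sup>2)
    + pi\<^sup>2 / (hk X k)\<^sup>2 * (v t - w t)\<^sup>2"
  have hk: "hk X k > 0" by (rule mesh.hk_pos)
  note pD = lattice.pwc_P1_deriv[OF v] mesh.pwc_P1_deriv[OF w]
    pwc_continuous[OF f_cont] pwc_continuous[OF lattice.P1_continuous[OF v]]
    pwc_continuous[OF mesh.P1_continuous[OF w]]
  note pI = pwc_intros pwc_indicator_Ct pwc_F1 pwc_F2 lattice.pwc_bubble mesh.pwc_bubble pD
  have "\<forall>\<^sub>\<approx>t. t \<in> {X (k - 1)<..<X k} \<longrightarrow> ?D t \<le> \<alpha> / 2 * ?G t + 1 / (2 * \<alpha>) * ?Z t"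
  proof (rule lattice.cosparse_gridI, rule impI)
    fix l t assume t: "t \<in> {lat N (l - 1)<..<lat N l}" "t \<in> {X (k - 1)<..<X k}"
    have "t \<in> Ct" using t k by (auto simp: elems_c_iff)
    then have Ct: "indicat_real Ct t = 1" by simp
    have p: "0 \<le> lattice.bubble t" "lattice.bubble t \<le> (eps N)\<^sup>2 / 8"
      using lattice.bubble_bounds[OF t(1)] by simp_all
    show "?D t \<le> \<alpha> / 2 * ?G t + 1 / (2 * \<alpha>) * ?Z t"
      using force_integrand_young[OF p mesh.bubble_bounds[OF t(2)] hk pi_gt_zero \<alpha>, of "F1 t" "deriv v t" "F2 t" "v t" "deriv w t" "w t" "f t"]
      unfolding Ct by simp
  qed
  then have "integral ?I ?D \<le> integral ?I (\<lambda>t. \<alpha> / 2 * ?G t + 1 / (2 * \<alpha>) * ?Z t)"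
    by (intro integral_cosparse_mono pI)
  also have "\<dots> = \<alpha> / 2 * integral ?I ?G + 1 / (2 * \<alpha>) * integral ?I ?Z"
  proof -
    have "integral ?I (\<lambda>t. \<alpha> / 2 * ?G t + 1 / (2 * \<alpha>) * ?Z t)
      = integral ?I (\<lambda>t. \<alpha> / 2 * ?G t) + integral ?I (\<lambda>t. 1 / (2 * \<alpha>) * ?Z t)"
      by (intro integral_pwc_add pI)
    then show ?thesis by (simp only: integral_mult_right)
  qed
  finally have le: "integral ?I ?D \<le> \<alpha> / 2 * integral ?I ?G + 1 / (2 * \<alpha>) * integral ?I ?Z" .
  have G: "integral ?I ?G = (hk X k)\<^sup>2 / pi\<^sup>2 * (L2norm (elem X k) f)\<^sup>2
        + (?e * (L2norm (elem X k) (deriv f))\<^sup>2 + ?e / (4 * pi\<^sup>2) * (L2norm (elem X k) (deriv (deriv f)))\<^sup>2)"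
  proof -
    have "integral ?I ?G = integral ?I (\<lambda>t. ?e * (F1 t)\<^sup>2) + integral ?I (\<lambda>t. ?e / (4 * pi\<^sup>2) * (F2 t)\<^sup>2)
        + integral ?I (\<lambda>t. (hk X k)\<^sup>2 / pi\<^sup>2 * (f t)\<^sup>2)"
      by (subst integral_pwc_add, (intro pI)+)+ (rule refl)
    also have "\<dots> = ?e * integral ?I (\<lambda>t. (F1 t)\<^sup>2) + ?e / (4 * pi\<^sup>2) * integral ?I (\<lambda>t. (F2 t)\<^sup>2)
        + (hk X k)\<^sup>2 / pi\<^sup>2 * integral ?I (\<lambda>t. (f t)\<^sup>2)"
      by (simp only: integral_mult_right)
    finally show ?thesis
      unfolding elem_L2norm[OF k] L2norm_sq[of "elem X k" f] unfolding elem_def by (simp only: add.commute add.left_commute)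
  qed
  have "integral ?I ?Z \<le> (1 / 8 + pi\<^sup>2 / 4) * integral ?I (\<lambda>t. (deriv v t)\<^sup>2)
        + pi\<^sup>2 / 16 * (integral ?I (\<lambda>t. (v t)\<^sup>2) + integral ?I (\<lambda>t. (w t)\<^sup>2))"
  proof -
    let ?V = "integral ?I (\<lambda>t. (deriv v t)\<^sup>2)"
    have "integral ?I ?Z = integral ?I (\<lambda>t. 1 / 16 * ((deriv v t)\<^sup>2 + (deriv w t)\<^sup>2))
        + integral ?I (\<lambda>t. pi\<^sup>2 / 16 * ((v t)\<^sup>2 + (w t)\<^sup>2))
        + integral ?I (\<lambda>t. pi\<^sup>2 / (hk X k)\<^sup>2 * (v t - w t)\<^sup>2)"
      by (subst integral_pwc_add, (intro pI)+)+ (rule refl)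
    also have "\<dots> = 1 / 16 * integral ?I (\<lambda>t. (deriv v t)\<^sup>2 + (deriv w t)\<^sup>2)
        + pi\<^sup>2 / 16 * integral ?I (\<lambda>t. (v t)\<^sup>2 + (w t)\<^sup>2)
        + pi\<^sup>2 / (hk X k)\<^sup>2 * integral ?I (\<lambda>t. (v t - w t)\<^sup>2)"
      by (simp only: integral_mult_right)
    also have "integral ?I (\<lambda>t. (deriv v t)\<^sup>2 + (deriv w t)\<^sup>2) = ?V + integral ?I (\<lambda>t. (deriv w t)\<^sup>2)"
      by (intro integral_pwc_add pwc_intros pD)
    also have "integral ?I (\<lambda>t. (v t)\<^sup>2 + (w t)\<^sup>2) = integral ?I (\<lambda>t. (v t)\<^sup>2) + integral ?I (\<lambda>t. (w t)\<^sup>2)"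
      by (intro integral_pwc_add pwc_intros pD)
    finally have Z: "integral ?I ?Z = 1 / 16 * (?V + integral ?I (\<lambda>t. (deriv w t)\<^sup>2))
        + pi\<^sup>2 / 16 * (integral ?I (\<lambda>t. (v t)\<^sup>2) + integral ?I (\<lambda>t. (w t)\<^sup>2))
        + pi\<^sup>2 / (hk X k)\<^sup>2 * integral ?I (\<lambda>t. (v t - w t)\<^sup>2)" .
    have "integral ?I (\<lambda>t. (v t - w t)\<^sup>2) \<le> integral ?I (\<lambda>_. hk X k / 4 * ?V)"
      using elem_interp_bounds(2)[OF v w agree]
      by (intro integral_cosparse_mono pwc_intros pD always_eventually) auto
    also have "\<dots> = hk X k * (hk X k / 4 * ?V)"
      by (rule mesh.integral_elem_const) (rule refl)
    finally have "pi\<^sup>2 / (hk X k)\<^sup>2 * integral ?I (\<lambda>t. (v t - w t)\<^sup>2)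
        \<le> pi\<^sup>2 / (hk X k)\<^sup>2 * (hk X k * (hk X k / 4 * ?V))"
      by (intro mult_left_mono) auto
    also have "\<dots> = pi\<^sup>2 / 4 * ?V" using hk by (simp add: power2_eq_square)
    finally have "pi\<^sup>2 / (hk X k)\<^sup>2 * integral ?I (\<lambda>t. (v t - w t)\<^sup>2) \<le> pi\<^sup>2 / 4 * ?V" .
    moreover have "integral ?I (\<lambda>t. (deriv w t)\<^sup>2) \<le> ?V"
      by (rule elem_interp_bounds(1)[OF v w]) (rule agree)
    moreover have "1 / 16 * (V + W) + c + T \<le> (1 / 8 * V + d) + c" if "T \<le> d" "W \<le> V" for V W T c d :: real
      using that by (simp add: field_simps)
    ultimately show ?thesis unfolding Z distrib_right by blast
  qed
  then have "1 / (2 * \<alpha>) * integral ?I ?Z \<le> 1 / (2 * \<alpha>) *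
      ((1 / 8 + pi\<^sup>2 / 4) * integral ?I (\<lambda>t. (deriv v t)\<^sup>2)
        + pi\<^sup>2 / 16 * (integral ?I (\<lambda>t. (v t)\<^sup>2) + integral ?I (\<lambda>t. (w t)\<^sup>2)))"
    using \<alpha> by (intro mult_left_mono) auto
  then show ?thesis by (intro order_trans[OF le[unfolded G]] add_left_mono)
qed

text \<open>The 5 bounds 1/8 + \<pi>^2/4 + \<pi>^2/32; with \<pi> < 4 this is at most 1/8 + 4 + 1/2.
  The last summand comes from the Poincare inequality for v and w, which both vanish at 0.\<close>

lemma force_residual_le:
  assumes v: "v \<in> P1 (lat N)" "\<And>t. v (t + 1) = v t" "v 0 = 0" and w: "w \<in> P1 X" "\<And>t. w (t + 1) = w t"
    and agree: "\<And>t. t \<in> range X \<Longrightarrow> v t = w t" and \<alpha>: "\<alpha> > 0"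
  shows "\<bar>ip_eps N f (nodal N v) - ip_h X f w\<bar>
    \<le> \<alpha> / 2 * ((eta_f N La Ra K X f)\<^sup>2 + (eta_q N La Ra K X f)\<^sup>2)
      + 5 / (2 * \<alpha>) * integral {-1/2..1/2} (\<lambda>t. (deriv v t)\<^sup>2)"
proof -
  let ?D = "\<lambda>t. \<bar>lattice.bubble t * (2 * F1 t * deriv v t + F2 t * v t)
        - mesh.bubble t * (2 * F1 t * deriv w t + F2 t * w t)
        + indicat_real Ct t * (f t * (v t - w t))\<bar>"
  let ?I = "\<lambda>k. {X (k - 1)..X k}"
  let ?V = "\<lambda>k. integral (?I k) (\<lambda>t. (deriv v t)\<^sup>2)"
  define G1 where "G1 k = (hk X k)\<^sup>2 / pi\<^sup>2 * (L2norm (elem X k) f)\<^sup>2" for k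
  define G2 where "G2 k = (eps N ^ 4 + hk X k ^ 4) * (L2norm (elem X k) (deriv f))\<^sup>2
          + (eps N ^ 4 + hk X k ^ 4) / (4 * pi\<^sup>2) * (L2norm (elem X k) (deriv (deriv f)))\<^sup>2" for k
  define Q where "Q k = (1 / 8 + pi\<^sup>2 / 4) * ?V k
        + pi\<^sup>2 / 16 * (integral (?I k) (\<lambda>t. (v t)\<^sup>2) + integral (?I k) (\<lambda>t. (w t)\<^sup>2))" for k
  have w0: "w 0 = 0"
  proof -
    have "0 \<in> range X" using qc_mesh by (simp add: qc_mesh_def)
    then show ?thesis using agree[of 0] v(3) by simp
  qed
  have dper: "deriv v (t + 1) = deriv v t" "deriv w (t + 1) = deriv w t" for t
    using v w by (auto intro: deriv_shift1)
  have Ct_per: "indicat_real Ct (t + 1) = indicat_real Ct t" for t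
    by (simp add: indicator_def)
  note pD = lattice.pwc_P1_deriv[OF v(1)] mesh.pwc_P1_deriv[OF w(1)]
    pwc_continuous[OF f_cont] pwc_continuous[OF lattice.P1_continuous[OF v(1)]]
    pwc_continuous[OF mesh.P1_continuous[OF w(1)]]
  note pI = pwc_intros pwc_indicator_Ct pwc_F1 pwc_F2 lattice.pwc_bubble mesh.pwc_bubble pD
  have eq: "ip_eps N f (nodal N v) - ip_h X f w = integral {-1/2..1/2}
    (\<lambda>t. lattice.bubble t * (2 * F1 t * deriv v t + F2 t * v t)
      - mesh.bubble t * (2 * F1 t * deriv w t + F2 t * w t)
      + indicat_real Ct t * (f t * (v t - w t)))"
    by (rule force_error[OF v(1,2) w]) (rule agree)
  have "\<bar>ip_eps N f (nodal N v) - ip_h X f w\<bar> \<le> integral {-1/2..1/2} ?D"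
    unfolding eq by (intro integral_pwc_abs_le pI)
  also have "\<dots> = (\<Sum>k\<in>{1..int K}. integral (?I k) ?D)"
    by (intro integral_mesh_sum pI)
      (simp only: lattice.bubble_per mesh.bubble_per F1_per F2_per dper v(2) w(2) f_per Ct_per)
  also have "\<dots> = (\<Sum>k\<in>elems_c N La Ra K X. integral (?I k) ?D)"
  proof (intro sum.mono_neutral_right ballI)
    fix k assume "k \<in> {1..int K} - elems_c N La Ra K X"
    then have "{X (k - 1)<..<X k} \<inter> Ct = {}" by (intro elem_outside_Ct) (auto simp: elems_c_iff)
    then have "F1 t = 0 \<and> F2 t = 0 \<and> indicat_real Ct t = 0" if "t \<in> {X (k - 1)<..<X k}" for t
      using that by (auto simp: F1_def F2_def disjoint_iff)
    then have "integral (?I k) ?D = integral (?I k) (\<lambda>_. 0)"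
      by (intro integral_cosparse_cong always_eventually) simp
    then show "integral (?I k) ?D = 0" by simp
  qed (auto simp: elems_c_def)
  also have "\<dots> \<le> (\<Sum>k\<in>elems_c N La Ra K X. \<alpha> / 2 * (G1 k + G2 k) + 1 / (2 * \<alpha>) * Q k)"
    unfolding G1_def G2_def Q_def
    by (intro sum_mono force_residual_elem[OF v(1) w(1) _ \<alpha>] agree)
  also have "\<dots> = \<alpha> / 2 * ((\<Sum>k\<in>elems_c N La Ra K X. G1 k) + (\<Sum>k\<in>elems_c N La Ra K X. G2 k))
      + 1 / (2 * \<alpha>) * (\<Sum>k\<in>elems_c N La Ra K X. Q k)"
    by (simp only: sum.distrib sum_distrib_left[symmetric])
  finally have le: "\<bar>ip_eps N f (nodal N v) - ip_h X f w\<bar>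
    \<le> \<alpha> / 2 * ((\<Sum>k\<in>elems_c N La Ra K X. G1 k) + (\<Sum>k\<in>elems_c N La Ra K X. G2 k))
      + 1 / (2 * \<alpha>) * (\<Sum>k\<in>elems_c N La Ra K X. Q k)" .
  have G1: "(\<Sum>k\<in>elems_c N La Ra K X. G1 k) = (eta_f N La Ra K X f)\<^sup>2"
  proof -
    have "(\<Sum>k\<in>elems_c N La Ra K X. G1 k) \<ge> 0" by (intro sum_nonneg) (simp add: G1_def)
    then show ?thesis by (simp add: eta_f_def G1_def)
  qed
  have G2: "(\<Sum>k\<in>elems_c N La Ra K X. G2 k) = (eta_q N La Ra K X f)\<^sup>2"
  proof -
    have "(\<Sum>k\<in>elems_c N La Ra K X. G2 k) \<ge> 0"
      using eps_pos by (intro sum_nonneg) (simp add: G2_def)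
    then show ?thesis by (simp add: eta_q_def G2_def)
  qed
  have "(\<Sum>k\<in>elems_c N La Ra K X. Q k) \<le> 5 * integral {-1/2..1/2} (\<lambda>t. (deriv v t)\<^sup>2)"
  proof -
    let ?VV = "integral {-1/2..1/2} (\<lambda>t. (deriv v t)\<^sup>2)"
    have nonneg: "integral (?I k) (\<lambda>t. (g t)\<^sup>2) \<ge> 0" if "pwc g" for g k
      using that by (intro integral_nonneg pwc_integrable pwc_intros) auto
    \<comment> \<open>The Poincare inequality needs the whole period, so the nonnegative terms of
      the remaining elements are added.\<close>
    have "(\<Sum>k\<in>elems_c N La Ra K X. Q k) \<le> (\<Sum>k\<in>{1..int K}. Q k)"
      unfolding Q_def
      by (intro sum_mono2 add_nonneg_nonneg mult_nonneg_nonneg nonneg pD) (auto simp: elems_c_def)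
    also have "\<dots> = (1 / 8 + pi\<^sup>2 / 4) * (\<Sum>k\<in>{1..int K}. ?V k)
        + pi\<^sup>2 / 16 * ((\<Sum>k\<in>{1..int K}. integral (?I k) (\<lambda>t. (v t)\<^sup>2))
          + (\<Sum>k\<in>{1..int K}. integral (?I k) (\<lambda>t. (w t)\<^sup>2)))"
      unfolding Q_def by (simp only: sum.distrib sum_distrib_left[symmetric])
    also have "(\<Sum>k\<in>{1..int K}. ?V k) = ?VV"
      by (rule integral_mesh_sum[symmetric]) (intro pwc_intros pD, simp only: dper)
    also have "(\<Sum>k\<in>{1..int K}. integral (?I k) (\<lambda>t. (v t)\<^sup>2)) = integral {-1/2..1/2} (\<lambda>t. (v t)\<^sup>2)"
      by (rule integral_mesh_sum[symmetric]) (intro pwc_intros pD, simp only: v(2))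
    also have "(\<Sum>k\<in>{1..int K}. integral (?I k) (\<lambda>t. (w t)\<^sup>2)) = integral {-1/2..1/2} (\<lambda>t. (w t)\<^sup>2)"
      by (rule integral_mesh_sum[symmetric]) (intro pwc_intros pD, simp only: w(2))
    finally have Q: "(\<Sum>k\<in>elems_c N La Ra K X. Q k) \<le> (1 / 8 + pi\<^sup>2 / 4) * ?VV
        + pi\<^sup>2 / 16 * (integral {-1/2..1/2} (\<lambda>t. (v t)\<^sup>2) + integral {-1/2..1/2} (\<lambda>t. (w t)\<^sup>2))" .
    have pv: "integral {-1/2..1/2} (\<lambda>t. (v t)\<^sup>2) \<le> ?VV / 4"
      by (intro periodic_poincare lattice.P1_continuous lattice.P1_cosparse_deriv pD v)
    have "integral {-1/2..1/2} (\<lambda>t. (w t)\<^sup>2) \<le> integral {-1/2..1/2} (\<lambda>t. (deriv w t)\<^sup>2) / 4"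
      by (intro periodic_poincare mesh.P1_continuous mesh.P1_cosparse_deriv pD w w0)
    also have "integral {-1/2..1/2} (\<lambda>t. (deriv w t)\<^sup>2) = (\<Sum>k\<in>{1..int K}. integral (?I k) (\<lambda>t. (deriv w t)\<^sup>2))"
      by (rule integral_mesh_sum) (intro pwc_intros pD, simp only: dper)
    also have "\<dots> \<le> (\<Sum>k\<in>{1..int K}. ?V k)"
      by (intro sum_mono elem_interp_bounds(1)[OF v(1) w(1)] agree)
    also have "\<dots> = ?VV"
      by (rule integral_mesh_sum[symmetric]) (intro pwc_intros pD, simp only: dper)
    finally have pw: "integral {-1/2..1/2} (\<lambda>t. (w t)\<^sup>2) \<le> ?VV / 4" by simp
    have V0: "?VV \<ge> 0" by (intro integral_nonneg pwc_integrable pwc_intros pD) auto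
    have "pi\<^sup>2 \<le> 4\<^sup>2" using pi_less_4 pi_gt_zero by (intro power_mono) auto
    then have pi16: "pi\<^sup>2 \<le> 16" by simp
    have "pi\<^sup>2 / 16 * (integral {-1/2..1/2} (\<lambda>t. (v t)\<^sup>2) + integral {-1/2..1/2} (\<lambda>t. (w t)\<^sup>2))
        \<le> 1 * (?VV / 4 + ?VV / 4)"
    proof (rule mult_mono)
      show "0 \<le> integral {-1/2..1/2} (\<lambda>t. (v t)\<^sup>2) + integral {-1/2..1/2} (\<lambda>t. (w t)\<^sup>2)"
        by (intro add_nonneg_nonneg integral_nonneg pwc_integrable pwc_intros pD) auto
    qed (use pi16 pv pw in auto)
    moreover have "(1 / 8 + pi\<^sup>2 / 4) * ?VV \<le> (1 / 8 + 4) * ?VV"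
      using pi16 V0 by (intro mult_right_mono) auto
    moreover have "q \<le> 5 * V" if "q \<le> a + b" "b \<le> 1 * (V / 4 + V / 4)" "a \<le> (1 / 8 + 4) * V" "0 \<le> V"
      for q a b V :: real
    proof -
      have "a \<le> 33 / 8 * V" "b \<le> V / 2" using that by simp_all
      with that(1,4) show ?thesis by linarith
    qed
    ultimately show ?thesis using Q V0 by blast
  qed
  then have "1 / (2 * \<alpha>) * (\<Sum>k\<in>elems_c N La Ra K X. Q k)
      \<le> 1 / (2 * \<alpha>) * (5 * integral {-1/2..1/2} (\<lambda>t. (deriv v t)\<^sup>2))"
    using \<alpha> by (intro mult_left_mono) auto
  also have "\<dots> = 5 / (2 * \<alpha>) * integral {-1/2..1/2} (\<lambda>t. (deriv v t)\<^sup>2)" by simp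
  finally show ?thesis by (intro order_trans[OF le[unfolded G1 G2]] add_left_mono)
qed

end

section \<open>Local convexity of the atomistic energy\<close>

text \<open>Two tangent inequalities show that \<phi>1 is nonincreasing beyond r. The point r itself
  is reached by continuity of \<phi>2; it matters because two strains of size rstar/2 add up to
  exactly rstar.\<close>

lemma deriv_deriv_nonpos:
  fixes \<phi> :: "real \<Rightarrow> real"
  assumes conc: "concave_on {r<..} \<phi>"
    and d1: "\<And>s. s > r \<Longrightarrow> (\<phi> has_real_derivative \<phi>1 s) (at s)"
    and d2: "\<And>s. s > r \<Longrightarrow> (\<phi>1 has_real_derivative \<phi>2 s) (at s)"
    and cont: "isCont \<phi>2 r" and x: "x \<ge> r"
  shows "\<phi>2 x \<le> 0"
proof -
  have mono: "\<phi>1 t \<le> \<phi>1 s" if "r < s" "s < t" for s t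
  proof -
    have conv: "convex_on {r<..} (\<lambda>s. - \<phi> s)" using conc by (simp add: concave_on_def)
    have d: "((\<lambda>s. - \<phi> s) has_real_derivative - \<phi>1 u) (at u within {r<..})" if "u > r" for u
      using d1[OF that] by (intro DERIV_minus) (rule has_field_derivative_at_within)
    have "- \<phi> t - - \<phi> s \<ge> - \<phi>1 s * (t - s)" "- \<phi> s - - \<phi> t \<ge> - \<phi>1 t * (s - t)"
      using that
      by (intro convex_on_imp_above_tangent[OF conv]; auto simp: interior_open intro!: d)+
    then have "(\<phi>1 t - \<phi>1 s) * (t - s) \<le> 0" by (simp add: algebra_simps)
    then show ?thesis using that by (simp add: mult_le_0_iff)
  qed
  have neg: "\<phi>2 s \<le> 0" if s: "s > r" for s
  proof (rule ccontr)
    assume "\<not> \<phi>2 s \<le> 0"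
    then obtain d where d: "d > 0" "\<And>h. 0 < h \<Longrightarrow> h < d \<Longrightarrow> \<phi>1 s < \<phi>1 (s + h)"
      using DERIV_pos_inc_right[OF d2[OF s]] by auto
    then have "\<phi>1 s < \<phi>1 (s + d / 2)" by simp
    moreover have "\<phi>1 (s + d / 2) \<le> \<phi>1 s" using s d(1) by (intro mono) auto
    ultimately show False by simp
  qed
  show ?thesis
  proof (cases "x = r")
    case True
    have "(\<phi>2 \<longlongrightarrow> \<phi>2 r) (at_right r)"
      using cont unfolding isCont_def by (rule filterlim_at_split[THEN iffD1, THEN conjunct2])
    moreover have "\<forall>\<^sub>F s in at_right r. \<phi>2 s \<le> 0"
      using neg by (auto simp: eventually_at_right_field intro!: exI[of _ "r + 1"])
    ultimately show ?thesis unfolding True by (rule tendsto_upperbound) simp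
  qed (use neg x in simp)
qed

text \<open>Finitely many points allow a common \<tau>. The radius is twice \<tau> because a second
  neighbour strain is the sum of two strains, each known up to \<tau>.\<close>

lemma uniform_lower_bound:
  fixes g :: "real \<Rightarrow> real"
  assumes "finite S" "\<And>d. d \<in> S \<Longrightarrow> isCont g d" "\<delta> > 0"
  shows "\<exists>\<tau>>0. \<forall>d\<in>S. \<forall>x. \<bar>x - d\<bar> \<le> 2 * \<tau> \<longrightarrow> g x \<ge> g d - \<delta>"
  using assms(1,2)
proof (induction S rule: finite_induct)
  case empty
  then show ?case by (intro exI[of _ 1]) simp
next
  case (insert d S)
  then obtain \<tau> where \<tau>: "\<tau> > 0" "\<forall>d\<in>S. \<forall>x. \<bar>x - d\<bar> \<le> 2 * \<tau> \<longrightarrow> g x \<ge> g d - \<delta>" by auto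
  have "(g \<longlongrightarrow> g d) (nhds d)"
    using insert.prems[of d] by (simp add: isCont_def tendsto_at_iff_tendsto_nhds)
  then have "\<forall>\<^sub>F x in nhds d. g x > g d - \<delta>" using \<open>\<delta> > 0\<close> by (intro order_tendstoD(1)) auto
  then obtain r where r: "r > 0" "\<And>x. dist x d < r \<Longrightarrow> g x > g d - \<delta>"
    unfolding eventually_nhds_metric by blast
  define \<rho> where "\<rho> = min \<tau> (r / 4)"
  have \<rho>: "\<rho> > 0" "\<rho> \<le> \<tau>" "2 * \<rho> < r" using \<tau>(1) r(1) by (auto simp: \<rho>_def)
  have "g x \<ge> g d' - \<delta>" if "d' \<in> insert d S" "\<bar>x - d'\<bar> \<le> 2 * \<rho>" for d' x
  proof (cases "d' = d")
    case True
    then have "dist x d < r" using that \<rho> by (simp add: dist_real_def)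
    then show ?thesis using r(2)[of x] True by simp
  next
    case False
    then have "d' \<in> S" "\<bar>x - d'\<bar> \<le> 2 * \<tau>" using that \<rho> by auto
    then show ?thesis using \<tau>(2) by blast
  qed
  with \<rho>(1) show ?case by blast
qed

lemma M2_bound:
  assumes "bdd_above ((\<lambda>s. \<bar>deriv (deriv \<phi>) s\<bar>) ` {\<mu>..})" "t \<ge> \<mu>" "s \<ge> t"
  shows "\<bar>deriv (deriv \<phi>) s\<bar> \<le> M2 \<phi> t"
  unfolding M2_def
  by (rule cSUP_upper) (use assms in \<open>auto intro: bdd_above_mono\<close>)

context qc_setting
begin

lemma sum_pair_shift:
  assumes "\<And>l. b (l + 2 * int N) = (b l :: real)" "\<And>l. q (l + 2 * int N) = (q l :: real)"
  shows "(\<Sum>l\<in>cell N. q l * (b (l - 1))\<^sup>2) = (\<Sum>l\<in>cell N. q (l + 1) * (b l)\<^sup>2)"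
proof -
  have "b (l + 2 * int N - 1) = b (l - 1)" for l
    using assms(1)[of "l - 1"] by (simp add: algebra_simps)
  then show ?thesis
    using sum_cell_shift[of "\<lambda>l. q l * (b (l - 1))\<^sup>2" 1] assms by simp
qed

text \<open>The square of a sum is at most twice the sum of the squares, and a periodic shift makes
  this 4Q in total. P + 4Q has the shape of \<open>C_H\<close>.\<close>

lemma quadratic_upper:
  assumes "\<And>l. b (l + 2 * int N) = (b l :: real)"
    and "\<And>l. \<bar>p l\<bar> \<le> P" "\<And>l. \<bar>q l\<bar> \<le> Q"
  shows "\<bar>\<Sum>l\<in>cell N. p l * (b l)\<^sup>2 + q l * (b (l - 1) + b l)\<^sup>2\<bar> \<le> (P + 4 * Q) * (\<Sum>l\<in>cell N. (b l)\<^sup>2)"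
proof -
  have "\<bar>\<Sum>l\<in>cell N. p l * (b l)\<^sup>2 + q l * (b (l - 1) + b l)\<^sup>2\<bar>
    \<le> (\<Sum>l\<in>cell N. \<bar>p l * (b l)\<^sup>2 + q l * (b (l - 1) + b l)\<^sup>2\<bar>)"
    by (rule sum_abs)
  also have "\<dots> \<le> (\<Sum>l\<in>cell N. P * (b l)\<^sup>2 + (2 * Q * (b (l - 1))\<^sup>2 + 2 * Q * (b l)\<^sup>2))"
  proof (rule sum_mono)
    fix l
    have "\<bar>p l * (b l)\<^sup>2\<bar> \<le> P * (b l)\<^sup>2"
      unfolding abs_mult using assms(2)[of l] by (intro mult_mono) auto
    moreover have "(b (l - 1) + b l)\<^sup>2 \<le> 2 * (b (l - 1))\<^sup>2 + 2 * (b l)\<^sup>2"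
      using sum_squares_bound[of "b (l - 1)" "b l"] by (simp add: power2_sum)
    then have "\<bar>q l * (b (l - 1) + b l)\<^sup>2\<bar> \<le> Q * (2 * (b (l - 1))\<^sup>2 + 2 * (b l)\<^sup>2)"
      unfolding abs_mult using assms(3)[of l] abs_ge_zero[of "q l"] by (intro mult_mono) auto
    ultimately show "\<bar>p l * (b l)\<^sup>2 + q l * (b (l - 1) + b l)\<^sup>2\<bar>
      \<le> P * (b l)\<^sup>2 + (2 * Q * (b (l - 1))\<^sup>2 + 2 * Q * (b l)\<^sup>2)"
      by (simp add: algebra_simps)
  qed
  also have "\<dots> = P * (\<Sum>l\<in>cell N. (b l)\<^sup>2) + ((\<Sum>l\<in>cell N. 2 * Q * (b (l - 1))\<^sup>2) + 2 * Q * (\<Sum>l\<in>cell N. (b l)\<^sup>2))"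
    by (simp only: sum.distrib sum_distrib_left)
  also have "(\<Sum>l\<in>cell N. 2 * Q * (b (l - 1))\<^sup>2) = (\<Sum>l\<in>cell N. 2 * Q * (b l)\<^sup>2)"
    by (rule sum_pair_shift[of b "\<lambda>_. 2 * Q"]) (simp_all add: assms(1))
  also have "P * (\<Sum>l\<in>cell N. (b l)\<^sup>2) + ((\<Sum>l\<in>cell N. 2 * Q * (b l)\<^sup>2) + 2 * Q * (\<Sum>l\<in>cell N. (b l)\<^sup>2))
    = (P + 4 * Q) * (\<Sum>l\<in>cell N. (b l)\<^sup>2)"
    unfolding sum_distrib_left[symmetric] by (simp add: algebra_simps)
  finally show ?thesis .
qed

text \<open>The second neighbour coefficients are negative up to \<open>\<delta>\<close>, so that
  \<open>(x + y)\<^sup>2 \<le> 2 x\<^sup>2 + 2 y\<^sup>2\<close> bounds the quadratic form from below.\<close>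

lemma quadratic_lower:
  assumes b: "\<And>l. b (l + 2 * int N) = (b l :: real)" and q: "\<And>l. q (l + 2 * int N) = (q l :: real)"
    and q0: "\<And>l. q l \<le> 0" and \<delta>: "\<delta> \<ge> 0"
    and p': "\<And>l. p' l \<ge> p l - \<delta>" and q': "\<And>l. q' l \<ge> q l - \<delta>"
    and A: "\<And>l. l \<in> cell N \<Longrightarrow> p l + 2 * q l + 2 * q (l + 1) \<ge> a"
  shows "(\<Sum>l\<in>cell N. p' l * (b l)\<^sup>2 + q' l * (b (l - 1) + b l)\<^sup>2) \<ge> (a - 5 * \<delta>) * (\<Sum>l\<in>cell N. (b l)\<^sup>2)"
proof -
  \<comment> \<open>The loss of 5 \<delta> is one \<delta> from p and two from each of the two
    second neighbour coefficients.\<close>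
  have "(a - 5 * \<delta>) * (\<Sum>l\<in>cell N. (b l)\<^sup>2)
    \<le> (\<Sum>l\<in>cell N. (p l - \<delta> + 2 * (q l - \<delta>) + 2 * (q (l + 1) - \<delta>)) * (b l)\<^sup>2)"
    unfolding sum_distrib_left
  proof (rule sum_mono)
    fix l assume "l \<in> cell N"
    from A[OF this] show "(a - 5 * \<delta>) * (b l)\<^sup>2 \<le> (p l - \<delta> + 2 * (q l - \<delta>) + 2 * (q (l + 1) - \<delta>)) * (b l)\<^sup>2"
      by (intro mult_right_mono) auto
  qed
  also have "\<dots> = (\<Sum>l\<in>cell N. (p l - \<delta>) * (b l)\<^sup>2) + (\<Sum>l\<in>cell N. 2 * (q l - \<delta>) * (b l)\<^sup>2)
      + (\<Sum>l\<in>cell N. 2 * (q (l + 1) - \<delta>) * (b l)\<^sup>2)"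
    by (simp only: sum.distrib distrib_right)
  also have "(\<Sum>l\<in>cell N. 2 * (q (l + 1) - \<delta>) * (b l)\<^sup>2) = (\<Sum>l\<in>cell N. 2 * (q l - \<delta>) * (b (l - 1))\<^sup>2)"
    by (rule sum_pair_shift[of b "\<lambda>l. 2 * (q l - \<delta>)", symmetric]) (simp_all add: b q)
  also have "(\<Sum>l\<in>cell N. (p l - \<delta>) * (b l)\<^sup>2) + (\<Sum>l\<in>cell N. 2 * (q l - \<delta>) * (b l)\<^sup>2)
      + (\<Sum>l\<in>cell N. 2 * (q l - \<delta>) * (b (l - 1))\<^sup>2)
    = (\<Sum>l\<in>cell N. (p l - \<delta>) * (b l)\<^sup>2 + (2 * (b (l - 1))\<^sup>2 + 2 * (b l)\<^sup>2) * (q l - \<delta>))"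
    unfolding sum.distrib[symmetric] by (rule sum.cong) (simp_all add: algebra_simps)
  also have "\<dots> \<le> (\<Sum>l\<in>cell N. p' l * (b l)\<^sup>2 + q' l * (b (l - 1) + b l)\<^sup>2)"
  proof (rule sum_mono)
    fix l
    have "(b (l - 1) + b l)\<^sup>2 \<le> 2 * (b (l - 1))\<^sup>2 + 2 * (b l)\<^sup>2"
      using sum_squares_bound[of "b (l - 1)" "b l"] by (simp add: power2_sum)
    then have "(2 * (b (l - 1))\<^sup>2 + 2 * (b l)\<^sup>2) * (q l - \<delta>) \<le> (b (l - 1) + b l)\<^sup>2 * (q l - \<delta>)"
      using q0[of l] \<delta> by (intro mult_right_mono_neg) auto
    also have "\<dots> \<le> (b (l - 1) + b l)\<^sup>2 * q' l"
      using q'[of l] by (intro mult_left_mono) auto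
    finally have "(2 * (b (l - 1))\<^sup>2 + 2 * (b l)\<^sup>2) * (q l - \<delta>) \<le> q' l * (b (l - 1) + b l)\<^sup>2"
      by (simp only: mult.commute)
    moreover have "(p l - \<delta>) * (b l)\<^sup>2 \<le> p' l * (b l)\<^sup>2"
      using p'[of l] by (intro mult_right_mono) auto
    ultimately show "(p l - \<delta>) * (b l)\<^sup>2 + (2 * (b (l - 1))\<^sup>2 + 2 * (b l)\<^sup>2) * (q l - \<delta>)
      \<le> p' l * (b l)\<^sup>2 + q' l * (b (l - 1) + b l)\<^sup>2" by linarith
  qed
  finally show ?thesis .
qed

section \<open>First and second variation of the atomistic energy\<close>

lemma ldiff_add_cmult: "ldiff N (\<lambda>l. y l + s * e l) l = ldiff N y l + s * ldiff N e l"
  by (simp add: ldiff_def algebra_simps diff_divide_distrib add_divide_distrib)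

lemma ip_eps_add_cmult: "ip_eps N f (\<lambda>l. u l + s * e l) = ip_eps N f u + s * ip_eps N f e"
  by (simp add: ip_eps_def algebra_simps sum.distrib sum_distrib_left)

definition D_E_a :: "(real \<Rightarrow> real) \<Rightarrow> (real \<Rightarrow> real) \<Rightarrow> (int \<Rightarrow> real) \<Rightarrow> (int \<Rightarrow> real) \<Rightarrow> real" where
  "D_E_a \<phi>1 f y e = eps N * (\<Sum>l\<in>cell N. \<phi>1 (ldiff N y l) * ldiff N e l
      + \<phi>1 (ldiff N y (l - 1) + ldiff N y l) * (ldiff N e (l - 1) + ldiff N e l)) - ip_eps N f e"

definition D2_E_a :: "(real \<Rightarrow> real) \<Rightarrow> (int \<Rightarrow> real) \<Rightarrow> (int \<Rightarrow> real) \<Rightarrow> real" where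
  "D2_E_a \<phi>2 y e = eps N * (\<Sum>l\<in>cell N. \<phi>2 (ldiff N y l) * (ldiff N e l)\<^sup>2
      + \<phi>2 (ldiff N y (l - 1) + ldiff N y l) * (ldiff N e (l - 1) + ldiff N e l)\<^sup>2)"

lemma E_a_has_derivative:
  assumes \<phi>: "\<And>s. s > 0 \<Longrightarrow> (\<phi> has_real_derivative \<phi>1 s) (at s)"
    and pos: "\<And>l. ldiff N y l + s * ldiff N e l > 0"
  shows "((\<lambda>s. E_a N F \<phi> f (\<lambda>l. y l + s * e l)) has_real_derivative D_E_a \<phi>1 f (\<lambda>l. y l + s * e l) e) (at s)"
proof -
  have u: "ip_eps N f (\<lambda>l. y l + s * e l - F * lat N l) = ip_eps N f (\<lambda>l. y l - F * lat N l) + s * ip_eps N f e" for s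
    unfolding ip_eps_add_cmult[symmetric] by (simp add: algebra_simps)
  have "((\<lambda>s. \<phi> (ldiff N y l + s * ldiff N e l)
        + \<phi> (ldiff N y (l - 1) + s * ldiff N e (l - 1) + (ldiff N y l + s * ldiff N e l)))
      has_real_derivative (\<phi>1 (ldiff N y l + s * ldiff N e l) * ldiff N e l
        + \<phi>1 (ldiff N y (l - 1) + s * ldiff N e (l - 1) + (ldiff N y l + s * ldiff N e l))
          * (ldiff N e (l - 1) + ldiff N e l))) (at s)" for l
    using \<phi>[OF pos[of l]] \<phi>[OF add_pos_pos[OF pos[of "l - 1"] pos[of l]]]
    by (intro DERIV_add DERIV_chain2[of \<phi>]) (auto intro!: derivative_eq_intros)
  then have "((\<lambda>s. eps N * (\<Sum>l\<in>cell N. \<phi> (ldiff N y l + s * ldiff N e l)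
        + \<phi> (ldiff N y (l - 1) + s * ldiff N e (l - 1) + (ldiff N y l + s * ldiff N e l)))
        - (ip_eps N f (\<lambda>l. y l - F * lat N l) + s * ip_eps N f e))
      has_real_derivative D_E_a \<phi>1 f (\<lambda>l. y l + s * e l) e) (at s)"
    unfolding D_E_a_def ldiff_add_cmult
    by (intro DERIV_diff DERIV_cmult DERIV_sum) (auto intro!: derivative_eq_intros)
  then show ?thesis unfolding E_a_def E_a_int_def ldiff_add_cmult u .
qed

lemma D_E_a_has_derivative:
  assumes \<phi>: "\<And>s. s > 0 \<Longrightarrow> (\<phi>1 has_real_derivative \<phi>2 s) (at s)"
    and pos: "\<And>l. ldiff N y l + s * ldiff N e l > 0"
  shows "((\<lambda>s. D_E_a \<phi>1 f (\<lambda>l. y l + s * e l) e) has_real_derivative D2_E_a \<phi>2 (\<lambda>l. y l + s * e l) e) (at s)"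
proof -
  have "((\<lambda>s. \<phi>1 (ldiff N y l + s * ldiff N e l) * ldiff N e l
        + \<phi>1 (ldiff N y (l - 1) + s * ldiff N e (l - 1) + (ldiff N y l + s * ldiff N e l))
          * (ldiff N e (l - 1) + ldiff N e l))
      has_real_derivative (\<phi>2 (ldiff N y l + s * ldiff N e l) * (ldiff N e l)\<^sup>2
        + \<phi>2 (ldiff N y (l - 1) + s * ldiff N e (l - 1) + (ldiff N y l + s * ldiff N e l))
          * (ldiff N e (l - 1) + ldiff N e l)\<^sup>2)) (at s)" for l
  proof -
    have "((\<lambda>s. \<phi>1 (ldiff N y l + s * ldiff N e l)) has_real_derivative
        \<phi>2 (ldiff N y l + s * ldiff N e l) * ldiff N e l) (at s)"
      using \<phi>[OF pos[of l]] by (intro DERIV_chain2[of \<phi>1]) (auto intro!: derivative_eq_intros)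
    moreover have "((\<lambda>s. \<phi>1 (ldiff N y (l - 1) + s * ldiff N e (l - 1) + (ldiff N y l + s * ldiff N e l)))
        has_real_derivative \<phi>2 (ldiff N y (l - 1) + s * ldiff N e (l - 1) + (ldiff N y l + s * ldiff N e l))
          * (ldiff N e (l - 1) + ldiff N e l)) (at s)"
      using \<phi>[OF add_pos_pos[OF pos[of "l - 1"] pos[of l]]]
      by (intro DERIV_chain2[of \<phi>1]) (auto intro!: derivative_eq_intros)
    ultimately show ?thesis
      unfolding power2_eq_square mult.assoc[symmetric]
      by (intro DERIV_add DERIV_cmult_right)
  qed
  then have "((\<lambda>s. eps N * (\<Sum>l\<in>cell N. \<phi>1 (ldiff N y l + s * ldiff N e l) * ldiff N e l
        + \<phi>1 (ldiff N y (l - 1) + s * ldiff N e (l - 1) + (ldiff N y l + s * ldiff N e l))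
          * (ldiff N e (l - 1) + ldiff N e l)) - ip_eps N f e)
      has_real_derivative D2_E_a \<phi>2 (\<lambda>l. y l + s * e l) e - 0) (at s)"
    unfolding D2_E_a_def ldiff_add_cmult
    by (intro DERIV_diff DERIV_cmult DERIV_sum DERIV_const)
  then show ?thesis unfolding D_E_a_def ldiff_add_cmult by simp
qed

lemma atomistic_critical:
  assumes min: "local_minimizer (E_a N F \<phi> f) (Y_eps_pos N F) y"
    and e: "\<And>l. e (l + 2 * int N) = e l" "e 0 = 0"
    and \<phi>: "\<And>s. s > 0 \<Longrightarrow> (\<phi> has_real_derivative \<phi>1 s) (at s)"
  shows "D_E_a \<phi>1 f y e = 0"
proof -
  have y: "y 0 = 0" "\<And>l. y (l + 2 * int N) = y l + F" "\<And>l. ldiff N y l > 0"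
    using min by (auto simp: local_minimizer_def Y_eps_pos_def Y_eps_def)
  have yp: "ldiff N y (l + 2 * int N) = ldiff N y l" for l by (rule ldiff_per) (rule y(2))
  have ep: "ldiff N e (l + 2 * int N) = ldiff N e l" for l
    by (rule ldiff_per[of e 0]) (simp add: e)
  obtain \<delta> where \<delta>: "\<delta> > 0" "\<And>z. z \<in> Y_eps_pos N F \<Longrightarrow> \<forall>l. \<bar>z l - y l\<bar> < \<delta> \<Longrightarrow>
      E_a N F \<phi> f y \<le> E_a N F \<phi> f z"
    using min by (auto simp: local_minimizer_def)
  have "\<forall>\<^sub>F s in nhds 0. \<forall>l\<in>cell N. ldiff N y l + s * ldiff N e l > 0 \<and> \<bar>s * e l\<bar> < \<delta>"
  proof (rule eventually_ball_finite)
    show "\<forall>l\<in>cell N. \<forall>\<^sub>F s in nhds 0. ldiff N y l + s * ldiff N e l > 0 \<and> \<bar>s * e l\<bar> < \<delta>"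
    proof (intro ballI eventually_conj)
      fix l
      have "((\<lambda>s. ldiff N y l + s * ldiff N e l) \<longlongrightarrow> ldiff N y l + 0 * ldiff N e l) (nhds 0)"
        by (intro tendsto_intros filterlim_ident)
      then show "\<forall>\<^sub>F s in nhds 0. ldiff N y l + s * ldiff N e l > 0"
        using y(3)[of l] by (intro order_tendstoD(1)) auto
      have "((\<lambda>s. \<bar>s * e l\<bar>) \<longlongrightarrow> \<bar>0 * e l\<bar>) (nhds 0)"
        by (intro tendsto_intros filterlim_ident)
      then show "\<forall>\<^sub>F s in nhds 0. \<bar>s * e l\<bar> < \<delta>"
        using \<delta>(1) by (intro order_tendstoD(2)) auto
    qed
  qed (simp add: cell_def)
  then have "\<forall>\<^sub>F s in nhds 0. E_a N F \<phi> f (\<lambda>l. y l + 0 * e l) \<le> E_a N F \<phi> f (\<lambda>l. y l + s * e l)"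
  proof eventually_elim
    case (elim s)
    have *: "ldiff N y l + s * ldiff N e l > 0 \<and> \<bar>s * e l\<bar> < \<delta>" for l
    proof -
      obtain l' m where l: "l = l' + int (2 * N) * m" "l' \<in> cell N" by (rule reduce_cell)
      have "ldiff N y l = ldiff N y l'" "ldiff N e l = ldiff N e l'" "e l = e l'"
        unfolding l(1) by (rule lattice.per_mult; simp add: yp ep e)+
      then show ?thesis using elim l(2) by simp
    qed
    then have "(\<lambda>l. y l + s * e l) \<in> Y_eps_pos N F"
      using y e by (simp add: Y_eps_pos_def Y_eps_def ldiff_add_cmult)
    then show ?case using \<delta>(2)[of "\<lambda>l. y l + s * e l"] * by simp
  qed
  then obtain d where "d > 0" "\<And>s. dist s 0 < d \<Longrightarrow>
      E_a N F \<phi> f (\<lambda>l. y l + 0 * e l) \<le> E_a N F \<phi> f (\<lambda>l. y l + s * e l)"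
    unfolding eventually_nhds_metric by blast
  moreover have "((\<lambda>s. E_a N F \<phi> f (\<lambda>l. y l + s * e l))
      has_real_derivative D_E_a \<phi>1 f (\<lambda>l. y l + 0 * e l) e) (at 0)"
    by (rule E_a_has_derivative[OF \<phi>]) (use y(3) in simp_all)
  ultimately have "D_E_a \<phi>1 f (\<lambda>l. y l + 0 * e l) e = 0"
    by (intro DERIV_local_min[of _ _ 0 d]) (auto simp: dist_real_def)
  then show ?thesis by simp
qed

lemma integral_deriv_sq:
  "integral {-1/2..1/2} (\<lambda>t. (deriv (pw_interp (lat N) e) t)\<^sup>2) = eps N * (\<Sum>l\<in>cell N. (ldiff N e l)\<^sup>2)"
proof -
  have P1: "pw_interp (lat N) e \<in> P1 (lat N)" by (rule lattice.pw_interp_P1)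
  have "integral {-1/2..1/2} (\<lambda>t. (deriv (pw_interp (lat N) e) t)\<^sup>2)
    = (\<Sum>l\<in>cell N. integral {lat N (l - 1)..lat N l} (\<lambda>t. (deriv (pw_interp (lat N) e) t)\<^sup>2))"
    by (intro integral_lattice_sum pwc_intros lattice.pwc_P1_deriv P1)
  also have "\<dots> = (\<Sum>l\<in>cell N. eps N * (ldiff N e l)\<^sup>2)"
  proof (rule sum.cong[OF refl])
    fix l
    have "integral {lat N (l - 1)..lat N l} (\<lambda>t. (deriv (pw_interp (lat N) e) t)\<^sup>2)
      = hk (lat N) l * (ldiff N e l)\<^sup>2"
      by (rule lattice.integral_elem_const)
        (simp add: lattice.P1_deriv[OF P1] lattice.slope_def ldiff_def)
    then show "integral {lat N (l - 1)..lat N l} (\<lambda>t. (deriv (pw_interp (lat N) e) t)\<^sup>2) = eps N * (ldiff N e l)\<^sup>2"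
      by simp
  qed
  finally show ?thesis by (simp only: sum_distrib_left)
qed

text \<open>The gradient of y need not be constant on a lattice cell, but its cell average is the
  lattice difference of \<open>nodal N y\<close>, and the almost everywhere bound passes to
  averages.\<close>

lemma ldiff_dist:
  assumes y: "y \<in> P1 X" "\<And>t. y (t + 1) = y t + F" and ya: "\<And>l. ya (l + 2 * int N) = ya l + F"
    and ae: "AE t in lborel. t \<in> Om \<longrightarrow> \<bar>deriv (pw_interp (lat N) ya) t - deriv y t\<bar> \<le> \<tau>"
  shows "\<bar>ldiff N ya l - ldiff N (nodal N y) l\<bar> \<le> \<tau>"
proof -
  define v where "v = pw_interp (lat N) ya"
  have v: "v \<in> P1 (lat N)" unfolding v_def by (rule lattice.pw_interp_P1)
  have cell: "\<bar>ldiff N ya l - ldiff N (nodal N y) l\<bar> \<le> \<tau>" if l: "l \<in> cell N" for l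
  proof -
    let ?I = "{lat N (l - 1)..lat N l}"
    let ?g = "\<lambda>t. deriv v t - deriv y t"
    have lt: "lat N (l - 1) < lat N l" by simp
    have "lat N (- int N) \<le> lat N (l - 1)" "lat N l \<le> lat N (int N)"
      using l by (auto simp: cell_def simp del: lat_N)
    then have sub: "?I \<subseteq> Om" by (auto simp: Om_def lat_N)
    have pg: "pwc ?g" by (intro pwc_intros lattice.pwc_P1_deriv[OF v] mesh.pwc_P1_deriv[OF y(1)])
    obtain M where M: "M \<in> null_sets lborel" "\<And>t. t \<notin> M \<Longrightarrow> t \<in> Om \<Longrightarrow> \<bar>?g t\<bar> \<le> \<tau>"
      using ae unfolding v_def by (auto elim!: AE_E3)
    have neg: "negligible M"
      using M(1) by (simp add: negligible_iff_null_sets null_sets_completionI)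
    \<comment> \<open>On the null set, where the bound may fail, the integrand is set to 0.\<close>
    define g' where "g' t = (if t \<in> M then 0 else ?g t)" for t
    have eq: "integral ?I g' = integral ?I ?g"
      by (rule integral_spike[OF neg]) (simp add: g'_def)
    have int: "g' integrable_on ?I"
      by (rule integrable_spike[OF pwc_integrable[OF pg] neg]) (simp add: g'_def)
    \<comment> \<open>A negative \<tau> would put a whole cell into the null set.\<close>
    have \<tau>0: "\<tau> \<ge> 0"
    proof (rule ccontr)
      assume "\<not> \<tau> \<ge> 0"
      then have "?I \<subseteq> M" using M(2) sub by force
      then have "negligible ?I" using neg negligible_subset by blast
      then show False using lt negligible_interval(1)[of "lat N (l - 1)" "lat N l"] by simp
    qed
    have "norm (integral ?I g') \<le> integral ?I (\<lambda>_. \<tau>)"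
      using M(2) sub \<tau>0 by (intro integral_norm_bound_integral int) (auto simp: g'_def)
    then have "\<bar>integral ?I ?g\<bar> \<le> eps N * \<tau>"
      using lt hk_lat[of l] by (simp add: eq hk_def)
    moreover have "integral ?I ?g = (v (lat N l) - v (lat N (l - 1))) - (y (lat N l) - y (lat N (l - 1)))"
      using lattice.P1_ftc[OF v, of "lat N (l - 1)" "lat N l"] mesh.P1_ftc[OF y(1), of "lat N (l - 1)" "lat N l"] lt
      by (simp add: integral_pwc_diff lattice.pwc_P1_deriv[OF v] mesh.pwc_P1_deriv[OF y(1)])
    moreover have "\<dots> = eps N * (ldiff N ya l - ldiff N (nodal N y) l)"
      using eps_pos by (simp add: ldiff_def nodal_def v_def field_simps)
    ultimately have "eps N * \<bar>ldiff N ya l - ldiff N (nodal N y) l\<bar> \<le> eps N * \<tau>"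
      using eps_pos by (simp add: abs_mult)
    then show ?thesis using eps_pos by simp
  qed
  obtain l' m where l: "l = l' + int (2 * N) * m" "l' \<in> cell N" by (rule reduce_cell)
  have "ldiff N ya (k + 2 * int N) = ldiff N ya k" for k by (rule ldiff_per) (rule ya)
  then have 1: "ldiff N ya l = ldiff N ya l'"
    unfolding l(1) by (intro lattice.per_mult) simp
  have "ldiff N (nodal N y) (k + 2 * int N) = ldiff N (nodal N y) k" for k
    by (rule ldiff_per) (rule nodal_per, rule y(2))
  then have 2: "ldiff N (nodal N y) l = ldiff N (nodal N y) l'"
    unfolding l(1) by (intro lattice.per_mult) simp
  show ?thesis unfolding 1 2 by (rule cell[OF l(2)])
qed

end

section \<open>The atomistic energy at the lattice values of the quasicontinuum solution\<close>

context qc_force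
begin

text \<open>Criticality of y can be tested with the mesh interpolant w, which is admissible because
  0 is a node and e vanishes there.\<close>

lemma residual_le:
  assumes d1: "\<And>s. s > 0 \<Longrightarrow> (\<phi> has_real_derivative deriv \<phi> s) (at s)"
    and min: "local_minimizer (E_qc N F La Ra X \<phi> f) (Y_h_pos F X) y"
    and e: "\<And>l. e (l + 2 * int N) = e l" "e 0 = 0" and \<alpha>: "\<alpha> > 0"
  shows "D_E_a (deriv \<phi>) f (nodal N y) e
    \<le> \<alpha> / 2 * ((eta N La Ra K X \<phi> y)\<^sup>2 + (eta_f N La Ra K X f)\<^sup>2 + (eta_q N La Ra K X f)\<^sup>2)
      + 3 / \<alpha> * (eps N * (\<Sum>l\<in>cell N. (ldiff N e l)\<^sup>2))"
proof -
  define v where "v = pw_interp (lat N) e"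
  define w where "w = pw_interp X (\<lambda>k. v (X k))"
  have yY: "y \<in> Y_h F X" and yP: "y \<in> P1 X"
    using min by (auto simp: local_minimizer_def Y_h_pos_def Y_h_def)
  have v: "v \<in> P1 (lat N)" unfolding v_def by (rule lattice.pw_interp_P1)
  have vper: "v (t + 1) = v t" for t
    using lattice.pw_interp_per[of e 0 t] e by (simp add: v_def)
  have node: "nodal N v = e" by (auto simp: nodal_def v_def)
  have v0: "v 0 = 0" using fun_cong[OF node, of 0] e(2) by (simp add: nodal_def lat_def)
  have w: "w \<in> P1 X" unfolding w_def by (rule mesh.pw_interp_P1)
  have wper: "w (t + 1) = w t" for t
    using mesh.pw_interp_per[of "\<lambda>k. v (X k)" 0 t] by (simp add: w_def mesh.X_per vper)
  have agree: "v t = w t" if "t \<in> range X" for t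
    using that by (auto simp: w_def)
  have "0 \<in> range X" using qc_mesh by (simp add: qc_mesh_def)
  then have wU: "w \<in> U_h X" using w wper agree[of 0] v0 by (simp add: U_h_def)
  have internal: "D_E_a (deriv \<phi>) f (nodal N y) e
    = (\<Sum>b\<in>bonds N. integral {bl b..br b} (\<lambda>t. bond_defect (deriv \<phi>) y b t * deriv v t))
      - (ip_eps N f (nodal N v) - ip_h X f w)"
    using internal_residual[of y F v w "deriv \<phi>", OF yP Y_h_per[OF yY] v vper agree]
      qc_critical[OF f_cont min wU d1]
    unfolding D_E_a_def node by linarith
  have "- (ip_eps N f (nodal N v) - ip_h X f w)
    \<le> \<alpha> / 2 * ((eta_f N La Ra K X f)\<^sup>2 + (eta_q N La Ra K X f)\<^sup>2)
      + 5 / (2 * \<alpha>) * integral {-1/2..1/2} (\<lambda>t. (deriv v t)\<^sup>2)"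
    using force_residual_le[OF v vper v0 w wper agree \<alpha>] by linarith
  then have "D_E_a (deriv \<phi>) f (nodal N y) e
    \<le> (\<alpha> / 2 * (eta N La Ra K X \<phi> y)\<^sup>2 + integral {-1/2..1/2} (\<lambda>t. (deriv v t)\<^sup>2) / (2 * \<alpha>))
      + (\<alpha> / 2 * ((eta_f N La Ra K X f)\<^sup>2 + (eta_q N La Ra K X f)\<^sup>2)
      + 5 / (2 * \<alpha>) * integral {-1/2..1/2} (\<lambda>t. (deriv v t)\<^sup>2))"
    unfolding internal using internal_residual_le[OF yP v vper \<alpha>, of \<phi>] by linarith
  \<comment> \<open>The coefficient 3/\<alpha> adds 1/(2\<alpha>) from the bonds and 5/(2\<alpha>)
    from the forces.\<close>
  also have "\<dots> = \<alpha> / 2 * ((eta N La Ra K X \<phi> y)\<^sup>2 + (eta_f N La Ra K X f)\<^sup>2 + (eta_q N La Ra K X f)\<^sup>2)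
      + 3 / \<alpha> * integral {-1/2..1/2} (\<lambda>t. (deriv v t)\<^sup>2)"
    using \<alpha> by (simp add: field_simps)
  finally show ?thesis unfolding v_def integral_deriv_sq .
qed

text \<open>The slack of one fortieth of the stability constant is multiplied by 5 in
  \<open>quadratic_lower\<close>, which leaves seven eighths of it.\<close>

lemma atomistic_error:
  assumes d1: "\<And>s. s > 0 \<Longrightarrow> (\<phi> has_real_derivative deriv \<phi> s) (at s)"
    and d2: "\<And>s. s > 0 \<Longrightarrow> (deriv \<phi> has_real_derivative deriv (deriv \<phi>) s) (at s)"
    and min: "local_minimizer (E_qc N F La Ra X \<phi> f) (Y_h_pos F X) y"
    and ya: "local_minimizer (E_a N F \<phi> f) (Y_eps_pos N F) ya"
    and \<mu>: "\<mu> > 0" "\<And>l. ldiff N ya l \<ge> \<mu>" "\<And>l. ldiff N (nodal N y) l \<ge> \<mu>"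
    and bdd: "bdd_above ((\<lambda>s. \<bar>deriv (deriv \<phi>) s\<bar>) ` {\<mu>..})"
    and A: "A_star N \<phi> (nodal N y) > 0"
    and second: "\<And>l. deriv (deriv \<phi>) (ldiff N (nodal N y) (l - 1) + ldiff N (nodal N y) l) \<le> 0"
    and close: "\<And>l. \<bar>ldiff N ya l - ldiff N (nodal N y) l\<bar> \<le> \<tau>"
    and lower1: "\<And>l x. \<bar>x - ldiff N (nodal N y) l\<bar> \<le> 2 * \<tau> \<Longrightarrow>
      deriv (deriv \<phi>) x \<ge> deriv (deriv \<phi>) (ldiff N (nodal N y) l) - A_star N \<phi> (nodal N y) / 40"
    and lower2: "\<And>l x. \<bar>x - (ldiff N (nodal N y) (l - 1) + ldiff N (nodal N y) l)\<bar> \<le> 2 * \<tau> \<Longrightarrow>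
      deriv (deriv \<phi>) x \<ge> deriv (deriv \<phi>) (ldiff N (nodal N y) (l - 1) + ldiff N (nodal N y) l)
        - A_star N \<phi> (nodal N y) / 40"
  shows "\<bar>E_a N F \<phi> f ya - E_a N F \<phi> f (nodal N y)\<bar>
      \<le> 4 * C_H \<phi> \<mu> / (A_star N \<phi> (nodal N y))\<^sup>2
         * ((eta N La Ra K X \<phi> y)\<^sup>2 + (eta_f N La Ra K X f)\<^sup>2 + (eta_q N La Ra K X f)\<^sup>2)"
proof -
  define Y where "Y = nodal N y"
  define e where "e l = Y l - ya l" for l
  define z where "z s l = ya l + s * e l" for s l
  define A where "A = A_star N \<phi> Y"
  define V where "V = eps N * (\<Sum>l\<in>cell N. (ldiff N e l)\<^sup>2)"
  define S where "S = (eta N La Ra K X \<phi> y)\<^sup>2 + (eta_f N La Ra K X f)\<^sup>2 + (eta_q N La Ra K X f)\<^sup>2"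
  let ?\<phi>2 = "deriv (deriv \<phi>)"
  have A0: "A > 0" using A by (simp add: A_def Y_def)
  have yY: "y \<in> Y_h F X" using min by (simp add: local_minimizer_def Y_h_pos_def)
  have Yper: "Y (l + 2 * int N) = Y l + F" for l
    unfolding Y_def by (rule nodal_per) (rule Y_h_per[OF yY])
  have Y0: "Y 0 = 0" using yY by (simp add: Y_def nodal_def lat_def Y_h_def U_h_def)
  have yaper: "ya (l + 2 * int N) = ya l + F" and ya0: "ya 0 = 0" for l
    using ya by (auto simp: local_minimizer_def Y_eps_pos_def Y_eps_def)
  have e: "e (l + 2 * int N) = e l" "e 0 = 0" for l
    by (simp_all add: e_def Yper yaper Y0 ya0)
  have eper: "ldiff N e (l + 2 * int N) = ldiff N e l" for l
    by (rule ldiff_per[of e 0]) (simp add: e)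
  have dper: "ldiff N Y (l + 2 * int N) = ldiff N Y l" for l
    by (rule ldiff_per) (rule Yper)
  have le: "ldiff N e l = ldiff N Y l - ldiff N ya l" for l
    by (simp add: ldiff_def e_def diff_divide_distrib)
  have z_ldiff: "ldiff N (z s) l = ldiff N ya l + s * ldiff N e l" for s l
    unfolding z_def by (rule ldiff_add_cmult)
  have z_conv: "ldiff N (z s) l = (1 - s) * ldiff N ya l + s * ldiff N Y l" for s l
    unfolding z_ldiff le by (simp add: algebra_simps)
  have z_\<mu>: "ldiff N (z s) l \<ge> \<mu>" if "0 \<le> s" "s \<le> 1" for s l
  proof -
    have "(1 - s) * \<mu> + s * \<mu> \<le> (1 - s) * ldiff N ya l + s * ldiff N Y l"
      using that \<mu>(2)[of l] \<mu>(3)[of l] unfolding Y_def by (intro add_mono mult_left_mono) auto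
    then show ?thesis unfolding z_conv by (simp add: algebra_simps)
  qed
  have z_close: "\<bar>ldiff N (z s) l - ldiff N Y l\<bar> \<le> \<tau>" if "0 \<le> s" "s \<le> 1" for s l
  proof -
    have "ldiff N (z s) l - ldiff N Y l = (1 - s) * (ldiff N ya l - ldiff N Y l)"
      unfolding z_conv by (simp add: algebra_simps)
    also have "\<bar>\<dots>\<bar> \<le> 1 * \<tau>"
      unfolding abs_mult using that close[of l] by (intro mult_mono) (auto simp: Y_def)
    finally show ?thesis by simp
  qed
  have V0: "V \<ge> 0" unfolding V_def using eps_pos by (intro mult_nonneg_nonneg sum_nonneg) auto
  have upper: "\<bar>D2_E_a ?\<phi>2 (z s) e\<bar> \<le> C_H \<phi> \<mu> * V" if s: "0 \<le> s" "s \<le> 1" for s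
  proof -
    have "\<bar>?\<phi>2 (ldiff N (z s) l)\<bar> \<le> M2 \<phi> \<mu>" for l
      by (rule M2_bound[OF bdd]) (use z_\<mu>[OF s] in auto)
    moreover have "\<bar>?\<phi>2 (ldiff N (z s) (l - 1) + ldiff N (z s) l)\<bar> \<le> M2 \<phi> (2 * \<mu>)" for l
      using z_\<mu>[OF s, of l] z_\<mu>[OF s, of "l - 1"] \<mu>(1) by (intro M2_bound[OF bdd]) auto
    ultimately have "\<bar>\<Sum>l\<in>cell N. ?\<phi>2 (ldiff N (z s) l) * (ldiff N e l)\<^sup>2
        + ?\<phi>2 (ldiff N (z s) (l - 1) + ldiff N (z s) l) * (ldiff N e (l - 1) + ldiff N e l)\<^sup>2\<bar>
      \<le> C_H \<phi> \<mu> * (\<Sum>l\<in>cell N. (ldiff N e l)\<^sup>2)"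
      unfolding C_H_def by (intro quadratic_upper eper)
    then have "eps N * \<bar>\<Sum>l\<in>cell N. ?\<phi>2 (ldiff N (z s) l) * (ldiff N e l)\<^sup>2
        + ?\<phi>2 (ldiff N (z s) (l - 1) + ldiff N (z s) l) * (ldiff N e (l - 1) + ldiff N e l)\<^sup>2\<bar>
      \<le> eps N * (C_H \<phi> \<mu> * (\<Sum>l\<in>cell N. (ldiff N e l)\<^sup>2))"
      using eps_pos by (intro mult_left_mono) auto
    then show ?thesis
      unfolding D2_E_a_def V_def abs_mult using eps_pos by (simp add: mult.left_commute)
  qed
  have lower: "7 / 8 * A * V \<le> D2_E_a ?\<phi>2 (z s) e" if s: "0 \<le> s" "s \<le> 1" for s
  proof -
    have "(A - 5 * (A / 40)) * (\<Sum>l\<in>cell N. (ldiff N e l)\<^sup>2)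
      \<le> (\<Sum>l\<in>cell N. ?\<phi>2 (ldiff N (z s) l) * (ldiff N e l)\<^sup>2
        + ?\<phi>2 (ldiff N (z s) (l - 1) + ldiff N (z s) l) * (ldiff N e (l - 1) + ldiff N e l)\<^sup>2)"
    proof (rule quadratic_lower[where p = "\<lambda>l. ?\<phi>2 (ldiff N Y l)"
          and q = "\<lambda>l. ?\<phi>2 (ldiff N Y (l - 1) + ldiff N Y l)"])
      fix l
      show "ldiff N e (l + 2 * int N) = ldiff N e l" by (rule eper)
      have "ldiff N Y (l + 2 * int N - 1) = ldiff N Y (l - 1)"
        using dper[of "l - 1"] by (simp add: algebra_simps)
      then show "?\<phi>2 (ldiff N Y (l + 2 * int N - 1) + ldiff N Y (l + 2 * int N))
          = ?\<phi>2 (ldiff N Y (l - 1) + ldiff N Y l)"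
        by (simp add: dper)
      show "?\<phi>2 (ldiff N Y (l - 1) + ldiff N Y l) \<le> 0"
        unfolding Y_def by (rule second)
      show "0 \<le> A / 40" using A0 by simp
      have c: "\<bar>ldiff N (z s) l - ldiff N Y l\<bar> \<le> \<tau>" "\<bar>ldiff N (z s) (l - 1) - ldiff N Y (l - 1)\<bar> \<le> \<tau>"
        by (rule z_close[OF s])+
      \<comment> \<open>The closeness bound forces \<tau> to be nonnegative, so \<tau> is within the
        radius 2\<tau> that the lower bound asks for.\<close>
      then have "\<tau> \<ge> 0" by linarith
      with c show "?\<phi>2 (ldiff N Y l) - A / 40 \<le> ?\<phi>2 (ldiff N (z s) l)"
        unfolding A_def Y_def by (intro lower1) linarith
      show "?\<phi>2 (ldiff N Y (l - 1) + ldiff N Y l) - A / 40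
          \<le> ?\<phi>2 (ldiff N (z s) (l - 1) + ldiff N (z s) l)"
        using c unfolding A_def Y_def by (intro lower2) linarith
      assume "l \<in> cell N"
      then have "A \<le> A_coef N \<phi> Y l"
        unfolding A_def A_star_def by (intro Min_le) (auto simp: cell_def)
      then show "A \<le> ?\<phi>2 (ldiff N Y l) + 2 * ?\<phi>2 (ldiff N Y (l - 1) + ldiff N Y l)
          + 2 * ?\<phi>2 (ldiff N Y (l + 1 - 1) + ldiff N Y (l + 1))"
        by (simp add: A_coef_def)
    qed
    then have "eps N * ((A - 5 * (A / 40)) * (\<Sum>l\<in>cell N. (ldiff N e l)\<^sup>2)) \<le> D2_E_a ?\<phi>2 (z s) e"
      unfolding D2_E_a_def using eps_pos by (intro mult_left_mono) auto
    moreover have "eps N * ((A - 5 * (A / 40)) * (\<Sum>l\<in>cell N. (ldiff N e l)\<^sup>2)) = 7 / 8 * A * V"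
      unfolding V_def by (simp add: algebra_simps)
    ultimately show ?thesis by (simp only:)
  qed
  have z1: "z 1 = Y" and z0: "z 0 = ya" by (auto simp: z_def e_def)
  have pos: "ldiff N ya l + s * ldiff N e l > 0" if "0 \<le> s" "s \<le> 1" for s l
    using z_\<mu>[OF that, of l] \<mu>(1) unfolding z_ldiff by linarith
  have D1: "((\<lambda>s. E_a N F \<phi> f (z s)) has_real_derivative D_E_a (deriv \<phi>) f (z s) e) (at s)"
    if "0 \<le> s" "s \<le> 1" for s
    unfolding z_def[abs_def] by (rule E_a_has_derivative[OF d1 pos[OF that]])
  have D2: "((\<lambda>s. D_E_a (deriv \<phi>) f (z s) e) has_real_derivative D2_E_a ?\<phi>2 (z s) e) (at s)"
    if "0 \<le> s" "s \<le> 1" for s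
    unfolding z_def[abs_def] by (rule D_E_a_has_derivative[OF d2 pos[OF that]])
  have crit: "D_E_a (deriv \<phi>) f (z 0) e = 0"
    unfolding z0 by (rule atomistic_critical[OF ya e d1])
  \<comment> \<open>The first variation in direction e vanishes at ya, so at Y it equals a second
    variation at an intermediate point, where the lower bound holds.\<close>
  have "\<exists>s. 0 < s \<and> s < 1 \<and> D_E_a (deriv \<phi>) f (z 1) e - D_E_a (deriv \<phi>) f (z 0) e
      = (1 - 0) * D2_E_a ?\<phi>2 (z s) e"
    by (rule MVT2) (use D2 in auto)
  then have "7 / 8 * A * V \<le> D_E_a (deriv \<phi>) f Y e"
    using lower crit by (auto simp: z1)
  \<comment> \<open>The choice \<alpha> = 48/(7A) turns 3/\<alpha> into 7A/16, half of the
    coefficient on the left.\<close>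
  also have "\<dots> \<le> (48 / (7 * A)) / 2 * S + 3 / (48 / (7 * A)) * V"
    unfolding S_def V_def Y_def by (rule residual_le[OF d1 min e]) (use A0 in auto)
  also have "3 / (48 / (7 * A)) * V = 7 / 16 * A * V"
    using A0 by simp
  finally have "7 / 16 * A * V \<le> 24 / (7 * A) * S" by simp
  then have "16 / (7 * A) * (7 / 16 * A * V) \<le> 16 / (7 * A) * (24 / (7 * A) * S)"
    using A0 by (intro mult_left_mono) auto
  then have V: "V \<le> 384 / 49 * (S / A\<^sup>2)"
    using A0 by (simp add: power2_eq_square)
  \<comment> \<open>The energy and its two derivatives along the segment, indexed by order as the
    Taylor theorem expects.\<close>
  define dd where "dd m = (if m = 0 then (\<lambda>s. E_a N F \<phi> f (z s))
    else if m = 1 then (\<lambda>s. D_E_a (deriv \<phi>) f (z s) e) else (\<lambda>s. D2_E_a ?\<phi>2 (z s) e))" for m :: nat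
  have "\<exists>t. 0 < t \<and> t < 1 \<and> E_a N F \<phi> f (z 1) = (\<Sum>m<2. dd m 0 / fact m * 1 ^ m) + dd 2 t / fact 2 * 1 ^ 2"
  proof (rule Maclaurin)
    show "\<forall>m t. m < 2 \<and> 0 \<le> t \<and> t \<le> 1 \<longrightarrow> (dd m has_real_derivative dd (Suc m) t) (at t)"
      using D1 D2 by (auto simp: dd_def less_2_cases_iff)
  qed (simp_all add: dd_def)
  then obtain t where t: "0 < t" "t < 1" "E_a N F \<phi> f Y = E_a N F \<phi> f ya + D2_E_a ?\<phi>2 (z t) e / 2"
    using crit by (auto simp: dd_def numeral_2_eq_2 z1 z0)
  \<comment> \<open>The suprema in \<open>C_H\<close> are nonnegative because they dominate absolute
    values at \<mu> and 2\<mu>.\<close>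
  have "\<bar>?\<phi>2 (2 * \<mu>)\<bar> \<le> M2 \<phi> (2 * \<mu>)" "\<bar>?\<phi>2 \<mu>\<bar> \<le> M2 \<phi> \<mu>"
    using \<mu>(1) by (auto intro!: M2_bound[OF bdd])
  then have CH: "0 \<le> C_H \<phi> \<mu>" unfolding C_H_def by linarith
  have "\<bar>E_a N F \<phi> f ya - E_a N F \<phi> f Y\<bar> \<le> C_H \<phi> \<mu> / 2 * V"
    using upper[of t] t by simp
  also have "\<dots> \<le> C_H \<phi> \<mu> / 2 * (384 / 49 * (S / A\<^sup>2))"
    by (rule mult_left_mono[OF V]) (use CH in simp)
  also have "\<dots> = 192 / 49 * (C_H \<phi> \<mu> * (S / A\<^sup>2))" by simp
  \<comment> \<open>192/49 is 3 times the square of 8/7, just below 4.\<close>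
  also have "\<dots> \<le> 4 * (C_H \<phi> \<mu> * (S / A\<^sup>2))"
  proof (rule mult_right_mono)
    have "0 \<le> S" by (simp add: S_def)
    with CH show "0 \<le> C_H \<phi> \<mu> * (S / A\<^sup>2)" by simp
  qed simp
  finally show ?thesis by (simp add: S_def A_def Y_def)
qed

end

text \<open>Boundedness of the second derivative beyond \<mu> is the case of finite suprema in
  \<open>C_H\<close>; in the other case the estimate is void. The almost everywhere inequality is
  the bound on the essential supremum of the gradient difference.\<close>

theorem theorem11:
  fixes N K :: nat and F rstar La Ra :: real and \<phi> f :: "real \<Rightarrow> real"
    and X :: "int \<Rightarrow> real" and yqc :: "real \<Rightarrow> real"
  assumes N: "N \<ge> 1" and F: "F > 0"
    and phi_C3: "Ck_on 3 {0<..} \<phi>"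
    and rstar: "rstar > 0"
    and phi_convex: "convex_on {0<..<rstar} \<phi>"
    and phi_concave: "concave_on {rstar<..} \<phi>"
    and f_cont: "continuous_on UNIV f"
    and f_per: "\<And>t. f (t + 1) = f t"
    and Om_a: "-1/2 < La" "La < Ra" "Ra < 1/2" "Ra - La \<ge> 2 * eps N"
    and mesh: "qc_mesh N La Ra K X"
    and f_C2: "f_regular N La Ra X f"
    and yqc_min: "local_minimizer (E_qc N F La Ra X \<phi> f) (Y_h_pos F X) yqc"
    and yqc_rstar: "\<And>l. ldiff N (nodal N yqc) l \<ge> rstar / 2"
    and yqc_stable: "A_star N \<phi> (nodal N yqc) > 0"
  shows "\<exists>\<tau>0>0. \<forall>\<tau>\<in>{0<..\<tau>0}. \<forall>ya :: int \<Rightarrow> real. \<forall>\<mu>>0.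
    local_minimizer (E_a N F \<phi> f) (Y_eps_pos N F) ya \<longrightarrow>
    (AE t in lborel. t \<in> Om \<longrightarrow> \<bar>deriv (pw_interp (lat N) ya) t - deriv yqc t\<bar> \<le> \<tau>) \<longrightarrow>
    (\<forall>l. ldiff N ya l \<ge> \<mu>) \<longrightarrow>
    (\<forall>l. ldiff N (nodal N yqc) l \<ge> \<mu>) \<longrightarrow>
    bdd_above ((\<lambda>s. \<bar>deriv (deriv \<phi>) s\<bar>) ` {\<mu>..}) \<longrightarrow>
    \<bar>E_a N F \<phi> f ya - E_qc N F La Ra X \<phi> f yqc\<bar>
      \<le> 4 * C_H \<phi> \<mu> / (A_star N \<phi> (nodal N yqc))\<^sup>2
           * ((eta N La Ra K X \<phi> yqc)\<^sup>2 + (eta_f N La Ra K X f)\<^sup>2 + (eta_q N La Ra K X f)\<^sup>2)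
         + mu_est N La Ra K X \<phi> yqc + mu_f N F La Ra K X f yqc + mu_q N F La Ra K X f yqc"
proof -
  interpret qc_force N K La Ra X f
    by unfold_locales (use N Om_a mesh f_cont f_per f_C2 in auto)
  let ?\<phi>2 = "deriv (deriv \<phi>)" and ?d = "ldiff N (nodal N yqc)"
  have "Ck_on 2 {0<..} \<phi>" using phi_C3 by (rule Ck_on_less) simp
  then obtain g1 g2 where "\<And>t. t \<in> interior {0<..} \<Longrightarrow> C2_at \<phi> t \<and> deriv \<phi> t = g1 t \<and> ?\<phi>2 t = g2 t"
    using Ck_on_2_deriv by metis
  then have C2: "C2_at \<phi> s" if "s > 0" for s using that by (simp add: interior_open)
  have d1: "(\<phi> has_real_derivative deriv \<phi> s) (at s)"
    and d2: "(deriv \<phi> has_real_derivative ?\<phi>2 s) (at s)"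
    and d3: "isCont ?\<phi>2 s" if "s > 0" for s
    using C2[OF that] by (auto simp: C2_at_def)
  have yY: "yqc \<in> Y_h F X" using yqc_min by (simp add: local_minimizer_def Y_h_pos_def)
  have yP: "yqc \<in> P1 X" using yY by (simp add: Y_h_def)
  have dpos: "?d l > 0" for l using yqc_rstar[of l] rstar by linarith
  \<comment> \<open>Two neighbouring strains add up to at least rstar, where \<phi> is
    concave.\<close>
  have second: "?\<phi>2 (?d (l - 1) + ?d l) \<le> 0" for l
    using rstar yqc_rstar[of l] yqc_rstar[of "l - 1"]
    by (intro deriv_deriv_nonpos[OF phi_concave, of "deriv \<phi>"] d1 d2 d3) auto
  \<comment> \<open>All first and second neighbour strains of yqc. By periodicity they form a finite
    set, and \<open>\<tau>0\<close> is obtained from this set, \<phi> and \<open>A_star\<close>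
    before ya and \<mu> are fixed.\<close>
  define S where "S = range ?d \<union> range (\<lambda>l. ?d (l - 1) + ?d l)"
  have per: "?d (l + 2 * int N) = ?d l" for l
    by (rule ldiff_per) (rule nodal_per, rule Y_h_per[OF yY])
  have fin: "finite (range h)" if "\<And>l. h (l + 2 * int N) = h l" for h :: "int \<Rightarrow> real"
  proof (rule finite_subset)
    show "range h \<subseteq> h ` cell N"
    proof
      fix x assume "x \<in> range h"
      then obtain l where "x = h l" by blast
      obtain l' m where l: "l = l' + int (2 * N) * m" "l' \<in> cell N" by (rule reduce_cell)
      have "h l = h l'" unfolding l(1) by (rule lattice.per_mult) (use that in simp)
      then show "x \<in> h ` cell N" using \<open>x = h l\<close> l(2) by blast
    qed
  qed (simp add: cell_def)
  have per': "?d (l + 2 * int N - 1) = ?d (l - 1)" for l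
    using per[of "l - 1"] by (simp add: algebra_simps)
  have "finite S" unfolding S_def using per per' by (intro finite_UnI fin) simp_all
  moreover have "isCont ?\<phi>2 s" if "s \<in> S" for s
    using that dpos by (intro d3) (auto simp: S_def intro: add_pos_pos)
  moreover have "A_star N \<phi> (nodal N yqc) / 40 > 0" using yqc_stable by simp
  ultimately have "\<exists>\<tau>>0. \<forall>s\<in>S. \<forall>x. \<bar>x - s\<bar> \<le> 2 * \<tau> \<longrightarrow>
      ?\<phi>2 x \<ge> ?\<phi>2 s - A_star N \<phi> (nodal N yqc) / 40"
    by (rule uniform_lower_bound)
  then obtain \<tau>0 where \<tau>0: "\<tau>0 > 0"
    "\<And>s x. s \<in> S \<Longrightarrow> \<bar>x - s\<bar> \<le> 2 * \<tau>0 \<Longrightarrow> ?\<phi>2 x \<ge> ?\<phi>2 s - A_star N \<phi> (nodal N yqc) / 40"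
    by auto
  show ?thesis
  proof (intro exI[of _ \<tau>0] conjI ballI allI impI)
    fix \<tau> \<mu> :: real and ya :: "int \<Rightarrow> real"
    assume \<tau>: "\<tau> \<in> {0<..\<tau>0}" and \<mu>: "\<mu> > 0"
      and ya: "local_minimizer (E_a N F \<phi> f) (Y_eps_pos N F) ya"
      and ae: "AE t in lborel. t \<in> Om \<longrightarrow> \<bar>deriv (pw_interp (lat N) ya) t - deriv yqc t\<bar> \<le> \<tau>"
      and \<mu>a: "\<forall>l. ldiff N ya l \<ge> \<mu>" and \<mu>q: "\<forall>l. ?d l \<ge> \<mu>"
      and bdd: "bdd_above ((\<lambda>s. \<bar>?\<phi>2 s\<bar>) ` {\<mu>..})"
    have yaper: "ya (l + 2 * int N) = ya l + F" for l
      using ya by (simp add: local_minimizer_def Y_eps_pos_def Y_eps_def)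
    have close: "\<bar>ldiff N ya l - ?d l\<bar> \<le> \<tau>0" for l
      using ldiff_dist[OF yP Y_h_per[OF yY] yaper ae, of l] \<tau> by simp
    have "\<bar>E_a N F \<phi> f ya - E_a N F \<phi> f (nodal N yqc)\<bar>
      \<le> 4 * C_H \<phi> \<mu> / (A_star N \<phi> (nodal N yqc))\<^sup>2
         * ((eta N La Ra K X \<phi> yqc)\<^sup>2 + (eta_f N La Ra K X f)\<^sup>2 + (eta_q N La Ra K X f)\<^sup>2)"
      by (rule atomistic_error[OF d1 d2 yqc_min ya \<mu> _ _ bdd yqc_stable second close])
        (use \<mu>a \<mu>q \<tau>0(2) in \<open>auto simp: S_def\<close>)
    then show "\<bar>E_a N F \<phi> f ya - E_qc N F La Ra X \<phi> f yqc\<bar>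
      \<le> 4 * C_H \<phi> \<mu> / (A_star N \<phi> (nodal N yqc))\<^sup>2
           * ((eta N La Ra K X \<phi> yqc)\<^sup>2 + (eta_f N La Ra K X f)\<^sup>2 + (eta_q N La Ra K X f)\<^sup>2)
         + mu_est N La Ra K X \<phi> yqc + mu_f N F La Ra K X f yqc + mu_q N F La Ra K X f yqc"
      using energy_consistency[OF yY, of \<phi>] by linarith
  qed (rule \<tau>0(1))
qed

end
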